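(* Let $Y$ be a clean (in particular compact) robust heteroclinic network with equilibria $\xi_1,\dots,\xi_N$, such that for every equilibrium $\xi_j\in Y$ there are constants $A_j>0$ and $\rho_j>0$ such that all nearby trajectories passing through $N_{\tilde\delta}(\xi_j)$ satisfy $$d(\Phi(\tau^{out},x),Y)<A_j\,\big(d(\Phi(\tau^{in},x),Y)\big)^{\rho_j}.$$ Suppose also that for any heteroclinic cycle $X\subset Y$, with equilibria (after relabelling) $\xi_1,\dots,\xi_m$, we have $$\rho(X)>1,\qquad\text{where}\quad \rho(X)=\prod_{1\le j\le m}\rho_j .$$ Then $Y$ is asymptotically stable.
   Context: Consider a smooth system $\dot x=f(x)$ in $\mathbb{R}^n$ with flow $\Phi(\tau,x)$. For a hyperbolic equilibrium $\xi$, $W^u(\xi)=\{x:\alpha(x)=\xi\}$, $W^s(\xi)=\{x:\omega(x)=\xi\}$; the connection from $\xi_i$ to $\xi_j$ is $C_{ij}=W^u(\xi_i)\cap W^s(\xi_j)$. A heteroclinic cycle is a union of finitely many hyperbolic equilibria $\xi_1,\dots,\xi_m$ and heteroclinic connections $C_{j,j+1}$, $1\le j\le m$, $\xi_{m+1}=\xi_1$. A heteroclinic network is a connected union of finitely many heteroclinic cycles; it is robust if each connection $C_{ij}$ belongs to a flow-invariant subspace $S_{ij}$ in which it is of saddle-sink type. The networks considered consist of finitely many hyperbolic equilibria and heteroclinic connections. A compact invariant set $Y$ is clean if each invariant subset $X\subseteq Y$ satisfies $W^u(X)\subseteq Y$. $d(x,Y)$ is the distance from $x$ to $Y$ (maximum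 norm). For a fixed small $\tilde\delta>0$, $N_{\tilde\delta}(\xi_j)$ is the neighbourhood of $\xi_j$ bounded by $|a_m|=\tilde\delta$, where $a_m$ are the coordinates centred at $\xi_j$ in a basis of eigenvectors of $\mathrm{d}f(\xi_j)$; these neighbourhoods are disjoint. $\tau^{in}$ and $\tau^{out}$ are the times at which the trajectory $\Phi(\tau,x)$ enters and exits $N_{\tilde\delta}(\xi_j)$. "Nearby trajectories" are those in a $\delta$-neighbourhood of $Y$, for some sufficiently small $\delta\ll\tilde\delta$, which are not contained in $Y$ and enter and exit $N_{\tilde\delta}(\xi_j)$. A set $Y$ is Lyapunov stable if for any neighbourhood $U$ of $Y$ there is a neighbourhood $V$ of $Y$ such that $\Phi(\tau,x)\in U$ for all $x\in V$, $\tau>0$. It is asymptotically stable if it is Lyapunov stable and in addition $V$ can be chosen such that $\lim_{\tau\to\infty}d(\Phi(\tau,x),Y)=0$ for all $x\in V$. *)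

theory Defs
  imports "HOL-Analysis.Analysis"
begin

section \<open>Smooth vector fields and their flows\<close>

text \<open>A function is $C^{k+1}$ iff it is differentiable and all its directional derivatives
  are $C^k$; smooth means $C^\infty$.\<close>

primrec Ck :: "nat \<Rightarrow> ('a::euclidean_space \<Rightarrow> 'b::real_normed_vector) \<Rightarrow> bool" where
  "Ck 0 f \<longleftrightarrow> continuous_on UNIV f"
| "Ck (Suc k) f \<longleftrightarrow>
     f differentiable_on UNIV \<and> (\<forall>v. Ck k (\<lambda>x. frechet_derivative f (at x) v))"

definition smooth :: "('a::euclidean_space \<Rightarrow> 'b::real_normed_vector) \<Rightarrow> bool" where
  "smooth f \<longleftrightarrow> (\<forall>k. Ck k f)"

definition solution_on ::
  "('a::euclidean_space \<Rightarrow> 'a) \<Rightarrow> 'a \<Rightarrow> real set \<Rightarrow> (real \<Rightarrow> 'a) \<Rightarrow> bool" where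
  "solution_on f x J \<phi> \<longleftrightarrow> open J \<and> is_interval J \<and> 0 \<in> J \<and> \<phi> 0 = x \<and>
     (\<forall>t\<in>J. (\<phi> has_vector_derivative f (\<phi> t)) (at t))"

text \<open>A smooth field need not be complete, so the flow \<open>\<Phi>\<close> is the maximal local one:
  \<open>I x\<close> is the maximal interval of existence of the trajectory through \<open>x\<close>, and
  \<open>\<Phi> t x\<close> is meaningful only for \<open>t \<in> I x\<close>. For smooth \<open>f\<close> such \<open>I\<close> and \<open>\<Phi>\<close> exist, and
  they are unique up to the values of \<open>\<Phi>\<close> outside \<open>I\<close>.\<close>

definition flow_of ::
  "('a::euclidean_space \<Rightarrow> 'a) \<Rightarrow> ('a \<Rightarrow> real set) \<Rightarrow> (real \<Rightarrow> 'a \<Rightarrow> 'a) \<Rightarrow> bool" where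
  "flow_of f I \<Phi> \<longleftrightarrow> (\<forall>x. solution_on f x (I x) (\<lambda>t. \<Phi> t x) \<and>
     (\<forall>J \<psi>. solution_on f x J \<psi> \<longrightarrow> J \<subseteq> I x \<and> (\<forall>t\<in>J. \<psi> t = \<Phi> t x)))"

definition flow_invariant ::
  "('a \<Rightarrow> real set) \<Rightarrow> (real \<Rightarrow> 'a \<Rightarrow> 'a) \<Rightarrow> 'a set \<Rightarrow> bool" where
  "flow_invariant I \<Phi> X \<longleftrightarrow> (\<forall>x\<in>X. \<forall>t\<in>I x. \<Phi> t x \<in> X)"

text \<open>These sets are empty for trajectories that cease to exist in finite backward or
  forward time, respectively.\<close>

definition alpha_limit ::
  "('a::euclidean_space \<Rightarrow> real set) \<Rightarrow> (real \<Rightarrow> 'a \<Rightarrow> 'a) \<Rightarrow> 'a \<Rightarrow> 'a set" where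
  "alpha_limit I \<Phi> x = {y. \<exists>t :: nat \<Rightarrow> real. range t \<subseteq> I x \<and>
     filterlim t at_bot sequentially \<and> (\<lambda>k. \<Phi> (t k) x) \<longlonglongrightarrow> y}"

definition omega_limit ::
  "('a::euclidean_space \<Rightarrow> real set) \<Rightarrow> (real \<Rightarrow> 'a \<Rightarrow> 'a) \<Rightarrow> 'a \<Rightarrow> 'a set" where
  "omega_limit I \<Phi> x = {y. \<exists>t :: nat \<Rightarrow> real. range t \<subseteq> I x \<and>
     filterlim t at_top sequentially \<and> (\<lambda>k. \<Phi> (t k) x) \<longlonglongrightarrow> y}"

section \<open>Hyperbolic equilibria\<close>

definition complexify :: "real ^ 'n \<Rightarrow> complex ^ 'n" where
  "complexify x = (\<chi> i. complex_of_real (x $ i))"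

definition complex_jacobian :: "(real ^ 'n \<Rightarrow> real ^ 'n) \<Rightarrow> real ^ 'n \<Rightarrow> complex ^ 'n ^ 'n" where
  "complex_jacobian f \<xi> = (\<chi> i j. complex_of_real (jacobian f (at \<xi>) $ i $ j))"

definition eigenvector :: "complex ^ 'n ^ 'n \<Rightarrow> complex \<Rightarrow> complex ^ 'n \<Rightarrow> bool" where
  "eigenvector M \<mu> v \<longleftrightarrow> v \<noteq> 0 \<and> M *v v = \<mu> *s v"

text \<open>The (complex) eigenvalues of the restriction of \<open>df(\<xi>)\<close> to a real subspace \<open>S\<close>: the
  eigenvectors range over the complexification $S \oplus iS$.\<close>

definition eigenvalues_on ::
  "(real ^ 'n \<Rightarrow> real ^ 'n) \<Rightarrow> real ^ 'n \<Rightarrow> (real ^ 'n) set \<Rightarrow> complex set" where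
  "eigenvalues_on f \<xi> S = {\<mu>. \<exists>u\<in>S. \<exists>w\<in>S.
     eigenvector (complex_jacobian f \<xi>) \<mu> (complexify u + \<i> *s complexify w)}"

definition hyperbolic_equilibrium :: "(real ^ 'n \<Rightarrow> real ^ 'n) \<Rightarrow> real ^ 'n \<Rightarrow> bool" where
  "hyperbolic_equilibrium f \<xi> \<longleftrightarrow> f \<xi> = 0 \<and> (\<forall>\<mu>\<in>eigenvalues_on f \<xi> UNIV. Re \<mu> \<noteq> 0)"

definition saddle_in :: "(real ^ 'n \<Rightarrow> real ^ 'n) \<Rightarrow> (real ^ 'n) set \<Rightarrow> real ^ 'n \<Rightarrow> bool" where
  "saddle_in f S \<xi> \<longleftrightarrow> \<xi> \<in> S \<and> f \<xi> = 0 \<and> (\<forall>\<mu>\<in>eigenvalues_on f \<xi> S. Re \<mu> \<noteq> 0) \<and>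
     (\<exists>\<mu>\<in>eigenvalues_on f \<xi> S. Re \<mu> > 0) \<and> (\<exists>\<mu>\<in>eigenvalues_on f \<xi> S. Re \<mu> < 0)"

definition sink_in :: "(real ^ 'n \<Rightarrow> real ^ 'n) \<Rightarrow> (real ^ 'n) set \<Rightarrow> real ^ 'n \<Rightarrow> bool" where
  "sink_in f S \<xi> \<longleftrightarrow> \<xi> \<in> S \<and> f \<xi> = 0 \<and> (\<forall>\<mu>\<in>eigenvalues_on f \<xi> S. Re \<mu> < 0)"

section \<open>Connections, cycles and networks\<close>

definition W_u ::
  "('a::euclidean_space \<Rightarrow> real set) \<Rightarrow> (real \<Rightarrow> 'a \<Rightarrow> 'a) \<Rightarrow> 'a \<Rightarrow> 'a set" where
  "W_u I \<Phi> \<xi> = {x. alpha_limit I \<Phi> x = {\<xi>}}"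

definition W_s ::
  "('a::euclidean_space \<Rightarrow> real set) \<Rightarrow> (real \<Rightarrow> 'a \<Rightarrow> 'a) \<Rightarrow> 'a \<Rightarrow> 'a set" where
  "W_s I \<Phi> \<xi> = {x. omega_limit I \<Phi> x = {\<xi>}}"

text \<open>The unstable set of an invariant set. Non-emptiness excludes trajectories that escape in
  backward time; for a one-point set this is \<^const>\<open>W_u\<close>.\<close>

definition W_u_set ::
  "('a::euclidean_space \<Rightarrow> real set) \<Rightarrow> (real \<Rightarrow> 'a \<Rightarrow> 'a) \<Rightarrow> 'a set \<Rightarrow> 'a set" where
  "W_u_set I \<Phi> X = {x. alpha_limit I \<Phi> x \<noteq> {} \<and> alpha_limit I \<Phi> x \<subseteq> X}"

definition connection ::
  "('a::euclidean_space \<Rightarrow> real set) \<Rightarrow> (real \<Rightarrow> 'a \<Rightarrow> 'a) \<Rightarrow> 'a \<Rightarrow> 'a \<Rightarrow> 'a set" where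
  "connection I \<Phi> \<xi> \<eta> = W_u I \<Phi> \<xi> \<inter> W_s I \<Phi> \<eta>"

text \<open>A connection must contain a non-constant trajectory. Removing \<open>\<xi>\<close> only matters for
  \<open>\<xi> = \<eta>\<close>, because the equilibrium \<open>\<xi>\<close> itself lies in \<open>W_u I \<Phi> \<xi> \<inter> W_s I \<Phi> \<xi>\<close>.\<close>

definition connected_to ::
  "('a::euclidean_space \<Rightarrow> real set) \<Rightarrow> (real \<Rightarrow> 'a \<Rightarrow> 'a) \<Rightarrow> 'a \<Rightarrow> 'a \<Rightarrow> bool" where
  "connected_to I \<Phi> \<xi> \<eta> \<longleftrightarrow> connection I \<Phi> \<xi> \<eta> - {\<xi>} \<noteq> {}"

text \<open>A cycle is given by the list of its (pairwise distinct) equilibria in cyclic order.\<close>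

definition heteroclinic_cycle ::
  "(real ^ 'n \<Rightarrow> real ^ 'n) \<Rightarrow> (real ^ 'n \<Rightarrow> real set) \<Rightarrow> (real \<Rightarrow> real ^ 'n \<Rightarrow> real ^ 'n) \<Rightarrow>
    (real ^ 'n) list \<Rightarrow> bool" where
  "heteroclinic_cycle f I \<Phi> xs \<longleftrightarrow> xs \<noteq> [] \<and> distinct xs \<and>
     (\<forall>\<xi>\<in>set xs. hyperbolic_equilibrium f \<xi>) \<and>
     (\<forall>j<length xs. connected_to I \<Phi> (xs ! j) (xs ! (Suc j mod length xs)))"

definition cycle_set ::
  "('a::euclidean_space \<Rightarrow> real set) \<Rightarrow> (real \<Rightarrow> 'a \<Rightarrow> 'a) \<Rightarrow> 'a list \<Rightarrow> 'a set" where
  "cycle_set I \<Phi> xs = set xs \<union>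
     (\<Union>j<length xs. connection I \<Phi> (xs ! j) (xs ! (Suc j mod length xs)))"

definition heteroclinic_network ::
  "(real ^ 'n \<Rightarrow> real ^ 'n) \<Rightarrow> (real ^ 'n \<Rightarrow> real set) \<Rightarrow> (real \<Rightarrow> real ^ 'n \<Rightarrow> real ^ 'n) \<Rightarrow>
    (real ^ 'n) set \<Rightarrow> bool" where
  "heteroclinic_network f I \<Phi> Y \<longleftrightarrow> connected Y \<and>
     (\<exists>K. finite K \<and> K \<noteq> {} \<and> (\<forall>xs\<in>K. heteroclinic_cycle f I \<Phi> xs) \<and>
          Y = (\<Union>xs\<in>K. cycle_set I \<Phi> xs))"

definition equilibria_in :: "('a::euclidean_space \<Rightarrow> 'a) \<Rightarrow> 'a set \<Rightarrow> 'a set" where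
  "equilibria_in f Y = {\<xi>\<in>Y. f \<xi> = 0}"

definition robust ::
  "(real ^ 'n \<Rightarrow> real ^ 'n) \<Rightarrow> (real ^ 'n \<Rightarrow> real set) \<Rightarrow> (real \<Rightarrow> real ^ 'n \<Rightarrow> real ^ 'n) \<Rightarrow>
    (real ^ 'n) set \<Rightarrow> bool" where
  "robust f I \<Phi> Y \<longleftrightarrow>
     (\<forall>\<xi>\<in>equilibria_in f Y. \<forall>\<eta>\<in>equilibria_in f Y.
        connected_to I \<Phi> \<xi> \<eta> \<and> connection I \<Phi> \<xi> \<eta> \<subseteq> Y \<longrightarrow>
        (\<exists>S. subspace S \<and> flow_invariant I \<Phi> S \<and> connection I \<Phi> \<xi> \<eta> \<subseteq> S \<and>
             saddle_in f S \<xi> \<and> sink_in f S \<eta>))"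

definition clean ::
  "('a::euclidean_space \<Rightarrow> real set) \<Rightarrow> (real \<Rightarrow> 'a \<Rightarrow> 'a) \<Rightarrow> 'a set \<Rightarrow> bool" where
  "clean I \<Phi> Y \<longleftrightarrow> compact Y \<and> flow_invariant I \<Phi> Y \<and>
     (\<forall>X\<subseteq>Y. flow_invariant I \<Phi> X \<longrightarrow> W_u_set I \<Phi> X \<subseteq> Y)"

section \<open>Passages near equilibria\<close>

text \<open>\<^const>\<open>infnorm\<close> is the maximum norm.\<close>

definition max_dist :: "'a::euclidean_space \<Rightarrow> 'a set \<Rightarrow> real" where
  "max_dist x Y = (INF y\<in>Y. infnorm (x - y))"

text \<open>Eigenvalues may be non-real, so eigenvectors and the coordinates $a_m$ are complex.\<close>

definition eigenbasis ::
  "(real ^ 'n \<Rightarrow> real ^ 'n) \<Rightarrow> real ^ 'n \<Rightarrow> ('n \<Rightarrow> complex ^ 'n) \<Rightarrow> bool" where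
  "eigenbasis f \<xi> v \<longleftrightarrow> inj v \<and> vec.independent (range v) \<and>
     (\<forall>m. \<exists>\<mu>. eigenvector (complex_jacobian f \<xi>) \<mu> (v m))"

definition eigenbox :: "('n \<Rightarrow> complex ^ 'n) \<Rightarrow> real \<Rightarrow> real ^ 'n \<Rightarrow> (real ^ 'n) set" where
  "eigenbox v r \<xi> = {x. \<exists>a. complexify (x - \<xi>) = (\<Sum>m\<in>UNIV. a m *s v m) \<and> (\<forall>m. cmod (a m) < r)}"

text \<open>The trajectory through \<open>x\<close> enters the open set \<open>B\<close> at time \<open>s\<close> and next exits it at
  time \<open>e\<close>; its positions at these two times lie on the boundary of \<open>B\<close>.\<close>

definition passage ::
  "('a::euclidean_space \<Rightarrow> real set) \<Rightarrow> (real \<Rightarrow> 'a \<Rightarrow> 'a) \<Rightarrow> 'a set \<Rightarrow> 'a \<Rightarrow> real \<Rightarrow> real \<Rightarrow> bool" where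
  "passage I \<Phi> B x s e \<longleftrightarrow> s < e \<and> {s..e} \<subseteq> I x \<and>
     \<Phi> s x \<notin> B \<and> \<Phi> e x \<notin> B \<and> (\<forall>t\<in>{s<..<e}. \<Phi> t x \<in> B)"

definition nearby_passage ::
  "('a::euclidean_space \<Rightarrow> real set) \<Rightarrow> (real \<Rightarrow> 'a \<Rightarrow> 'a) \<Rightarrow> 'a set \<Rightarrow> real \<Rightarrow>
    'a set \<Rightarrow> 'a \<Rightarrow> real \<Rightarrow> real \<Rightarrow> bool" where
  "nearby_passage I \<Phi> Y \<delta> B x s e \<longleftrightarrow> passage I \<Phi> B x s e \<and>
     \<not> (\<lambda>t. \<Phi> t x) ` I x \<subseteq> Y \<and> (\<forall>t\<in>{s..e}. max_dist (\<Phi> t x) Y < \<delta>)"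

section \<open>Stability\<close>

definition lyapunov_stable ::
  "('a::euclidean_space \<Rightarrow> real set) \<Rightarrow> (real \<Rightarrow> 'a \<Rightarrow> 'a) \<Rightarrow> 'a set \<Rightarrow> bool" where
  "lyapunov_stable I \<Phi> Y \<longleftrightarrow>
     (\<forall>U. open U \<and> Y \<subseteq> U \<longrightarrow>
       (\<exists>V. open V \<and> Y \<subseteq> V \<and> (\<forall>x\<in>V. \<forall>t>0. t \<in> I x \<and> \<Phi> t x \<in> U)))"

definition asymptotically_stable ::
  "('a::euclidean_space \<Rightarrow> real set) \<Rightarrow> (real \<Rightarrow> 'a \<Rightarrow> 'a) \<Rightarrow> 'a set \<Rightarrow> bool" where
  "asymptotically_stable I \<Phi> Y \<longleftrightarrow> lyapunov_stable I \<Phi> Y \<and>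
     (\<exists>V. open V \<and> Y \<subseteq> V \<and>
       (\<forall>x\<in>V. {0<..} \<subseteq> I x \<and> ((\<lambda>t. max_dist (\<Phi> t x) Y) \<longlongrightarrow> 0) at_top))"

end

theory Submission
  imports Defs
begin

text \<open>Write \<open>D x\<close> for the distance from \<open>x\<close> to \<open>Y\<close> and \<open>E\<close> for the set of equilibria in \<open>Y\<close>.
  Cleanness puts the unstable set of every \<open>\<xi> \<in> E\<close> into \<open>Y\<close>. Hence every directed cycle of the
  graph \<open>connected_to\<close> on \<open>E\<close> is a heteroclinic cycle inside \<open>Y\<close>, and the product of the exponents
  \<open>\<rho>\<close> along it exceeds 1. For such a graph there are weights \<open>\<theta> > 0\<close> and a factor \<open>\<Lambda> > 1\<close> with
  \<open>\<Lambda> * \<theta> \<xi> \<le> \<rho> \<xi> * \<theta> \<kappa>\<close> along every edge from \<open>\<xi>\<close> to \<open>\<kappa>\<close> (\<open>cycle_potential\<close>). If a nearby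
  trajectory visits equilibria in the order prescribed by the edges, then the estimate
  \<open>D_out < A * D_in powr \<rho> \<xi>\<close> makes the quantity \<open>- \<theta> \<xi> * ln D\<close> grow at each visit: up to an
  additive constant it is multiplied by \<open>\<Lambda>\<close> (\<open>level_gain\<close>). Once it is large it tends to infinity,
  and this is stability and attraction at the same time.

  Two things have to be controlled. The first is the distance to \<open>Y\<close> during a visit. Along a piece
  of trajectory of bounded duration, \<open>D\<close> changes at most by a constant factor (\<open>growth\<close>), but a
  visit to an equilibrium may last arbitrarily long. Here hyperbolicity enters: in the eigenbasis
  the form \<open>\<Sum>m. sgn (Re (\<mu> m)) * (cmod (a m))\<^sup>2\<close> increases strictly along non-constant trajectories
  near \<open>\<xi>\<close>, so an orbit that stays near \<open>\<xi>\<close> for all negative times lies in the unstable set of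
  \<open>\<xi>\<close>, hence in \<open>Y\<close>. A compactness argument then shows that a trajectory that starts near \<open>Y\<close>
  remains near \<open>Y\<close> as long as it stays in a small ball around \<open>\<xi>\<close> (\<open>local_stability\<close>).

  The second is the order of the visits. A trajectory that leaves \<open>\<xi>\<close> after a close visit follows
  the unstable set of \<open>\<xi>\<close>, and a point of it other than \<open>\<xi>\<close> lies on a connection to some
  \<open>\<kappa> \<noteq> \<xi>\<close>; the case \<open>\<kappa> = \<xi>\<close> is excluded by robustness, as \<open>\<xi>\<close> would be a saddle and a sink in the
  same subspace. But for a fixed notion of closeness the trajectory only shadows some orbit in \<open>Y\<close>
  up to the limit \<open>\<kappa>\<close> of that orbit, and the orbit may pass other equilibria \<open>e\<close> on its way, so that
  \<open>\<xi>\<close> and \<open>\<kappa>\<close> need not be joined by an edge. If \<open>\<rho> e > 1\<close>, such a bounded passage is impossible: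
  \<open>D\<close> would change at most by a constant factor and yet satisfy \<open>D_out < A * D_in powr \<rho> e\<close> with
  arbitrarily small \<open>D_in\<close> (\<open>strong_equilibrium_not_skipped\<close>). If \<open>\<rho> e \<le> 1\<close>, then the weight
  grows along every edge that leaves \<open>e\<close>, and skipping \<open>e\<close> preserves the inequality
  \<open>\<Lambda> * \<theta> \<xi> \<le> \<rho> \<xi> * \<theta> \<kappa>\<close> (\<open>successor_allowed\<close>). So the inequality holds for all consecutive visits,
  and that is all that the growth argument uses.\<close>

section \<open>Continuous dependence on initial conditions\<close>

text \<open>The squared distance of two solutions, multiplied by \<open>exp (- 2 * K * t)\<close>, does not increase:
  by the Lipschitz bound and the Cauchy-Schwarz inequality its derivative is non-positive.\<close>

lemma gronwall:
  fixes u w :: "real \<Rightarrow> 'a::euclidean_space"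
  assumes "0 \<le> T"
    and u: "\<And>t. t \<in> {0..T} \<Longrightarrow> (u has_vector_derivative F (u t)) (at t)"
    and w: "\<And>t. t \<in> {0..T} \<Longrightarrow> (w has_vector_derivative F (w t)) (at t)"
    and S: "\<And>t. t \<in> {0..T} \<Longrightarrow> u t \<in> S \<and> w t \<in> S"
    and lip: "\<And>x y. x \<in> S \<Longrightarrow> y \<in> S \<Longrightarrow> norm (F x - F y) \<le> K * norm (x - y)"
  shows "norm (u T - w T) \<le> exp (K * T) * norm (u 0 - w 0)"
proof -
  define g where "g t = exp (- 2 * K * t) * ((u t - w t) \<bullet> (u t - w t))" for t
  define g' where "g' t = exp (- 2 * K * t) * (2 * ((u t - w t) \<bullet> (F (u t) - F (w t)))) +
      (- 2 * K * exp (- 2 * K * t)) * ((u t - w t) \<bullet> (u t - w t))" for t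
  have der: "(g has_real_derivative g' t) (at t)" if "t \<in> {0..T}" for t
  proof -
    have 1: "((\<lambda>t. u t - w t) has_vector_derivative F (u t) - F (w t)) (at t)"
      by (intro has_vector_derivative_diff u w that)
    have 2: "((\<lambda>t. (u t - w t) \<bullet> (u t - w t)) has_vector_derivative
        2 * ((u t - w t) \<bullet> (F (u t) - F (w t)))) (at t)"
      using bounded_bilinear.has_vector_derivative[OF bounded_bilinear_inner 1 1]
      by (simp add: inner_commute)
    have 3: "((\<lambda>t. exp (- 2 * K * t)) has_vector_derivative (- 2 * K * exp (- 2 * K * t))) (at t)"
      unfolding has_real_derivative_iff_has_vector_derivative[symmetric]
      by (auto intro!: derivative_eq_intros)
    show ?thesis
      unfolding g_def g'_def has_real_derivative_iff_has_vector_derivative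
      using has_vector_derivative_mult[OF 3 2] by (simp add: add.commute)
  qed
  have neg: "g' t \<le> 0" if "t \<in> {0..T}" for t
  proof -
    have "(u t - w t) \<bullet> (F (u t) - F (w t)) \<le> norm (u t - w t) * norm (F (u t) - F (w t))"
      by (rule norm_cauchy_schwarz)
    also have "\<dots> \<le> norm (u t - w t) * (K * norm (u t - w t))"
      using lip S[OF that] by (intro mult_left_mono) auto
    also have "\<dots> = K * ((u t - w t) \<bullet> (u t - w t))"
      by (simp add: power2_norm_eq_inner[symmetric] power2_eq_square)
    finally have le: "(u t - w t) \<bullet> (F (u t) - F (w t)) \<le> K * ((u t - w t) \<bullet> (u t - w t))" .
    have "g' t = 2 * exp (- 2 * K * t) *
        ((u t - w t) \<bullet> (F (u t) - F (w t)) - K * ((u t - w t) \<bullet> (u t - w t)))"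
      unfolding g'_def by (simp add: algebra_simps)
    also have "\<dots> \<le> 0" using le by (intro mult_nonneg_nonpos) auto
    finally show ?thesis .
  qed
  have "g T \<le> g 0"
    by (rule DERIV_nonpos_imp_nonincreasing[OF \<open>0 \<le> T\<close>]) (use der neg in fastforce)
  hence "exp (- 2 * K * T) * (norm (u T - w T))\<^sup>2 \<le> (norm (u 0 - w 0))\<^sup>2"
    by (simp add: g_def power2_norm_eq_inner)
  hence "(exp (K * T))\<^sup>2 * (exp (- 2 * K * T) * (norm (u T - w T))\<^sup>2) \<le> (exp (K * T))\<^sup>2 * (norm (u 0 - w 0))\<^sup>2"
    by (intro mult_left_mono) auto
  moreover have "(exp (K * T))\<^sup>2 * exp (- 2 * K * T) = 1"
    by (simp add: power2_eq_square exp_add[symmetric])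
  ultimately have "(norm (u T - w T))\<^sup>2 \<le> (exp (K * T) * norm (u 0 - w 0))\<^sup>2"
    by (metis mult.assoc mult_1 power_mult_distrib)
  thus ?thesis by (rule power2_le_imp_le) simp
qed

lemma first_hitting_time:
  fixes g :: "real \<Rightarrow> 'a::metric_space"
  assumes "a \<le> b" "continuous_on {a..b} g" "closed C" "g b \<in> C"
  obtains t where "a \<le> t" "t \<le> b" "g t \<in> C" "\<And>s. a \<le> s \<Longrightarrow> s < t \<Longrightarrow> g s \<notin> C"
proof -
  let ?S = "{a..b} \<inter> g -` C"
  have "closed ?S" by (intro continuous_closed_preimage assms) auto
  hence "compact ({a..b} \<inter> ?S)" by (intro compact_Int_closed) auto
  moreover have "{a..b} \<inter> ?S = ?S" by auto
  ultimately have "compact ?S" by simp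
  moreover have "?S \<noteq> {}" using assms by auto
  ultimately obtain t where t: "t \<in> ?S" "\<And>s. s \<in> ?S \<Longrightarrow> t \<le> s"
    using compact_attains_inf[of ?S] by blast
  show thesis
  proof (rule that[of t])
    fix s assume "a \<le> s" "s < t"
    thus "g s \<notin> C" using t(1) t(2)[of s] by auto
  qed (use t in auto)
qed

lemma last_hitting_time:
  fixes g :: "real \<Rightarrow> 'a::metric_space"
  assumes "a \<le> b" "continuous_on {a..b} g" "closed C" "g a \<in> C"
  obtains t where "a \<le> t" "t \<le> b" "g t \<in> C" "\<And>s. t < s \<Longrightarrow> s \<le> b \<Longrightarrow> g s \<notin> C"
proof -
  have "continuous_on {-b..-a} (\<lambda>t. g (- t))"
    by (rule continuous_on_compose2[OF assms(2)]) (auto intro!: continuous_intros)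
  from first_hitting_time[of "-b" "-a", OF _ this assms(3)] assms
  obtain t where t: "-b \<le> t" "t \<le> -a" "g (- t) \<in> C" "\<And>s. -b \<le> s \<Longrightarrow> s < t \<Longrightarrow> g (- s) \<notin> C"
    by auto
  show thesis
  proof (rule that[of "- t"])
    fix s assume "- t < s" "s \<le> b"
    thus "g s \<notin> C" using t(4)[of "- s"] by auto
  qed (use t in auto)
qed

lemma bounded_subset_cball0:
  fixes S :: "'a::real_normed_vector set"
  assumes "bounded S" obtains R where "S \<subseteq> cball 0 R"
  using assms that by (auto simp: bounded_iff subset_iff)

text \<open>The flow of a locally Lipschitz field. Smooth fields are instances, and so is the time
  reversal of an instance; every statement about forward orbits thus yields one about backward
  orbits.\<close>

locale local_flow =
  fixes f :: "'a::euclidean_space \<Rightarrow> 'a" and I :: "'a \<Rightarrow> real set" and \<Phi> :: "real \<Rightarrow> 'a \<Rightarrow> 'a"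
  assumes flow: "flow_of f I \<Phi>"
    and locally_lipschitz: "\<exists>K\<ge>0. \<forall>x\<in>cball 0 R. \<forall>y\<in>cball 0 R. norm (f x - f y) \<le> K * norm (x - y)"
begin

lemma solution: "solution_on f x (I x) (\<lambda>t. \<Phi> t x)"
  using flow by (simp add: flow_of_def)

lemma maximal: "solution_on f x J \<psi> \<Longrightarrow> J \<subseteq> I x \<and> (\<forall>t\<in>J. \<psi> t = \<Phi> t x)"
  using flow by (simp add: flow_of_def)

lemma open_I: "open (I x)" and interval_I: "is_interval (I x)" and zero_in_I [simp]: "0 \<in> I x"
  and flow_0 [simp]: "\<Phi> 0 x = x"
  using solution[of x] by (auto simp: solution_on_def)

lemma flow_derivative: "t \<in> I x \<Longrightarrow> ((\<lambda>t. \<Phi> t x) has_vector_derivative f (\<Phi> t x)) (at t)"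
  using solution[of x] by (auto simp: solution_on_def)

lemma I_between: "a \<in> I x \<Longrightarrow> b \<in> I x \<Longrightarrow> a \<le> t \<Longrightarrow> t \<le> b \<Longrightarrow> t \<in> I x"
  using interval_I[of x] unfolding is_interval_1 by blast

lemma I_neighbourhood:
  assumes "s \<in> I x"
  obtains e where "e > 0" "\<And>t. \<bar>t - s\<bar> \<le> e \<Longrightarrow> t \<in> I x"
proof -
  obtain e where "e > 0" "cball s e \<subseteq> I x"
    using open_contains_cball[THEN iffD1, OF open_I, THEN bspec, OF assms] by metis
  thus thesis using that[of e] by (auto simp: subset_iff dist_real_def abs_minus_commute)
qed

lemma isCont_flow: "t \<in> I x \<Longrightarrow> isCont (\<lambda>t. \<Phi> t x) t"
  using flow_derivative has_vector_derivative_continuous by blast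

lemma continuous_on_flow: "S \<subseteq> I x \<Longrightarrow> continuous_on S (\<lambda>t. \<Phi> t x)"
  by (rule continuous_on_subset[of "I x"])
     (auto intro!: continuous_at_imp_continuous_on isCont_flow)

text \<open>The translated trajectory solves the same equation with initial value \<open>\<Phi> s x\<close>, so it is part
  of the maximal solution through that point.\<close>

lemma shift_subset:
  assumes "s \<in> I x" "t + s \<in> I x"
  shows "t \<in> I (\<Phi> s x) \<and> \<Phi> t (\<Phi> s x) = \<Phi> (t + s) x"
proof -
  let ?J = "(\<lambda>t. t - s) ` I x"
  have "solution_on f (\<Phi> s x) ?J (\<lambda>t. \<Phi> (t + s) x)"
    unfolding solution_on_def
  proof (intro conjI ballI)
    show "open ?J" using open_translation[OF open_I, of "-s" x] by (simp add: image_def)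
    show "is_interval ?J" using is_interval_translation[of "-s" "I x"] interval_I by (simp add: image_def)
    show "0 \<in> ?J" using assms(1) by force
    show "\<Phi> (0 + s) x = \<Phi> s x" by simp
    fix t assume "t \<in> ?J"
    hence "t + s \<in> I x" by auto
    from flow_derivative[OF this]
    have "((\<lambda>t. \<Phi> t x) has_vector_derivative f (\<Phi> (t + s) x)) (at (t + s) within UNIV)" by simp
    moreover have "((\<lambda>t. t + s) has_vector_derivative 1) (at t)"
      by (auto intro!: derivative_eq_intros)
    ultimately show "((\<lambda>t. \<Phi> (t + s) x) has_vector_derivative f (\<Phi> (t + s) x)) (at t)"
      using vector_diff_chain_at[of "\<lambda>t. t + s" 1 t "\<lambda>t. \<Phi> t x"] by (simp add: o_def)
  qed
  from maximal[OF this] show ?thesis using assms(2) by force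
qed

lemma I_shift: "s \<in> I x \<Longrightarrow> t \<in> I (\<Phi> s x) \<longleftrightarrow> t + s \<in> I x"
proof
  assume s: "s \<in> I x" and t: "t \<in> I (\<Phi> s x)"
  have m: "- s \<in> I (\<Phi> s x)" "\<Phi> (- s) (\<Phi> s x) = x" using shift_subset[OF s, of "- s"] by auto
  have "(t + s) + (- s) \<in> I (\<Phi> s x)" using t by simp
  from shift_subset[OF m(1) this] show "t + s \<in> I x" using m(2) by simp
qed (use shift_subset in blast)

lemma flow_add: "s \<in> I x \<Longrightarrow> t + s \<in> I x \<Longrightarrow> \<Phi> t (\<Phi> s x) = \<Phi> (t + s) x"
  using shift_subset by blast

lemma equilibrium:
  assumes "f \<xi> = 0" shows "t \<in> I \<xi>" "\<Phi> t \<xi> = \<xi>"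
proof -
  have "solution_on f \<xi> UNIV (\<lambda>t. \<xi>)"
    unfolding solution_on_def by (auto simp: assms)
  from maximal[OF this] show "t \<in> I \<xi>" "\<Phi> t \<xi> = \<xi>" by auto
qed

lemma reverse_flow: "local_flow (\<lambda>x. - f x) (\<lambda>x. uminus ` I x) (\<lambda>t. \<Phi> (- t))"
proof
  have rev: "solution_on g x (uminus ` J) (\<lambda>t. \<psi> (- t))"
    if "solution_on h x J \<psi>" "\<And>x. g x = - h x" for g h :: "'a \<Rightarrow> 'a" and x J \<psi>
  proof -
    have J: "open J" "is_interval J" "0 \<in> J" "\<psi> 0 = x"
      and der: "\<And>t. t \<in> J \<Longrightarrow> (\<psi> has_vector_derivative h (\<psi> t)) (at t)"
      using that(1) by (auto simp: solution_on_def)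
    show ?thesis unfolding solution_on_def
    proof (intro conjI ballI)
      show "open (uminus ` J)" using open_negations[OF J(1)] by simp
      show "is_interval (uminus ` J)" 
        unfolding is_interval_1
      proof (intro ballI allI impI)
        fix a b t assume "a \<in> uminus ` J" "b \<in> uminus ` J" "a \<le> t \<and> t \<le> b"
        hence "- b \<le> - t" "- t \<le> - a" "- a \<in> J" "- b \<in> J" by auto
        hence "- t \<in> J" using J(2) unfolding is_interval_1 by blast
        thus "t \<in> uminus ` J" by force
      qed
      show "0 \<in> uminus ` J" using J(3) by force
      show "\<psi> (- 0) = x" using J(4) by simp
      fix t assume "t \<in> uminus ` J"
      hence "- t \<in> J" by auto
      from der[OF this] have "(\<psi> has_vector_derivative h (\<psi> (- t))) (at (- t) within UNIV)" by simp
      moreover have "(uminus has_vector_derivative (- 1 :: real)) (at t)"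
        by (auto intro!: derivative_eq_intros)
      ultimately show "((\<lambda>t. \<psi> (- t)) has_vector_derivative g (\<psi> (- t))) (at t)"
        using vector_diff_chain_at[of uminus "-1" t \<psi>] that(2) by (simp add: o_def)
    qed
  qed
  show "flow_of (\<lambda>x. - f x) (\<lambda>x. uminus ` I x) (\<lambda>t. \<Phi> (- t))"
    unfolding flow_of_def
  proof (intro allI conjI impI)
    show "solution_on (\<lambda>x. - f x) x (uminus ` I x) (\<lambda>t. \<Phi> (- t) x)" for x
      by (rule rev[OF solution]) simp
    fix x J \<psi> assume "solution_on (\<lambda>x. - f x) x J \<psi>"
    from rev[OF this, of f] have "solution_on f x (uminus ` J) (\<lambda>t. \<psi> (- t))" by simp
    from maximal[OF this] have m: "uminus ` J \<subseteq> I x" "\<forall>t\<in>uminus ` J. \<psi> (- t) = \<Phi> t x" by auto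
    show "J \<subseteq> uminus ` I x"
    proof
      fix t assume "t \<in> J"
      hence "- t \<in> I x" using m(1) by auto
      thus "t \<in> uminus ` I x" by force
    qed
    show "\<forall>t\<in>J. \<psi> t = \<Phi> (- t) x" using m(2) by force
  qed
  show "\<exists>K\<ge>0. \<forall>x\<in>cball 0 R. \<forall>y\<in>cball 0 R. norm (- f x - - f y) \<le> K * norm (x - y)" for R
  proof -
    have "norm (- f x - - f y) = norm (f x - f y)" for x y by (simp add: norm_minus_commute)
    thus ?thesis using locally_lipschitz[of R] by simp
  qed
qed

lemma in_reversed_I [simp]: "t \<in> uminus ` I x \<longleftrightarrow> - t \<in> I x"
  by force

lemma lipschitz_forward:
  assumes "0 \<le> T" "{0..T} \<subseteq> I x" "{0..T} \<subseteq> I y"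
    and "\<And>t. 0 \<le> t \<Longrightarrow> t \<le> T \<Longrightarrow> \<Phi> t x \<in> S \<and> \<Phi> t y \<in> S"
    and "\<And>x y. x \<in> S \<Longrightarrow> y \<in> S \<Longrightarrow> norm (f x - f y) \<le> K * norm (x - y)"
  shows "norm (\<Phi> T x - \<Phi> T y) \<le> exp (K * T) * norm (x - y)"
  using gronwall[of T "\<lambda>t. \<Phi> t x" f "\<lambda>t. \<Phi> t y" S K] assms
  by (fastforce intro!: flow_derivative)

lemma lipschitz_backward:
  assumes "0 \<le> T" "{-T..0} \<subseteq> I x" "{-T..0} \<subseteq> I y"
    and "\<And>t. -T \<le> t \<Longrightarrow> t \<le> 0 \<Longrightarrow> \<Phi> t x \<in> S \<and> \<Phi> t y \<in> S"
    and "\<And>x y. x \<in> S \<Longrightarrow> y \<in> S \<Longrightarrow> norm (f x - f y) \<le> K * norm (x - y)"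
  shows "norm (\<Phi> (-T) x - \<Phi> (-T) y) \<le> exp (K * T) * norm (x - y)"
proof -
  interpret rev: local_flow "\<lambda>x. - f x" "\<lambda>x. uminus ` I x" "\<lambda>t. \<Phi> (- t)"
    by (rule reverse_flow)
  show ?thesis
  proof (rule rev.lipschitz_forward[of T x y S])
    show "norm (- f x - - f y) \<le> K * norm (x - y)" if "x \<in> S" "y \<in> S" for x y
      using assms(5)[OF that] by (simp add: norm_minus_commute)
    show "{0..T} \<subseteq> uminus ` I x" "{0..T} \<subseteq> uminus ` I y"
      using assms(2,3) by (auto simp: subset_iff)
  qed (use assms in auto)
qed

text \<open>A bounded trajectory cannot end at a finite time \<open>b\<close>. Let \<open>p\<close> be a limit point of the
  trajectory at \<open>b\<close>. The backward orbit of \<open>p\<close> exists for some time \<open>h\<close>, and the Lipschitz estimate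
  in backward time shows that it coincides with the trajectory on \<open>(b - h, b)\<close>. So the trajectory
  reaches \<open>p\<close> at time \<open>b\<close> and continues beyond it.\<close>

lemma forward_complete:
  assumes bounded: "\<And>t. t \<in> I x \<Longrightarrow> 0 \<le> t \<Longrightarrow> \<Phi> t x \<in> cball 0 R" and "0 \<le> t"
  shows "t \<in> I x"
proof (rule ccontr)
  assume "t \<notin> I x"
  hence ub: "s \<le> t" if "s \<in> I x" for s
    using I_between[of 0 x s t] that \<open>0 \<le> t\<close> by force
  define b where "b = Sup (I x)"
  have bdd: "bdd_above (I x)" using ub by (auto intro!: bdd_aboveI)
  have lt_b: "s < b" if "s \<in> I x" for s
  proof -
    obtain e where e: "e > 0" "\<And>t. \<bar>t - s\<bar> \<le> e \<Longrightarrow> t \<in> I x" using I_neighbourhood[OF \<open>s \<in> I x\<close>] by metis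
    have "s + e \<in> I x" using e by auto
    from cSup_upper[OF this bdd] e(1) show ?thesis by (simp add: b_def)
  qed
  have below_b: "s \<in> I x" if "0 \<le> s" "s < b" for s
  proof -
    obtain s' where "s' \<in> I x" "s < s'"
      using \<open>s < b\<close> less_cSup_iff[OF _ bdd, of s] zero_in_I[of x] unfolding b_def by blast
    thus ?thesis using I_between[of 0 x s' s] that by auto
  qed
  have "b \<notin> I x" using lt_b by blast
  have "0 < b" using lt_b[OF zero_in_I] .
  define sq where "sq n = b - b / real (Suc n)" for n
  have sq: "0 \<le> sq n" "sq n < b" for n using \<open>0 < b\<close> by (auto simp: sq_def field_simps)
  have sq_lim: "sq \<longlonglongrightarrow> b"
    unfolding sq_def using tendsto_diff[OF tendsto_const LIMSEQ_Suc[OF lim_const_over_n[of b]]]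
    by simp
  have "\<forall>n. \<Phi> (sq n) x \<in> cball 0 R" using bounded below_b sq by auto
  then obtain p \<sigma> where p: "p \<in> cball 0 R" "strict_mono \<sigma>" "((\<lambda>n. \<Phi> (sq n) x) \<circ> \<sigma>) \<longlonglongrightarrow> p"
    using compact_imp_seq_compact[OF compact_cball, of 0 R] seq_compactE by (metis (no_types, lifting))
  obtain K where K: "K \<ge> 0" "\<And>x y. x \<in> cball 0 (R+1) \<Longrightarrow> y \<in> cball 0 (R+1) \<Longrightarrow> norm (f x - f y) \<le> K * norm (x - y)"
    using locally_lipschitz[of "R+1"] by blast
  obtain h where h: "0 < h" "h \<le> b" "{-h..0} \<subseteq> I p" "\<And>s. -h \<le> s \<Longrightarrow> s \<le> 0 \<Longrightarrow> \<Phi> s p \<in> cball 0 (R+1)"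
  proof -
    obtain e1 where e1: "e1 > 0" "\<And>t. \<bar>t - 0\<bar> \<le> e1 \<Longrightarrow> t \<in> I p" using I_neighbourhood[OF zero_in_I] by metis
    have "isCont (\<lambda>t. \<Phi> t p) 0"
      by (intro isCont_flow zero_in_I)
    then obtain e2 where e2: "e2 > 0" "\<And>s. dist s 0 < e2 \<Longrightarrow> dist (\<Phi> s p) (\<Phi> 0 p) < 1"
      unfolding continuous_at_eps_delta by (meson zero_less_one)
    show thesis
    proof (rule that[of "min b (min e1 (e2/2))"])
      show "{-min b (min e1 (e2/2))..0} \<subseteq> I p" using e1 by (auto simp: subset_iff)
      fix s assume "-min b (min e1 (e2/2)) \<le> s" "s \<le> 0"
      hence "dist s 0 < e2" using e2(1) by (auto simp: dist_real_def)
      from e2(2)[OF this] have "dist (\<Phi> s p) p < 1" by simp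
      moreover have "norm (\<Phi> s p) \<le> dist (\<Phi> s p) p + norm p" by (metis dist_norm norm_triangle_sub add.commute)
      ultimately show "\<Phi> s p \<in> cball 0 (R+1)" using p(1) by simp
    qed (use e1 e2 \<open>0 < b\<close> in auto)
  qed
  define c where "c = b - h / 2"
  have c: "0 \<le> c" "c < b" using h \<open>0 < b\<close> by (auto simp: c_def)
  have le: "norm (\<Phi> c x - \<Phi> (c - s) p) \<le> exp (K * h) * norm (\<Phi> s x - p)" if s: "c \<le> s" "s < b" for s
  proof -
    have sI: "s \<in> I x" using below_b s c by auto
    have fl: "r \<in> I (\<Phi> s x)" "\<Phi> r (\<Phi> s x) = \<Phi> (r + s) x" "r + s \<in> I x" if "- s \<le> r" "r \<le> 0" for r
      using I_shift[OF sI] flow_add[OF sI] below_b that s c by auto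
    have "norm (\<Phi> (-(s-c)) (\<Phi> s x) - \<Phi> (-(s-c)) p) \<le> exp (K * (s-c)) * norm (\<Phi> s x - p)"
    proof (rule lipschitz_backward[where S = "cball 0 (R+1)"])
      show "{-(s-c)..0} \<subseteq> I (\<Phi> s x)" using fl c by auto
      show "{-(s-c)..0} \<subseteq> I p" using h(3) s c by (auto simp: subset_iff c_def)
      fix r assume r: "-(s-c) \<le> r" "r \<le> 0"
      have "\<Phi> (r + s) x \<in> cball 0 R" using bounded fl(3)[of r] r c by auto
      hence "\<Phi> r (\<Phi> s x) \<in> cball 0 (R+1)" using fl(2)[of r] r c by auto
      moreover have "\<Phi> r p \<in> cball 0 (R+1)" using h(4) r s by (auto simp: c_def)
      ultimately show "\<Phi> r (\<Phi> s x) \<in> cball 0 (R+1) \<and> \<Phi> r p \<in> cball 0 (R+1)" by blast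
    qed (use K s in auto)
    also have "\<dots> \<le> exp (K * h) * norm (\<Phi> s x - p)"
      using K(1) s h(1) by (intro mult_right_mono) (auto simp: c_def intro!: mult_left_mono)
    finally show ?thesis using fl(2)[of "c-s"] s c by simp
  qed
  have lim1: "(\<lambda>n. \<Phi> (c - sq (\<sigma> n)) p) \<longlonglongrightarrow> \<Phi> (c - b) p"
  proof (rule isCont_tendsto_compose[of _ "\<lambda>t. \<Phi> t p"])
    show "isCont (\<lambda>t. \<Phi> t p) (c - b)"
      by (intro isCont_flow) (use h in \<open>auto simp: c_def\<close>)
    show "(\<lambda>n. c - sq (\<sigma> n)) \<longlonglongrightarrow> c - b"
      using LIMSEQ_subseq_LIMSEQ[OF sq_lim p(2)] by (intro tendsto_intros) (simp add: o_def)
  qed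
  have lim2: "(\<lambda>n. \<Phi> (c - sq (\<sigma> n)) p) \<longlonglongrightarrow> \<Phi> c x"
  proof -
    have "(\<lambda>n. exp (K * h) * norm (\<Phi> (sq (\<sigma> n)) x - p)) \<longlonglongrightarrow> exp (K * h) * 0"
      using p(3) by (intro tendsto_mult tendsto_const tendsto_norm_zero) (simp add: o_def LIM_zero_iff)
    hence "(\<lambda>n. exp (K * h) * norm (\<Phi> (sq (\<sigma> n)) x - p)) \<longlonglongrightarrow> 0" by simp
    moreover have "\<forall>\<^sub>F n in sequentially. c < sq (\<sigma> n)"
      using order_tendstoD(1)[OF LIMSEQ_subseq_LIMSEQ[OF sq_lim p(2)] c(2)] by (simp add: o_def)
    hence "\<forall>\<^sub>F n in sequentially. norm (\<Phi> (c - sq (\<sigma> n)) p - \<Phi> c x) \<le> exp (K * h) * norm (\<Phi> (sq (\<sigma> n)) x - p)"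
      by eventually_elim (use le sq in \<open>force simp: norm_minus_commute\<close>)
    ultimately have "(\<lambda>n. \<Phi> (c - sq (\<sigma> n)) p - \<Phi> c x) \<longlonglongrightarrow> 0"
      by (rule Lim_null_comparison[rotated])
    thus ?thesis by (simp add: LIM_zero_iff)
  qed
  have eq: "\<Phi> c x = \<Phi> (c - b) p" using LIMSEQ_unique[OF lim2 lim1] .
  have "c - b \<in> I p" using h by (auto simp: c_def)
  hence "b - c \<in> I (\<Phi> (c - b) p)" using I_shift by simp
  hence "b - c \<in> I (\<Phi> c x)" using eq by simp
  hence "b \<in> I x" using I_shift[OF below_b[OF c]] by simp
  thus False using \<open>b \<notin> I x\<close> by blast
qed

lemma backward_complete:
  assumes "\<And>t. t \<in> I x \<Longrightarrow> t \<le> 0 \<Longrightarrow> \<Phi> t x \<in> cball 0 R" and "t \<le> 0"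
  shows "t \<in> I x"
proof -
  interpret rev: local_flow "\<lambda>x. - f x" "\<lambda>x. uminus ` I x" "\<lambda>t. \<Phi> (- t)"
    by (rule reverse_flow)
  have "- t \<in> uminus ` I x"
    by (rule rev.forward_complete[where R = R]) (use assms in auto)
  thus ?thesis by simp
qed

text \<open>The Lipschitz estimate needs both orbits in a region where \<open>K\<close> is a Lipschitz constant. This is
  the case as long as they are at distance at most 1, and by the estimate itself the distance does
  not reach 1 before time \<open>T\<close>. In particular the orbit of \<open>y\<close> is bounded and so exists up to \<open>T\<close>.\<close>

lemma dependence_forward:
  assumes "0 \<le> T" "{0..T} \<subseteq> I x" "\<And>t. 0 \<le> t \<Longrightarrow> t \<le> T \<Longrightarrow> \<Phi> t x \<in> cball 0 R"
    and K: "0 \<le> K" "\<And>x y. x \<in> cball 0 (R+1) \<Longrightarrow> y \<in> cball 0 (R+1) \<Longrightarrow> norm (f x - f y) \<le> K * norm (x - y)"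
    and close: "exp (K * T) * norm (y - x) < 1"
    and t: "0 \<le> t" "t \<le> T"
  shows "t \<in> I y" "norm (\<Phi> t y - \<Phi> t x) \<le> exp (K * T) * norm (y - x)"
proof -
  have near: "norm (\<Phi> t y - \<Phi> t x) \<le> exp (K * t) * norm (y - x) \<and> norm (\<Phi> t y - \<Phi> t x) < 1"
    if t: "0 \<le> t" "t \<le> T" "t \<in> I y" for t
  proof -
    have sub: "{0..t} \<subseteq> I y" "{0..t} \<subseteq> I x" using assms(2) t I_between[of 0 y t] by auto
    have gr: "norm (\<Phi> s y - \<Phi> s x) \<le> exp (K * s) * norm (y - x) \<and> exp (K * s) * norm (y - x) < 1"
      if s: "0 \<le> s" "s \<le> t" "\<And>r. 0 \<le> r \<Longrightarrow> r \<le> s \<Longrightarrow> norm (\<Phi> r y - \<Phi> r x) \<le> 1" for s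
    proof
      show "norm (\<Phi> s y - \<Phi> s x) \<le> exp (K * s) * norm (y - x)"
      proof (rule lipschitz_forward[where S = "cball 0 (R+1)"])
        fix r assume r: "0 \<le> r" "r \<le> s"
        have "\<Phi> r x \<in> cball 0 R" using assms(3)[of r] r s t by auto
        moreover have "norm (\<Phi> r y) \<le> norm (\<Phi> r y - \<Phi> r x) + norm (\<Phi> r x)"
          by (metis norm_triangle_sub add.commute)
        ultimately show "\<Phi> r y \<in> cball 0 (R+1) \<and> \<Phi> r x \<in> cball 0 (R+1)"
          using s(3)[OF r] by auto
      qed (use K s t sub in auto)
      have "exp (K * s) * norm (y - x) \<le> exp (K * T) * norm (y - x)"
        using K(1) s t by (intro mult_right_mono) (auto intro!: mult_left_mono)
      thus "exp (K * s) * norm (y - x) < 1" using close by linarith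
    qed
    have lt1: "norm (\<Phi> r y - \<Phi> r x) < 1" if "0 \<le> r" "r \<le> t" for r
    proof (rule ccontr)
      assume "\<not> norm (\<Phi> r y - \<Phi> r x) < 1"
      hence "norm (\<Phi> r y - \<Phi> r x) \<in> {1..}" by simp
      have cont: "continuous_on {0..r} (\<lambda>s. norm (\<Phi> s y - \<Phi> s x))"
        using sub that by (intro continuous_intros continuous_on_flow) auto
      obtain s where s: "0 \<le> s" "s \<le> r" "1 \<le> norm (\<Phi> s y - \<Phi> s x)"
        "\<And>q. 0 \<le> q \<Longrightarrow> q < s \<Longrightarrow> norm (\<Phi> q y - \<Phi> q x) < 1"
        by (rule first_hitting_time[OF \<open>0 \<le> r\<close> cont closed_real_atLeast \<open>norm (\<Phi> r y - \<Phi> r x) \<in> {1..}\<close>])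
           (auto simp: not_le)
      show False
      proof (cases "s = 0")
        case True
        have "norm (y - x) \<le> exp (K * T) * norm (y - x)"
          using mult_right_mono[of 1 "exp (K * T)" "norm (y - x)"] K(1) \<open>0 \<le> T\<close> by simp
        thus ?thesis using s(3) close True by simp
      next
        case False
        have "norm (\<Phi> s y - \<Phi> s x) \<le> 1"
        proof (rule continuous_le_on_closure[where f = "\<lambda>q. norm (\<Phi> q y - \<Phi> q x)" and S = "{0..<s}"])
          show "continuous_on (closure {0..<s}) (\<lambda>q. norm (\<Phi> q y - \<Phi> q x))"
            using continuous_on_subset[OF cont, of "{0..s}"] s False by simp
          show "s \<in> closure {0..<s}" using s False by simp
        qed (use s(4) in \<open>auto intro: less_imp_le\<close>)
        hence "norm (\<Phi> q y - \<Phi> q x) \<le> 1" if "0 \<le> q" "q \<le> s" for q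
          using s(4)[of q] that by (cases "q = s") auto
        with gr[of s] s that show False by fastforce
      qed
    qed
    show ?thesis using gr[of t] lt1 t by (auto intro: less_imp_le)
  qed
  have T: "T \<in> I y"
  proof (rule ccontr)
    assume "T \<notin> I y"
    hence lt: "s < T" if "s \<in> I y" "0 \<le> s" for s
      using I_between[of 0 y s T] that \<open>0 \<le> T\<close> by force
    have "T \<in> I y"
    proof (rule forward_complete[where R = "R+1"])
      fix s assume s: "s \<in> I y" "0 \<le> s"
      have "norm (\<Phi> s y) \<le> norm (\<Phi> s y - \<Phi> s x) + norm (\<Phi> s x)"
        by (metis norm_triangle_sub add.commute)
      moreover have "\<Phi> s x \<in> cball 0 R" using assms(3) s lt[OF s] by auto
      ultimately show "\<Phi> s y \<in> cball 0 (R+1)" using near[of s] lt[OF s] s by auto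
    qed fact
    thus False using \<open>T \<notin> I y\<close> by blast
  qed
  show "t \<in> I y" using I_between[of 0 y T t] T t by auto
  from near[OF t this] have "norm (\<Phi> t y - \<Phi> t x) \<le> exp (K * t) * norm (y - x)" by blast
  also have "\<dots> \<le> exp (K * T) * norm (y - x)"
    using K(1) t by (intro mult_right_mono) (auto intro!: mult_left_mono)
  finally show "norm (\<Phi> t y - \<Phi> t x) \<le> exp (K * T) * norm (y - x)" .
qed

lemma dependence_backward:
  assumes "0 \<le> T" "{-T..0} \<subseteq> I x" "\<And>t. -T \<le> t \<Longrightarrow> t \<le> 0 \<Longrightarrow> \<Phi> t x \<in> cball 0 R"
    and K: "0 \<le> K" "\<And>x y. x \<in> cball 0 (R+1) \<Longrightarrow> y \<in> cball 0 (R+1) \<Longrightarrow> norm (f x - f y) \<le> K * norm (x - y)"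
    and close: "exp (K * T) * norm (y - x) < 1"
    and t: "-T \<le> t" "t \<le> 0"
  shows "t \<in> I y" "norm (\<Phi> t y - \<Phi> t x) \<le> exp (K * T) * norm (y - x)"
proof -
  interpret rev: local_flow "\<lambda>x. - f x" "\<lambda>x. uminus ` I x" "\<lambda>t. \<Phi> (- t)"
    by (rule reverse_flow)
  have 1: "{0..T} \<subseteq> uminus ` I x" using assms(2) by (auto simp: subset_iff)
  have 2: "norm (- f x - - f y) \<le> K * norm (x - y)" if "x \<in> cball 0 (R+1)" "y \<in> cball 0 (R+1)" for x y
    using K(2)[OF that] by (simp add: norm_minus_commute)
  have 3: "\<Phi> (- t) x \<in> cball 0 R" if "0 \<le> t" "t \<le> T" for t using assms(3) that by auto
  show "t \<in> I y" "norm (\<Phi> t y - \<Phi> t x) \<le> exp (K * T) * norm (y - x)"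
    using rev.dependence_forward[OF assms(1) 1 3 K(1) 2 close, of "- t"] t by auto
qed

lemma dependence:
  assumes "0 \<le> T"
    and orbit: "\<And>t. a \<le> t \<Longrightarrow> t \<le> b \<Longrightarrow> t \<in> I x \<and> \<Phi> t x \<in> cball 0 R"
    and "-T \<le> a" "a \<le> 0" "0 \<le> b" "b \<le> T"
    and K: "0 \<le> K" "\<And>x y. x \<in> cball 0 (R+1) \<Longrightarrow> y \<in> cball 0 (R+1) \<Longrightarrow> norm (f x - f y) \<le> K * norm (x - y)"
    and close: "exp (K * T) * dist y x < 1"
    and t: "a \<le> t" "t \<le> b"
  shows "t \<in> I y \<and> dist (\<Phi> t y) (\<Phi> t x) \<le> exp (K * T) * dist y x"
proof -
  have le: "exp (K * s) * norm (y - x) \<le> exp (K * T) * norm (y - x)" if "s \<le> T" for s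
    using K(1) that by (intro mult_right_mono) (auto intro!: mult_left_mono)
  show ?thesis
  proof (cases "0 \<le> t")
    case True
    have lt: "exp (K * b) * norm (y - x) < 1"
      using le[of b] close \<open>b \<le> T\<close> by (simp add: dist_norm)
    have sub: "{0..b} \<subseteq> I x" "\<And>t. 0 \<le> t \<Longrightarrow> t \<le> b \<Longrightarrow> \<Phi> t x \<in> cball 0 R"
      using orbit \<open>a \<le> 0\<close> by auto
    show ?thesis
      using dependence_forward[OF \<open>0 \<le> b\<close> sub K lt True t(2)] le[of b] \<open>b \<le> T\<close> by (simp add: dist_norm)
  next
    case False
    hence "t \<le> 0" by simp
    have lt: "exp (K * - a) * norm (y - x) < 1"
      using le[of "- a"] close \<open>-T \<le> a\<close> by (simp add: dist_norm)
    have sub: "{- (- a)..0} \<subseteq> I x" "\<And>t. - (- a) \<le> t \<Longrightarrow> t \<le> 0 \<Longrightarrow> \<Phi> t x \<in> cball 0 R"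
      using orbit \<open>0 \<le> b\<close> by auto
    have "0 \<le> - a" using \<open>a \<le> 0\<close> by simp
    moreover have "- (- a) \<le> t" using t by simp
    ultimately show ?thesis
      using dependence_backward[OF _ sub K lt _ \<open>t \<le> 0\<close>] le[of "- a"] \<open>-T \<le> a\<close> by (simp add: dist_norm)
  qed
qed

text \<open>On a bounded invariant set the constants depend only on the length of the time interval.\<close>

lemma dependence_invariant:
  assumes "0 \<le> T" "bounded S"
    and inv: "\<And>x t. x \<in> S \<Longrightarrow> t \<in> I x \<and> \<Phi> t x \<in> S"
  obtains \<delta> L where "0 < \<delta>" "0 < L"
    "\<And>x y t. x \<in> S \<Longrightarrow> dist y x < \<delta> \<Longrightarrow> \<bar>t\<bar> \<le> T \<Longrightarrow> t \<in> I y \<and> dist (\<Phi> t y) (\<Phi> t x) \<le> L * dist y x"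
proof -
  obtain R where R: "S \<subseteq> cball 0 R" by (rule bounded_subset_cball0[OF \<open>bounded S\<close>])
  obtain K where K: "K \<ge> 0" "\<And>x y. x \<in> cball 0 (R+1) \<Longrightarrow> y \<in> cball 0 (R+1) \<Longrightarrow> norm (f x - f y) \<le> K * norm (x - y)"
    using locally_lipschitz[of "R+1"] by blast
  show thesis
  proof (rule that[of "exp (- (K * T))" "exp (K * T)"])
    fix x y t assume x: "x \<in> S" and y: "dist y x < exp (- (K * T))" and t: "\<bar>t\<bar> \<le> T"
    have "exp (K * T) * dist y x < exp (K * T) * exp (- (K * T))"
      using y by (intro mult_strict_left_mono) auto
    hence "exp (K * T) * dist y x < 1" by (simp add: exp_minus)
    moreover have "t \<in> I x \<and> \<Phi> t x \<in> cball 0 R" for t using inv[OF x] R by blast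
    ultimately show "t \<in> I y \<and> dist (\<Phi> t y) (\<Phi> t x) \<le> exp (K * T) * dist y x"
      using \<open>0 \<le> T\<close> t by (intro dependence[of T "-T" T, OF _ _ _ _ _ _ K]) auto
  qed auto
qed

text \<open>Joint continuity of the flow; the domain of the flow is open.\<close>

lemma flow_tendsto:
  assumes t: "t \<in> I x" and X: "X \<longlonglongrightarrow> x" and \<tau>: "\<tau> \<longlonglongrightarrow> t"
  shows "\<forall>\<^sub>F n in sequentially. \<tau> n \<in> I (X n)" "(\<lambda>n. \<Phi> (\<tau> n) (X n)) \<longlonglongrightarrow> \<Phi> t x"
proof -
  obtain e where e: "e > 0" "\<And>s. \<bar>s - t\<bar> \<le> e \<Longrightarrow> s \<in> I x" using I_neighbourhood[OF t] by metis
  define a where "a = min 0 (t - e)"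
  define b where "b = max 0 (t + e)"
  have "t - e \<in> I x" "t + e \<in> I x" using e by auto
  hence ab: "a \<in> I x" "b \<in> I x" "a < t" "t < b" "a \<le> 0" "0 \<le> b"
    using e(1) by (auto simp: a_def b_def min_def max_def)
  hence sub: "{a..b} \<subseteq> I x" using I_between[of a x b] by auto
  have "compact ((\<lambda>t. \<Phi> t x) ` {a..b})"
    by (intro compact_continuous_image continuous_on_flow sub) auto
  then obtain R where R: "(\<lambda>t. \<Phi> t x) ` {a..b} \<subseteq> cball 0 R"
    by (rule bounded_subset_cball0[OF compact_imp_bounded])
  obtain K where K: "K \<ge> 0" "\<And>x y. x \<in> cball 0 (R+1) \<Longrightarrow> y \<in> cball 0 (R+1) \<Longrightarrow> norm (f x - f y) \<le> K * norm (x - y)"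
    using locally_lipschitz[of "R+1"] by blast
  have orbit: "t \<in> I x" "norm (\<Phi> t x) \<le> R" if "a \<le> t" "t \<le> b" for t
  proof -
    have "t \<in> {a..b}" using that by simp
    thus "t \<in> I x" "norm (\<Phi> t x) \<le> R" using sub subsetD[OF R imageI] by auto
  qed
  define T where "T = max b (- a)"
  have dist0: "(\<lambda>n. dist (X n) x) \<longlonglongrightarrow> 0" using tendsto_dist_iff[THEN iffD1, OF X] .
  have "(\<lambda>n. exp (K * T) * dist (X n) x) \<longlonglongrightarrow> exp (K * T) * 0"
    by (intro tendsto_mult tendsto_const dist0)
  hence "(\<lambda>n. exp (K * T) * dist (X n) x) \<longlonglongrightarrow> 0" by simp
  hence "\<forall>\<^sub>F n in sequentially. exp (K * T) * dist (X n) x < 1"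
    by (rule order_tendstoD) simp
  moreover have "\<forall>\<^sub>F n in sequentially. a < \<tau> n" "\<forall>\<^sub>F n in sequentially. \<tau> n < b"
    using order_tendstoD[OF \<tau>] ab by auto
  ultimately have ev: "\<forall>\<^sub>F n in sequentially. \<tau> n \<in> I (X n) \<and>
      dist (\<Phi> (\<tau> n) (X n)) (\<Phi> (\<tau> n) x) \<le> exp (K * T) * dist (X n) x"
  proof eventually_elim
    case (elim n)
    show ?case
      by (rule dependence[of T a b x R, OF _ _ _ _ _ _ K])
         (use elim ab in \<open>auto simp: T_def orbit\<close>)
  qed
  thus "\<forall>\<^sub>F n in sequentially. \<tau> n \<in> I (X n)" by eventually_elim simp
  have "(\<lambda>n. \<Phi> (\<tau> n) x) \<longlonglongrightarrow> \<Phi> t x"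
    by (rule isCont_tendsto_compose[of _ "\<lambda>t. \<Phi> t x", OF _ \<tau>]) (intro isCont_flow t)
  hence "(\<lambda>n. dist (\<Phi> (\<tau> n) x) (\<Phi> t x)) \<longlonglongrightarrow> 0"
    by (rule tendsto_dist_iff[THEN iffD1])
  from tendsto_add[OF \<open>(\<lambda>n. exp (K * T) * dist (X n) x) \<longlonglongrightarrow> 0\<close> this]
  have lim: "(\<lambda>n. exp (K * T) * dist (X n) x + dist (\<Phi> (\<tau> n) x) (\<Phi> t x)) \<longlonglongrightarrow> 0" by simp
  have "\<forall>\<^sub>F n in sequentially. norm (dist (\<Phi> (\<tau> n) (X n)) (\<Phi> t x))
      \<le> exp (K * T) * dist (X n) x + dist (\<Phi> (\<tau> n) x) (\<Phi> t x)"
    using ev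
  proof eventually_elim
    case (elim n)
    thus ?case using dist_triangle[of "\<Phi> (\<tau> n) (X n)" "\<Phi> t x" "\<Phi> (\<tau> n) x"] by simp
  qed
  from Lim_null_comparison[OF this lim]
  show "(\<lambda>n. \<Phi> (\<tau> n) (X n)) \<longlonglongrightarrow> \<Phi> t x"
    by (rule tendsto_dist_iff[THEN iffD2])
qed

text \<open>Longer and longer backward orbits in a compact set converge to a complete backward orbit in this
  set. The limit exists for all negative times because it is bounded.\<close>

lemma backward_limit_orbit:
  assumes C: "compact C" and z: "z \<longlonglongrightarrow> p" and \<tau>: "filterlim \<tau> at_top sequentially"
    and orbit: "\<And>n t. - \<tau> n \<le> t \<Longrightarrow> t \<le> 0 \<Longrightarrow> t \<in> I (z n) \<and> \<Phi> t (z n) \<in> C"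
    and t: "t \<le> 0"
  shows "t \<in> I p \<and> \<Phi> t p \<in> C"
proof -
  have in_C: "\<Phi> s p \<in> C" if "s \<in> I p" "s \<le> 0" for s
  proof (rule Lim_in_closed_set[OF compact_imp_closed[OF C]])
    show "(\<lambda>n. \<Phi> s (z n)) \<longlonglongrightarrow> \<Phi> s p" by (rule flow_tendsto[OF that(1) z tendsto_const])
    have "\<forall>\<^sub>F n in sequentially. - s \<le> \<tau> n" using \<tau> by (auto simp: filterlim_at_top)
    thus "\<forall>\<^sub>F n in sequentially. \<Phi> s (z n) \<in> C"
      by eventually_elim (use orbit that in auto)
  qed simp
  obtain R where R: "C \<subseteq> cball 0 R" by (rule bounded_subset_cball0[OF compact_imp_bounded[OF C]])
  have "t \<in> I p" by (rule backward_complete[where R = R]) (use in_C R t in blast)+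
  thus ?thesis using in_C t by blast
qed

lemma omega_limit_unique:
  assumes "{0..} \<subseteq> I x" "((\<lambda>t. \<Phi> t x) \<longlongrightarrow> \<xi>) at_top"
  shows "omega_limit I \<Phi> x = {\<xi>}"
proof (intro equalityI subsetI)
  fix y assume "y \<in> omega_limit I \<Phi> x"
  then obtain t where t: "filterlim t at_top sequentially" "(\<lambda>k. \<Phi> (t k) x) \<longlonglongrightarrow> y"
    by (auto simp: omega_limit_def)
  from filterlim_compose[OF assms(2) t(1)] t(2) show "y \<in> {\<xi>}" using LIMSEQ_unique by blast
next
  fix y assume "y \<in> {\<xi>}"
  thus "y \<in> omega_limit I \<Phi> x"
    using filterlim_compose[OF assms(2) filterlim_real_sequentially] assms(1) filterlim_real_sequentially
    unfolding omega_limit_def by (auto intro!: exI[of _ real])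
qed

text \<open>LaSalle's principle for a function that increases strictly along the flow off \<open>\<xi>\<close>. The supremum
  of \<open>Q\<close> along the orbit is attained at every limit point \<open>p\<close> of the orbit, and also at
  \<open>\<Phi> h p\<close>, so \<open>Q\<close> cannot increase at \<open>p\<close>.\<close>

lemma lyapunov_convergence:
  assumes C: "compact C" and orbit: "\<And>t. 0 \<le> t \<Longrightarrow> t \<in> I x \<and> \<Phi> t x \<in> C"
    and Q: "\<And>y. (Q has_derivative Q' y) (at y)"
    and pos: "\<And>y. y \<in> C \<Longrightarrow> y \<noteq> \<xi> \<Longrightarrow> (0::real) < Q' y (f y)" and "f \<xi> = 0"
  shows "((\<lambda>t. \<Phi> t x) \<longlongrightarrow> \<xi>) at_top"
proof (rule ccontr)
  have der: "((\<lambda>t. Q (\<Phi> t y)) has_real_derivative Q' (\<Phi> t y) (f (\<Phi> t y))) (at t)" if "t \<in> I y" for t y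
  proof -
    interpret Q': bounded_linear "Q' (\<Phi> t y)" using Q has_derivative_bounded_linear by blast
    have "((\<lambda>t. \<Phi> t y) has_derivative (\<lambda>h. h *\<^sub>R f (\<Phi> t y))) (at t)"
      using flow_derivative[OF that] by (simp add: has_vector_derivative_def)
    from has_derivative_compose[OF this Q]
    show ?thesis by (simp add: has_field_derivative_def Q'.scaleR mult.commute[of _ "Q' (\<Phi> t y) _"] mult_commute_abs)
  qed
  have nonneg: "0 \<le> Q' y (f y)" if "y \<in> C" for y
  proof (cases "y = \<xi>")
    case True
    interpret Q': bounded_linear "Q' y" using Q has_derivative_bounded_linear by blast
    show ?thesis using True \<open>f \<xi> = 0\<close> Q'.zero by simp
  qed (use pos that less_imp_le in blast)
  have mono: "Q (\<Phi> s x) \<le> Q (\<Phi> t x)" if "0 \<le> s" "s \<le> t" for s t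
    by (rule DERIV_nonneg_imp_nondecreasing[OF that(2)])
       (use der orbit nonneg that in \<open>meson order_trans\<close>)
  assume "\<not> ((\<lambda>t. \<Phi> t x) \<longlongrightarrow> \<xi>) at_top"
  then obtain e where e: "e > 0" "\<not> (\<forall>\<^sub>F t in at_top. dist (\<Phi> t x) \<xi> < e)"
    by (auto simp: tendsto_iff)
  hence "\<exists>t\<ge>real n. \<not> dist (\<Phi> t x) \<xi> < e" for n
    by (auto simp: eventually_at_top_linorder)
  then obtain t where t: "\<And>n. real n \<le> t n" "\<And>n. \<not> dist (\<Phi> (t n) x) \<xi> < e" by metis
  have t0: "0 \<le> t n" for n using t(1)[of n] by simp
  have "\<forall>n. \<Phi> (t n) x \<in> C" using orbit t0 by blast
  then obtain p \<sigma> where p: "p \<in> C" "strict_mono \<sigma>" "((\<lambda>n. \<Phi> (t n) x) \<circ> \<sigma>) \<longlonglongrightarrow> p"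
    using compact_imp_seq_compact[OF C] seq_compactE by (metis (no_types, lifting))
  hence lim: "(\<lambda>n. \<Phi> (t (\<sigma> n)) x) \<longlonglongrightarrow> p" by (simp add: o_def)
  have "p \<noteq> \<xi>"
  proof
    assume "p = \<xi>"
    hence "\<forall>\<^sub>F n in sequentially. dist (\<Phi> (t (\<sigma> n)) x) \<xi> < e" using lim e(1) by (simp add: tendstoD)
    thus False using t(2) by simp
  qed
  have contQ: "isCont Q y" for y using Q has_derivative_continuous by blast
  have ub: "Q (\<Phi> s x) \<le> Q p" if "0 \<le> s" for s
  proof (rule tendsto_lowerbound[OF isCont_tendsto_compose[OF contQ lim]])
    have "s \<le> t (\<sigma> n)" if "nat \<lceil>s\<rceil> \<le> n" for n
      using t(1)[of "\<sigma> n"] seq_suble[OF p(2), of n] that by linarith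
    thus "\<forall>\<^sub>F n in sequentially. Q (\<Phi> s x) \<le> Q (\<Phi> (t (\<sigma> n)) x)"
      unfolding eventually_sequentially using mono[OF \<open>0 \<le> s\<close>] by blast
  qed simp
  have "((\<lambda>t. Q (\<Phi> t p)) has_real_derivative Q' p (f p)) (at 0)" using der[of 0 p] by simp
  from DERIV_pos_inc_right[OF this pos[OF p(1) \<open>p \<noteq> \<xi>\<close>]]
  obtain d where d: "0 < d" "\<And>h. 0 < h \<Longrightarrow> h < d \<Longrightarrow> Q p < Q (\<Phi> h p)" by auto
  obtain d' where d': "0 < d'" "\<And>t. \<bar>t - 0\<bar> \<le> d' \<Longrightarrow> t \<in> I p"
    using I_neighbourhood[OF zero_in_I] by metis
  define h where "h = min (d/2) d'"
  have h: "0 < h" "h < d" "h \<in> I p" using d(1) d' by (auto simp: h_def)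
  have "Q (\<Phi> h p) \<le> Q p"
  proof (rule tendsto_upperbound[OF isCont_tendsto_compose[OF contQ flow_tendsto(2)[OF h(3) lim tendsto_const]]])
    have "\<Phi> h (\<Phi> (t (\<sigma> n)) x) = \<Phi> (h + t (\<sigma> n)) x" for n
      using flow_add orbit t0 h(1) by (simp add: add_nonneg_nonneg)
    thus "\<forall>\<^sub>F n in sequentially. Q (\<Phi> h (\<Phi> (t (\<sigma> n)) x)) \<le> Q p"
      using ub t0 h(1) by (simp add: add_nonneg_nonneg)
  qed simp
  thus False using d(2)[OF h(1,2)] by simp
qed

lemma alpha_limit_reverse: "alpha_limit I \<Phi> x = omega_limit (\<lambda>x. uminus ` I x) (\<lambda>t. \<Phi> (- t)) x"
proof (intro equalityI subsetI)
  fix y assume "y \<in> alpha_limit I \<Phi> x"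
  then obtain t where t: "range t \<subseteq> I x" "filterlim t at_bot sequentially" "(\<lambda>k. \<Phi> (t k) x) \<longlonglongrightarrow> y"
    by (auto simp: alpha_limit_def)
  have "range (\<lambda>k. - t k) \<subseteq> uminus ` I x" using t(1) by auto
  moreover have "filterlim (\<lambda>k. - t k) at_top sequentially"
    using t(2) filterlim_uminus_at_bot by blast
  ultimately show "y \<in> omega_limit (\<lambda>x. uminus ` I x) (\<lambda>t. \<Phi> (- t)) x"
    unfolding omega_limit_def using t(3) by (intro CollectI exI[of _ "\<lambda>k. - t k"]) simp
next
  fix y assume "y \<in> omega_limit (\<lambda>x. uminus ` I x) (\<lambda>t. \<Phi> (- t)) x"
  then obtain t where t: "range t \<subseteq> uminus ` I x" "filterlim t at_top sequentially" "(\<lambda>k. \<Phi> (- t k) x) \<longlonglongrightarrow> y"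
    by (auto simp: omega_limit_def)
  have "range (\<lambda>k. - t k) \<subseteq> I x" using t(1) by (force simp: image_subset_iff)
  moreover have "filterlim (\<lambda>k. - t k) at_bot sequentially"
    using t(2) filterlim_uminus_at_top by blast
  ultimately show "y \<in> alpha_limit I \<Phi> x"
    unfolding alpha_limit_def using t(3) by (intro CollectI exI[of _ "\<lambda>k. - t k"]) simp
qed

lemma lyapunov_alpha_limit:
  assumes C: "compact C" and orbit: "\<And>t. t \<le> 0 \<Longrightarrow> t \<in> I x \<and> \<Phi> t x \<in> C"
    and Q: "\<And>y. (Q has_derivative Q' y) (at y)"
    and pos: "\<And>y. y \<in> C \<Longrightarrow> y \<noteq> \<xi> \<Longrightarrow> (0::real) < Q' y (f y)" and "f \<xi> = 0"
  shows "alpha_limit I \<Phi> x = {\<xi>}"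
proof -
  interpret rev: local_flow "\<lambda>x. - f x" "\<lambda>x. uminus ` I x" "\<lambda>t. \<Phi> (- t)"
    by (rule reverse_flow)
  have "((\<lambda>t. \<Phi> (- t) x) \<longlongrightarrow> \<xi>) at_top"
  proof (rule rev.lyapunov_convergence[where Q = "\<lambda>y. - Q y" and Q' = "\<lambda>y h. - Q' y h", OF C])
    show "((\<lambda>y. - Q y) has_derivative (\<lambda>h. - Q' y h)) (at y)" for y
      using Q by (rule has_derivative_minus)
    show "0 < - Q' y (- f y)" if "y \<in> C" "y \<noteq> \<xi>" for y
    proof -
      have "linear (Q' y)" using Q has_derivative_linear by blast
      thus ?thesis using pos[OF that] by (simp add: linear_neg)
    qed
  qed (use orbit \<open>f \<xi> = 0\<close> in auto)
  moreover have "{0..} \<subseteq> uminus ` I x" using orbit by (auto simp: subset_iff)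
  ultimately show ?thesis unfolding alpha_limit_reverse by (intro rev.omega_limit_unique)
qed

end

section \<open>Eigenbases and hyperbolic equilibria\<close>

text \<open>The complex coordinates of a real point in an eigenbasis are a real-linear injective function of
  the point, namely the inverse of the matrix with columns \<open>v m\<close> applied to its complexification.\<close>

lemma eigenbasis_coordinates:
  fixes f :: "real ^ 'n \<Rightarrow> real ^ 'n"
  assumes "eigenbasis f \<xi> v"
  shows "\<exists>L :: real ^ 'n \<Rightarrow> complex ^ 'n. linear L \<and> inj L \<and>
    (\<forall>x a. complexify x = (\<Sum>m\<in>UNIV. a m *s v m) \<longleftrightarrow> (\<forall>m. a m = L x $ m))"
proof -
  define P :: "complex ^ 'n ^ 'n" where "P = (\<chi> i m. v m $ i)"
  have col: "column m P = v m" for m by (simp add: P_def column_def vec_eq_iff)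
  have mult: "P *v z = (\<Sum>m\<in>UNIV. z $ m *s v m)" for z
    using matrix_mult_sum[of P z] by (simp add: col)
  have v: "inj v" "vec.independent (range v)" using assms by (auto simp: eigenbasis_def)
  have "c i = 0" if "(\<Sum>m\<in>UNIV. c m *s column m P) = 0" for c i
  proof -
    have "(\<Sum>w\<in>range v. c (inv v w) *s w) = (\<Sum>m\<in>UNIV. c m *s v m)"
      using v(1) by (subst sum.reindex) auto
    hence "(\<Sum>w\<in>range v. c (inv v w) *s w) = 0" using that by (simp add: col)
    from vec.independentD[OF v(2) _ _ this, of "v i"] v(1) show "c i = 0" by simp
  qed
  then obtain C where C: "C ** P = mat 1"
    using matrix_left_invertible_independent_columns[of P] by auto
  hence C': "P ** C = mat 1" by (simp add: matrix_left_right_inverse)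
  define L where "L x = C *v complexify x" for x :: "real ^ 'n"
  have "linear L"
  proof (rule linearI)
    show "L (x + y) = L x + L y" for x y
      by (simp add: L_def complexify_def matrix_vector_mult_def vec_eq_iff sum.distrib[symmetric] distrib_left)
    show "L (c *\<^sub>R x) = c *\<^sub>R L x" for c x
      by (simp add: L_def complexify_def matrix_vector_mult_def vec_eq_iff scaleR_sum_right
          scaleR_conv_of_real[where 'a = complex] sum_distrib_left mult_ac)
  qed
  have iff: "complexify x = (\<Sum>m\<in>UNIV. a m *s v m) \<longleftrightarrow> (\<forall>m. a m = L x $ m)" for x a
  proof -
    have "(\<Sum>m\<in>UNIV. a m *s v m) = P *v (\<chi> m. a m)" by (simp add: mult)
    moreover have "complexify x = P *v (\<chi> m. a m) \<longleftrightarrow> L x = (\<chi> m. a m)"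
    proof
      assume "complexify x = P *v (\<chi> m. a m)"
      thus "L x = (\<chi> m. a m)" by (simp add: L_def matrix_vector_mul_assoc C)
    next
      assume "L x = (\<chi> m. a m)"
      hence "P *v L x = P *v (\<chi> m. a m)" by simp
      thus "complexify x = P *v (\<chi> m. a m)" by (simp add: L_def matrix_vector_mul_assoc C')
    qed
    ultimately show ?thesis by (auto simp: vec_eq_iff)
  qed
  have "inj L"
  proof (rule injI)
    fix x y assume "L x = L y"
    hence "complexify x = complexify y" using iff[of x "\<lambda>m. L x $ m"] iff[of y "\<lambda>m. L x $ m"] by simp
    thus "x = y" by (simp add: complexify_def vec_eq_iff)
  qed
  show ?thesis using \<open>linear L\<close> \<open>inj L\<close> iff by blast
qed

lemma open_eigenbox:
  fixes f :: "real ^ 'n \<Rightarrow> real ^ 'n"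
  assumes "eigenbasis f \<xi> v" shows "open (eigenbox v r \<xi>)"
proof -
  obtain L :: "real ^ 'n \<Rightarrow> complex ^ 'n" where L: "linear L" "inj L"
    and coord: "\<And>x a. complexify x = (\<Sum>m\<in>UNIV. a m *s v m) \<longleftrightarrow> (\<forall>m. a m = L x $ m)"
    using eigenbasis_coordinates[OF assms] by auto
  have "eigenbox v r \<xi> = (\<Inter>m. {x. cmod (L (x - \<xi>) $ m) < r})"
  proof -
    have "(\<exists>a. (\<forall>m. a m = L (x - \<xi>) $ m) \<and> (\<forall>m. cmod (a m) < r)) \<longleftrightarrow>
        (\<forall>m. cmod (L (x - \<xi>) $ m) < r)" for x by metis
    thus ?thesis unfolding eigenbox_def coord by auto
  qed
  moreover have "continuous_on UNIV (\<lambda>x. L (x - \<xi>))"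
    by (rule continuous_on_compose2[OF linear_continuous_on[of L UNIV]])
       (use L(1) linear_conv_bounded_linear in \<open>auto intro!: continuous_intros\<close>)
  ultimately show ?thesis
    by (auto intro!: open_INT open_Collect_less continuous_intros)
qed

lemma center_in_eigenbox: "0 < r \<Longrightarrow> \<xi> \<in> eigenbox v r \<xi>"
  unfolding eigenbox_def by (auto simp: complexify_def vec_eq_iff intro!: exI[of _ "\<lambda>m. 0"])

lemma complexify_derivative:
  fixes f :: "real ^ 'n \<Rightarrow> real ^ 'n"
  assumes "(f has_derivative A) (at \<xi>)"
  shows "complexify (A x) = complex_jacobian f \<xi> *v complexify x"
proof -
  have A: "A = frechet_derivative f (at \<xi>)" by (rule frechet_derivative_at[OF assms])
  have "linear A" using assms has_derivative_linear by blast
  hence "A x = jacobian f (at \<xi>) *v x" unfolding jacobian_def A[symmetric] by (simp add: matrix_works)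
  thus ?thesis
    by (simp add: complexify_def complex_jacobian_def matrix_vector_mult_def vec_eq_iff)
qed

text \<open>Every complex vector is \<open>u + \<i> w\<close> with real \<open>u\<close> and \<open>w\<close>, so over the whole space
  \<open>eigenvalues_on\<close> contains every eigenvalue of the Jacobian.\<close>

lemma hyperbolic_eigenvalue:
  assumes "hyperbolic_equilibrium f \<xi>" "eigenvector (complex_jacobian f \<xi>) \<mu> w"
  shows "Re \<mu> \<noteq> 0"
proof -
  have "w = complexify (\<chi> i. Re (w $ i)) + \<i> *s complexify (\<chi> i. Im (w $ i))"
    by (simp add: complexify_def vec_eq_iff complex_eq_iff)
  hence "\<exists>u u'. eigenvector (complex_jacobian f \<xi>) \<mu> (complexify u + \<i> *s complexify u')"
    using assms(2) by metis
  hence "\<mu> \<in> eigenvalues_on f \<xi> UNIV" by (simp add: eigenvalues_on_def)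
  thus ?thesis using assms(1) by (auto simp: hyperbolic_equilibrium_def)
qed

text \<open>In eigenbasis coordinates \<open>a m\<close> take \<open>Q = (\<Sum>m. sgn (Re (\<mu> m)) * (cmod (a m))\<^sup>2)\<close>. Along the
  linearised flow its derivative is \<open>2 * (\<Sum>m. \<bar>Re (\<mu> m)\<bar> * (cmod (a m))\<^sup>2)\<close>, which is positive off the
  equilibrium and dominates the contribution of the nonlinear remainder close to it.\<close>

lemma hyperbolic_lyapunov_function:
  fixes f :: "real ^ 'n \<Rightarrow> real ^ 'n"
  assumes A: "(f has_derivative A) (at \<xi>)" and hyp: "hyperbolic_equilibrium f \<xi>" and basis: "eigenbasis f \<xi> v"
  obtains r Q Q' where "0 < r" "\<And>y. (Q has_derivative Q' y) (at y)"
    "\<And>y. y \<in> cball \<xi> r \<Longrightarrow> y \<noteq> \<xi> \<Longrightarrow> (0::real) < Q' y (f y)"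
proof -
  obtain L :: "real ^ 'n \<Rightarrow> complex ^ 'n" where L: "linear L" "inj L"
    and coord: "\<And>x a. complexify x = (\<Sum>m\<in>UNIV. a m *s v m) \<longleftrightarrow> (\<forall>m. a m = L x $ m)"
    using eigenbasis_coordinates[OF basis] by auto
  obtain \<mu> where \<mu>: "\<And>m. eigenvector (complex_jacobian f \<xi>) (\<mu> m) (v m)"
    using basis unfolding eigenbasis_def by (metis (no_types))
  have [simp]: "L (A x) $ m = \<mu> m * L x $ m" for x m
  proof -
    have "complexify (A x) = complex_jacobian f \<xi> *v (\<Sum>m\<in>UNIV. L x $ m *s v m)"
      using complexify_derivative[OF A] coord[of x "\<lambda>m. L x $ m"] by simp
    also have "\<dots> = (\<Sum>m\<in>UNIV. complex_jacobian f \<xi> *v (L x $ m *s v m))"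
      by (rule vec.linear_sum[OF matrix_vector_mul_linear_gen])
    also have "\<dots> = (\<Sum>m\<in>UNIV. (\<mu> m * L x $ m) *s v m)"
      using \<mu> by (auto simp: eigenvector_def matrix_vector_mult_scaleR vec.scale_scale vec.linear_scale[OF matrix_vector_mul_linear_gen] mult.commute)
    finally show ?thesis using coord by simp
  qed
  obtain b where b: "0 < b" "\<And>x. b * norm x \<le> norm (L x)"
    using linear_inj_bounded_below_pos[OF L] by blast
  obtain B where B: "0 < B" "\<And>x. norm (L x) \<le> B * norm x"
    using linear_bounded_pos[OF L(1)] by blast
  have Re: "Re (\<mu> m) \<noteq> 0" for m using hyperbolic_eigenvalue[OF hyp \<mu>] .
  define \<kappa> where "\<kappa> = Min (range (\<lambda>m. \<bar>Re (\<mu> m)\<bar>))"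
  have \<kappa>: "0 < \<kappa>" "\<kappa> \<le> \<bar>Re (\<mu> m)\<bar>" for m using Re by (auto simp: \<kappa>_def)
  define \<sigma> where "\<sigma> m = sgn (Re (\<mu> m))" for m
  define Q where "Q y = (\<Sum>m\<in>UNIV. \<sigma> m * (L (y - \<xi>) $ m \<bullet> L (y - \<xi>) $ m))" for y
  define Q' where "Q' y h = (\<Sum>m\<in>UNIV. \<sigma> m * (2 * (L (y - \<xi>) $ m \<bullet> L h $ m)))" for y h
  have der: "(Q has_derivative Q' y) (at y)" for y
  proof -
    have "((\<lambda>y. L (y - \<xi>)) has_derivative (\<lambda>h. L (h - 0))) (at y)"
      using L(1) by (intro bounded_linear.has_derivative[of L] has_derivative_diff has_derivative_ident has_derivative_const)
        (simp add: linear_conv_bounded_linear)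
    hence D: "((\<lambda>y. L (y - \<xi>) $ m) has_derivative (\<lambda>h. L h $ m)) (at y)" for m
      using bounded_linear.has_derivative[OF bounded_linear_vec_nth] by fastforce
    have "((\<lambda>y. L (y - \<xi>) $ m \<bullet> L (y - \<xi>) $ m) has_derivative (\<lambda>h. 2 * (L (y - \<xi>) $ m \<bullet> L h $ m))) (at y)" for m
      by (rule has_derivative_eq_rhs[OF has_derivative_inner[OF D D]]) (simp add: inner_commute)
    thus ?thesis unfolding Q_def Q'_def
      by (intro has_derivative_sum has_derivative_mult_right)
  qed
  define n where "n = real CARD('n)"
  have "0 < n" by (simp add: n_def)
  \<comment> \<open>a remainder of this relative size consumes half of the positive derivative\<close>
  define \<epsilon> where "\<epsilon> = \<kappa> * b\<^sup>2 / (2 * n * B\<^sup>2)"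
  have "0 < \<epsilon>" using \<kappa> b(1) B(1) \<open>0 < n\<close> by (simp add: \<epsilon>_def)
  obtain d where d: "0 < d" "\<And>y. norm (y - \<xi>) < d \<Longrightarrow> norm (f y - f \<xi> - A (y - \<xi>)) \<le> \<epsilon> * norm (y - \<xi>)"
    using A \<open>0 < \<epsilon>\<close> unfolding has_derivative_at_alt by blast
  have "f \<xi> = 0" using hyp by (simp add: hyperbolic_equilibrium_def)
  show thesis
  proof (rule that[of "d/2" Q Q'])
    fix y assume y: "y \<in> cball \<xi> (d/2)" "y \<noteq> \<xi>"
    define w where "w = y - \<xi>"
    define e where "e = f y - A w"
    have "w \<noteq> 0" using y by (simp add: w_def)
    have "norm w < d" using y d(1) by (auto simp: w_def dist_norm norm_minus_commute)
    hence e: "norm e \<le> \<epsilon> * norm w" using d(2)[of y] \<open>f \<xi> = 0\<close> by (simp add: e_def w_def)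
    have "f y = A w + e" by (simp add: e_def)
    hence split: "Q' y (f y) = (\<Sum>m\<in>UNIV. \<sigma> m * (2 * (L w $ m \<bullet> (\<mu> m * L w $ m)))) +
        (\<Sum>m\<in>UNIV. \<sigma> m * (2 * (L w $ m \<bullet> L e $ m)))"
      by (simp add: Q'_def w_def[symmetric] linear_add[OF L(1)] inner_add_right sum.distrib[symmetric] algebra_simps)
    have inner: "z \<bullet> (c * z) = Re c * (norm z)\<^sup>2" for z c :: complex
      unfolding cmod_power2 inner_complex_def by (simp add: power2_eq_square algebra_simps)
    have "2 * \<kappa> * (b * norm w)\<^sup>2 \<le> 2 * \<kappa> * (norm (L w))\<^sup>2"
      using b \<kappa> by (intro mult_left_mono power_mono) auto
    also have "(norm (L w))\<^sup>2 = (\<Sum>m\<in>UNIV. (norm (L w $ m))\<^sup>2)"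
      unfolding power2_norm_eq_inner inner_vec_def by simp
    also have "2 * \<kappa> * \<dots> \<le> (\<Sum>m\<in>UNIV. \<sigma> m * (2 * (L w $ m \<bullet> (\<mu> m * L w $ m))))"
      unfolding sum_distrib_left
    proof (rule sum_mono)
      fix m
      have "\<kappa> * (norm (L w $ m))\<^sup>2 \<le> (\<sigma> m * Re (\<mu> m)) * (norm (L w $ m))\<^sup>2"
        using \<kappa>(2)[of m] by (intro mult_right_mono) (auto simp: \<sigma>_def abs_sgn[symmetric] mult.commute)
      thus "2 * \<kappa> * (norm (L w $ m))\<^sup>2 \<le> \<sigma> m * (2 * (L w $ m \<bullet> (\<mu> m * L w $ m)))"
        by (simp add: inner mult_ac)
    qed
    finally have main: "2 * \<kappa> * (b * norm w)\<^sup>2 \<le> (\<Sum>m\<in>UNIV. \<sigma> m * (2 * (L w $ m \<bullet> (\<mu> m * L w $ m))))" .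
    have "- (\<Sum>m\<in>UNIV. \<sigma> m * (2 * (L w $ m \<bullet> L e $ m))) \<le> (\<Sum>m\<in>(UNIV::'n set). 2 * (B\<^sup>2 * \<epsilon> * (norm w)\<^sup>2))"
      unfolding sum_negf[symmetric]
    proof (rule sum_mono)
      fix m
      have "\<bar>L w $ m \<bullet> L e $ m\<bar> \<le> norm (L w $ m) * norm (L e $ m)" by (rule Cauchy_Schwarz_ineq2)
      also have "\<dots> \<le> (B * norm w) * (B * (\<epsilon> * norm w))"
      proof (rule mult_mono)
        show "norm (L w $ m) \<le> B * norm w" by (rule order_trans[OF Finite_Cartesian_Product.norm_nth_le B(2)])
        have "norm (L e $ m) \<le> B * norm e" by (rule order_trans[OF Finite_Cartesian_Product.norm_nth_le B(2)])
        also have "\<dots> \<le> B * (\<epsilon> * norm w)" using e B(1) by (intro mult_left_mono) auto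
        finally show "norm (L e $ m) \<le> B * (\<epsilon> * norm w)" .
      qed (use B in auto)
      finally have "\<bar>L w $ m \<bullet> L e $ m\<bar> \<le> B\<^sup>2 * \<epsilon> * (norm w)\<^sup>2"
        by (simp add: power2_eq_square mult_ac)
      moreover have "- (\<sigma> m * (2 * (L w $ m \<bullet> L e $ m))) \<le> 2 * \<bar>L w $ m \<bullet> L e $ m\<bar>"
        using Re[of m] by (cases "Re (\<mu> m) > 0") (auto simp: \<sigma>_def)
      ultimately show "- (\<sigma> m * (2 * (L w $ m \<bullet> L e $ m))) \<le> 2 * (B\<^sup>2 * \<epsilon> * (norm w)\<^sup>2)" by linarith
    qed
    also have "\<dots> = 2 * n * B\<^sup>2 * \<epsilon> * (norm w)\<^sup>2" by (simp add: n_def)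
    also have "2 * n * B\<^sup>2 * \<epsilon> = \<kappa> * b\<^sup>2" using B(1) \<open>0 < n\<close> by (simp add: \<epsilon>_def)
    finally have "Q' y (f y) \<ge> 2 * \<kappa> * (b * norm w)\<^sup>2 - \<kappa> * b\<^sup>2 * (norm w)\<^sup>2"
      using main split by linarith
    also have "2 * \<kappa> * (b * norm w)\<^sup>2 - \<kappa> * b\<^sup>2 * (norm w)\<^sup>2 = \<kappa> * (b * norm w)\<^sup>2"
      by (simp add: power_mult_distrib)
    moreover have "0 < \<kappa> * (b * norm w)\<^sup>2" using \<kappa>(1) b(1) \<open>w \<noteq> 0\<close> by simp
    ultimately show "0 < Q' y (f y)" by linarith
  qed (use d der in auto)
qed

text \<open>The directional derivatives along the basis vectors are continuous, hence bounded on a ball, and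
  they bound the operator norm of the derivative there.\<close>

lemma smooth_locally_lipschitz:
  fixes f :: "'a::euclidean_space \<Rightarrow> 'a"
  assumes "smooth f"
  shows "\<exists>K\<ge>0. \<forall>x\<in>cball 0 R. \<forall>y\<in>cball 0 R. norm (f x - f y) \<le> K * norm (x - y)"
proof -
  have "Ck (Suc 0) f" using assms by (simp add: smooth_def)
  hence diff: "f differentiable_on UNIV"
    and cont: "\<And>v. continuous_on UNIV (\<lambda>x. frechet_derivative f (at x) v)" by auto
  have der: "(f has_derivative frechet_derivative f (at x)) (at x)" for x
    using diff by (simp add: differentiable_on_def frechet_derivative_works)
  have "\<exists>B. \<forall>x\<in>cball 0 R. norm (frechet_derivative f (at x) b) \<le> B" for b
  proof -
    have "compact ((\<lambda>x. frechet_derivative f (at x) b) ` cball 0 R)"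
      by (intro compact_continuous_image continuous_on_subset[OF cont]) auto
    from compact_imp_bounded[OF this] show ?thesis by (auto simp: bounded_iff)
  qed
  then obtain B where B: "\<And>b x. x \<in> cball 0 R \<Longrightarrow> norm (frechet_derivative f (at x) b) \<le> B b"
    by metis
  define K where "K = max 0 (\<Sum>b\<in>Basis. B b)"
  have "norm (f x - f y) \<le> K * norm (x - y)" if "x \<in> cball 0 R" "y \<in> cball 0 R" for x y
  proof (rule differentiable_bound[OF convex_cball _ _ that])
    fix x assume x: "x \<in> cball (0::'a) R"
    show "(f has_derivative frechet_derivative f (at x)) (at x within cball 0 R)"
      using der has_derivative_at_withinI by blast
    show "onorm (frechet_derivative f (at x)) \<le> K"
    proof (rule onorm_le)
      fix h
      have lin: "linear (frechet_derivative f (at x))" using der has_derivative_linear by blast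
      have "frechet_derivative f (at x) h = (\<Sum>b\<in>Basis. (h \<bullet> b) *\<^sub>R frechet_derivative f (at x) b)"
        by (subst euclidean_representation[of h, symmetric]) (simp add: linear_sum[OF lin] linear_scale[OF lin])
      also have "norm \<dots> \<le> (\<Sum>b\<in>Basis. norm h * B b)"
        by (rule sum_norm_le) (use B[OF x] in \<open>auto intro!: mult_mono Basis_le_norm\<close>)
      also have "\<dots> = norm h * (\<Sum>b\<in>Basis. B b)" by (simp add: sum_distrib_left)
      also have "\<dots> \<le> norm h * K" by (intro mult_left_mono) (auto simp: K_def)
      also have "\<dots> = K * norm h" by simp
      finally show "norm (frechet_derivative f (at x) h) \<le> K * norm h" .
    qed
  qed
  thus ?thesis by (intro exI[of _ K]) (auto simp: K_def)
qed

section \<open>Weights on a graph whose cycles expand\<close>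

lemma exists_uniform_expansion:
  fixes \<rho> :: "'a \<Rightarrow> real"
  assumes "finite \<C>" and "\<And>xs. xs \<in> \<C> \<Longrightarrow> length xs \<le> n" and "\<And>xs. xs \<in> \<C> \<Longrightarrow> 1 < (\<Prod>x\<in>set xs. \<rho> x)"
  obtains \<Lambda> where "1 < \<Lambda>" "\<And>xs. xs \<in> \<C> \<Longrightarrow> \<Lambda> ^ length xs \<le> (\<Prod>x\<in>set xs. \<rho> x)"
proof -
  define P where "P = Min (insert 2 ((\<lambda>xs. \<Prod>x\<in>set xs. \<rho> x) ` \<C>))"
  have P: "1 < P" "\<And>xs. xs \<in> \<C> \<Longrightarrow> P \<le> (\<Prod>x\<in>set xs. \<rho> x)"
    using assms by (auto simp: P_def)
  define \<Lambda> where "\<Lambda> = root (Suc n) P"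
  have \<Lambda>: "1 < \<Lambda>" "\<Lambda> ^ Suc n = P" using P(1) unfolding \<Lambda>_def by (auto intro: real_root_pow_pos2 simp del: power_Suc)
  show thesis
  proof (rule that[OF \<Lambda>(1)])
    fix xs assume "xs \<in> \<C>"
    have "\<Lambda> ^ length xs \<le> \<Lambda> ^ Suc n"
      using assms(2)[OF \<open>xs \<in> \<C>\<close>] \<Lambda>(1) by (intro power_increasing) auto
    thus "\<Lambda> ^ length xs \<le> (\<Prod>x\<in>set xs. \<rho> x)" using \<Lambda>(2) P(2)[OF \<open>xs \<in> \<C>\<close>] by simp
  qed
qed

text \<open>This is the potential that certifies the absence of cycles of gain above 1 in the graph where
  an edge that leaves \<open>x\<close> has gain \<open>\<Lambda> / \<rho> x\<close>: let \<open>\<theta> y\<close> be the largest gain of a simple path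
  that ends at \<open>y\<close>. If such a path to \<open>x\<close> is extended by an edge to \<open>y\<close> and runs into itself, then
  it consists of a simple path to \<open>y\<close> and a cycle, and cutting off the cycle does not decrease the
  gain.\<close>

lemma cycle_potential:
  fixes \<rho> :: "'a \<Rightarrow> real"
  assumes "finite V" and \<rho>: "\<And>x. x \<in> V \<Longrightarrow> 0 < \<rho> x"
    and cycles: "\<And>xs. xs \<noteq> [] \<Longrightarrow> distinct xs \<Longrightarrow> set xs \<subseteq> V \<Longrightarrow>
      (\<And>j. j < length xs \<Longrightarrow> E (xs ! j) (xs ! (Suc j mod length xs))) \<Longrightarrow> 1 < (\<Prod>x\<in>set xs. \<rho> x)"
  obtains \<theta> \<Lambda> where "1 < \<Lambda>" "\<And>x. x \<in> V \<Longrightarrow> 0 < \<theta> x"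
    "\<And>x y. x \<in> V \<Longrightarrow> y \<in> V \<Longrightarrow> E x y \<Longrightarrow> \<Lambda> * \<theta> x \<le> \<rho> x * \<theta> y"
proof -
  define \<C> where "\<C> = {xs. xs \<noteq> [] \<and> distinct xs \<and> set xs \<subseteq> V \<and>
      (\<forall>j<length xs. E (xs ! j) (xs ! (Suc j mod length xs)))}"
  have fin: "finite {xs. distinct xs \<and> set xs \<subseteq> V}"
    using finite_subset_distinct[OF \<open>finite V\<close>] by (simp add: conj_commute)
  have "finite \<C>" by (rule finite_subset[OF _ fin]) (auto simp: \<C>_def)
  moreover have "length xs \<le> card V" if "xs \<in> \<C>" for xs
    using that card_mono[OF \<open>finite V\<close>, of "set xs"] by (auto simp: \<C>_def distinct_card)
  moreover have "1 < (\<Prod>x\<in>set xs. \<rho> x)" if "xs \<in> \<C>" for xs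
    using that cycles by (auto simp: \<C>_def)
  ultimately obtain \<Lambda> where \<Lambda>: "1 < \<Lambda>" "\<And>xs. xs \<in> \<C> \<Longrightarrow> \<Lambda> ^ length xs \<le> (\<Prod>x\<in>set xs. \<rho> x)"
    using exists_uniform_expansion[of \<C> "card V" \<rho>] by blast
  define w where "w x = \<Lambda> / \<rho> x" for x
  have w: "0 < w x" if "x \<in> V" for x using \<rho>[OF that] \<Lambda>(1) by (simp add: w_def)
  \<comment> \<open>a path is represented by the vertices before its endpoint, whose outgoing edges it uses\<close>
  define paths where "paths y = {ps. distinct (ps @ [y]) \<and> set ps \<subseteq> V \<and> successively E (ps @ [y])}" for y
  have fin_paths: "finite (paths y)" for y
    by (rule finite_subset[OF _ fin]) (auto simp: paths_def)
  define \<theta> where "\<theta> y = Max ((\<lambda>ps. \<Prod>x\<in>set ps. w x) ` paths y)" for y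
  have ne: "[] \<in> paths y" for y by (simp add: paths_def)
  have \<theta>_ge: "(\<Prod>x\<in>set ps. w x) \<le> \<theta> y" if "ps \<in> paths y" for ps y
    unfolding \<theta>_def using that fin_paths by (intro Max_ge) auto
  have pos: "0 < \<theta> y" for y using \<theta>_ge[OF ne, of y] by simp
  have step: "w x * \<theta> x \<le> \<theta> y" if xy: "x \<in> V" "y \<in> V" "E x y" for x y
  proof -
    have "\<theta> x \<in> (\<lambda>ps. \<Prod>x\<in>set ps. w x) ` paths x"
      unfolding \<theta>_def using fin_paths ne by (intro Max_in) auto
    then obtain ps where ps: "distinct (ps @ [x])" "set ps \<subseteq> V" "successively E (ps @ [x])" "\<theta> x = (\<Prod>x\<in>set ps. w x)"
      by (auto simp: paths_def)
    have prod: "w x * \<theta> x = (\<Prod>x\<in>set (ps @ [x]). w x)" using ps(1,4) by simp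
    show ?thesis
    proof (cases "y \<in> set (ps @ [x])")
      case False
      hence "ps @ [x] \<in> paths y"
        using ps(1-3) xy by (auto simp: paths_def successively_append_iff)
      from \<theta>_ge[OF this] prod show ?thesis by simp
    next
      case True
      then obtain as bs where split: "ps @ [x] = as @ y # bs" by (metis split_list)
      have last: "last (y # bs) = x" using arg_cong[OF split, of last] by simp
      have dist: "distinct (as @ y # bs)" and sub: "set (as @ y # bs) \<subseteq> V"
        unfolding split[symmetric] using ps xy by auto
      have "as \<in> paths y"
        unfolding paths_def using dist sub ps(3)[unfolded split] by (auto simp: successively_append_iff)
      have "y # bs \<in> \<C>"
        unfolding \<C>_def
      proof (intro CollectI conjI allI impI)
        fix j assume j: "j < length (y # bs)"
        show "E ((y # bs) ! j) ((y # bs) ! (Suc j mod length (y # bs)))"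
        proof (cases "Suc j < length (y # bs)")
          case True
          have "successively E (y # bs)"
            using ps(3) unfolding split by (simp add: successively_append_iff)
          thus ?thesis using True by (simp add: successively_conv_nth)
        next
          case False
          hence "Suc j = length (y # bs)" using j by simp
          thus ?thesis using last xy(3) by (metis last_conv_nth diff_Suc_1 list.distinct(1) mod_self nth_Cons_0)
        qed
      qed (use dist sub in auto)
      from \<Lambda>(2)[OF this] have le: "\<Lambda> ^ length (y # bs) \<le> (\<Prod>x\<in>set (y # bs). \<rho> x)" .
      have "(\<Prod>x\<in>set (y # bs). w x) = \<Lambda> ^ card (set (y # bs)) / (\<Prod>x\<in>set (y # bs). \<rho> x)"
        unfolding w_def by (simp add: prod_dividef)
      also have "card (set (y # bs)) = length (y # bs)" using dist by (intro distinct_card) auto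
      also have "\<Lambda> ^ length (y # bs) / (\<Prod>x\<in>set (y # bs). \<rho> x) \<le> 1"
        using le sub \<rho> by (subst divide_le_eq_1_pos) (auto intro!: prod_pos simp del: set_simps)
      finally have cyc_le: "(\<Prod>x\<in>set (y # bs). w x) \<le> 1" .
      have "w x * \<theta> x = (\<Prod>x\<in>set as. w x) * (\<Prod>x\<in>set (y # bs). w x)"
        unfolding prod split set_append using dist by (intro prod.union_disjoint) auto
      also have "\<dots> \<le> (\<Prod>x\<in>set as. w x) * 1"
        using cyc_le sub w by (intro mult_left_mono prod_nonneg) (auto intro: less_imp_le)
      also have "\<dots> \<le> \<theta> y" using \<theta>_ge[OF \<open>as \<in> paths y\<close>] by simp
      finally show ?thesis .
    qed
  qed
  show thesis
  proof (rule that[OF \<Lambda>(1) pos])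
    show "\<Lambda> * \<theta> x \<le> \<rho> x * \<theta> y" if "x \<in> V" "y \<in> V" "E x y" for x y
      using step[OF that] \<rho>[OF that(1)] by (simp add: w_def field_simps)
  qed
qed

section \<open>Motion near an invariant network\<close>

text \<open>A threshold that exists for each of finitely many points, and that may be lowered, can be chosen
  uniformly.\<close>

lemma finite_uniform:
  fixes P :: "'a \<Rightarrow> real \<Rightarrow> bool"
  assumes "finite S" and "\<And>\<xi>. \<xi> \<in> S \<Longrightarrow> \<exists>\<eta>>0. P \<xi> \<eta>"
    and mono: "\<And>\<xi> \<eta> \<eta>'. P \<xi> \<eta> \<Longrightarrow> 0 < \<eta>' \<Longrightarrow> \<eta>' \<le> \<eta> \<Longrightarrow> P \<xi> \<eta>'"
  shows "\<exists>\<eta>>0. \<forall>\<xi>\<in>S. P \<xi> \<eta>"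
proof -
  obtain h where h: "\<And>\<xi>. \<xi> \<in> S \<Longrightarrow> 0 < h \<xi> \<and> P \<xi> (h \<xi>)" using assms(2) by metis
  define \<eta> where "\<eta> = Min (insert 1 (h ` S))"
  have "0 < \<eta>" using h \<open>finite S\<close> by (auto simp: \<eta>_def)
  moreover have "\<eta> \<le> h \<xi>" if "\<xi> \<in> S" for \<xi> using that \<open>finite S\<close> by (auto simp: \<eta>_def)
  ultimately show ?thesis using h mono by blast
qed

lemma frequently_finite_value:
  assumes "finite S" "\<And>n. g n \<in> S"
  obtains a where "a \<in> S" "\<exists>\<^sub>F n in sequentially. g n = a"
proof (rule ccontr)
  assume "\<not> thesis"
  hence "\<forall>a\<in>S. \<forall>\<^sub>F n in sequentially. g n \<noteq> a" using that by (auto simp: frequently_def)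
  hence "\<forall>\<^sub>F n in sequentially. \<forall>a\<in>S. g n \<noteq> a"
    using \<open>finite S\<close> by (simp add: eventually_ball_finite)
  thus False using assms(2) by (auto simp: eventually_sequentially)
qed

lemma tendsto_zero_inverse_Suc:
  fixes g :: "nat \<Rightarrow> real"
  assumes "\<And>n. 0 \<le> g n" "\<And>n. g n \<le> c / real (Suc n)"
  shows "g \<longlonglongrightarrow> 0"
proof (rule Lim_null_comparison)
  show "\<forall>\<^sub>F n in sequentially. norm (g n) \<le> c / real (Suc n)" using assms by simp
  show "(\<lambda>n. c / real (Suc n)) \<longlonglongrightarrow> 0" by (rule LIMSEQ_Suc[OF lim_const_over_n])
qed

lemma in_closure_complement:
  fixes S :: "'a::metric_space set"
  assumes "\<And>n. X n \<notin> S" "X \<longlonglongrightarrow> y" shows "y \<in> closure (- S)"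
  unfolding closure_sequential using assms by (intro exI[of _ X]) auto

lemma bounded_times_subsequence:
  assumes "\<And>n. 0 \<le> \<tau> n" "\<not> filterlim \<tau> at_top sequentially"
  obtains \<sigma> t where "strict_mono \<sigma>" "(\<lambda>n. \<tau> (\<sigma> n)) \<longlonglongrightarrow> t" "0 \<le> (t::real)"
proof -
  obtain M where "\<exists>\<^sub>F n in sequentially. \<tau> n < M"
    using assms(2) unfolding filterlim_at_top frequently_def by (auto simp: not_less)
  hence "infinite {n. \<tau> n < M}" by (simp add: frequently_cofinite cofinite_eq_sequentially[symmetric])
  from infinite_enumerate[OF this]
  obtain \<sigma> :: "nat \<Rightarrow> nat" where \<sigma>: "strict_mono \<sigma>" "\<forall>n. \<tau> (\<sigma> n) < M" by auto
  have "\<forall>n. \<tau> (\<sigma> n) \<in> {0..M}" using assms(1) \<sigma>(2) by (auto intro: less_imp_le)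
  then obtain t \<sigma>' where \<sigma>': "t \<in> {0..M}" "strict_mono \<sigma>'" "((\<lambda>n. \<tau> (\<sigma> n)) \<circ> \<sigma>') \<longlonglongrightarrow> t"
    using compact_imp_seq_compact[OF compact_Icc, of 0 M] seq_compactE by (metis (no_types, lifting))
  show thesis
    by (rule that[of "\<sigma> \<circ> \<sigma>'" t]) (use \<sigma> \<sigma>' strict_mono_o in \<open>auto simp: o_def\<close>)
qed

text \<open>The facts about a network from which its stability follows. The set \<open>B \<xi>\<close> is the box around the
  equilibrium \<open>\<xi>\<close>, and the ball of radius \<open>r\<close> around \<open>\<xi>\<close> is so small that \<open>\<xi>\<close> attracts every orbit
  that stays in it, in forward or in backward time. The assumption on backward orbits combines
  cleanness, the absence of homoclinic orbits and the choice of the weights \<open>\<theta>\<close>: the unstable set of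
  \<open>\<xi>\<close> lies in \<open>Y\<close> and leads to equilibria \<open>\<kappa> \<noteq> \<xi>\<close> that satisfy the weight inequality.\<close>

locale network_flow = local_flow f I \<Phi>
  for f :: "'a::euclidean_space \<Rightarrow> 'a" and I :: "'a \<Rightarrow> real set" and \<Phi> :: "real \<Rightarrow> 'a \<Rightarrow> 'a" +
  fixes Y E :: "'a set" and B :: "'a \<Rightarrow> 'a set" and r \<delta> A \<Lambda> :: real and \<theta> \<rho> :: "'a \<Rightarrow> real"
  assumes compact_Y: "compact Y" and nonempty_Y: "Y \<noteq> {}"
    and invariant_Y: "\<And>x t. x \<in> Y \<Longrightarrow> t \<in> I x \<Longrightarrow> \<Phi> t x \<in> Y"
    and finite_E: "finite E" and E_subset: "E \<subseteq> Y"
    and equilibrium_E: "\<And>\<xi>. \<xi> \<in> E \<Longrightarrow> f \<xi> = 0"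
    and open_B: "\<And>\<xi>. \<xi> \<in> E \<Longrightarrow> open (B \<xi>)"
    and disjoint_B: "\<And>\<xi> \<eta>. \<xi> \<in> E \<Longrightarrow> \<eta> \<in> E \<Longrightarrow> \<xi> \<noteq> \<eta> \<Longrightarrow> B \<xi> \<inter> B \<eta> = {}"
    and r_pos: "0 < r" and ball_subset: "\<And>\<xi>. \<xi> \<in> E \<Longrightarrow> cball \<xi> (2 * r) \<subseteq> B \<xi>"
    and forward_trapped: "\<And>\<xi> x. \<xi> \<in> E \<Longrightarrow> (\<And>t. 0 \<le> t \<Longrightarrow> t \<in> I x \<and> \<Phi> t x \<in> cball \<xi> r) \<Longrightarrow>
      ((\<lambda>t. \<Phi> t x) \<longlongrightarrow> \<xi>) at_top"
    and backward_trapped: "\<And>\<xi> x. \<xi> \<in> E \<Longrightarrow> (\<And>t. t \<le> 0 \<Longrightarrow> t \<in> I x \<and> \<Phi> t x \<in> cball \<xi> r) \<Longrightarrow>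
      \<xi> \<in> alpha_limit I \<Phi> x \<and> x \<in> Y \<and>
      (x \<noteq> \<xi> \<longrightarrow> (\<exists>\<kappa>\<in>E. \<kappa> \<noteq> \<xi> \<and> \<kappa> \<in> omega_limit I \<Phi> x \<and> \<Lambda> * \<theta> \<xi> \<le> \<rho> \<xi> * \<theta> \<kappa>))"
    and omega_Y: "\<And>x. x \<in> Y \<Longrightarrow> \<exists>\<kappa>\<in>E. \<kappa> \<in> omega_limit I \<Phi> x"
    and \<Lambda>: "1 < \<Lambda>" and \<theta>_pos: "\<And>\<xi>. \<xi> \<in> E \<Longrightarrow> 0 < \<theta> \<xi>" and \<rho>_pos: "\<And>\<xi>. \<xi> \<in> E \<Longrightarrow> 0 < \<rho> \<xi>"
    and \<delta>_pos: "0 < \<delta>" and A_pos: "0 < A"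
    and estimate: "\<And>\<xi> x s e. \<xi> \<in> E \<Longrightarrow> x \<notin> Y \<Longrightarrow> passage I \<Phi> (B \<xi>) x s e \<Longrightarrow>
      (\<And>t. s \<le> t \<Longrightarrow> t \<le> e \<Longrightarrow> infdist (\<Phi> t x) Y < \<delta>) \<Longrightarrow>
      infdist (\<Phi> e x) Y \<le> A * infdist (\<Phi> s x) Y powr \<rho> \<xi>"
begin

abbreviation "D x \<equiv> infdist x Y"

text \<open>This inequality is all that the growth argument needs to know about a step from \<open>\<xi>\<close> to \<open>\<kappa>\<close>. In
  contrast to being joined by a connection, it survives the skipping of equilibria \<open>e\<close> with
  \<open>\<rho> e \<le> 1\<close>.\<close>

definition "allowed \<xi> \<kappa> \<longleftrightarrow> \<Lambda> * \<theta> \<xi> \<le> \<rho> \<xi> * \<theta> \<kappa>"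

lemma closed_Y: "closed Y" using compact_Y compact_imp_closed by blast

lemma I_Y: assumes "x \<in> Y" shows "t \<in> I x"
proof -
  obtain R where R: "Y \<subseteq> cball 0 R" by (rule bounded_subset_cball0[OF compact_imp_bounded[OF compact_Y]])
  show ?thesis
  proof (cases "0 \<le> t")
    case True
    show ?thesis by (rule forward_complete[OF _ True, where R = R]) (use invariant_Y assms R in blast)
  next
    case False
    show ?thesis by (rule backward_complete[where R = R]) (use invariant_Y assms R False in \<open>blast, simp\<close>)
  qed
qed

lemma flow_Y: "x \<in> Y \<Longrightarrow> \<Phi> t x \<in> Y" using invariant_Y I_Y by blast

lemma flow_notin_Y: assumes "x \<notin> Y" "t \<in> I x" shows "\<Phi> t x \<notin> Y"
proof
  assume "\<Phi> t x \<in> Y"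
  hence "\<Phi> (- t) (\<Phi> t x) \<in> Y" by (rule flow_Y)
  thus False using flow_add[OF assms(2), of "- t"] assms(1) by simp
qed

lemma D_pos: "x \<notin> Y \<Longrightarrow> 0 < D x"
  using infdist_pos_not_in_closed[OF closed_Y nonempty_Y] by blast

lemma D_zero: "x \<in> Y \<Longrightarrow> D x = 0" by simp

lemma ball_small: assumes "\<xi> \<in> E" "dist x \<xi> \<le> r" shows "x \<in> B \<xi>"
proof -
  have "x \<in> cball \<xi> (2 * r)" using assms r_pos by (simp add: dist_commute)
  thus ?thesis using ball_subset assms(1) by blast
qed

text \<open>Compare the trajectory of \<open>x\<close> with that of a point of \<open>Y\<close> nearest to \<open>x\<close>, which stays in \<open>Y\<close>.
  The bound holds in both time directions; the backward one turns into a lower bound for the distance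
  after a passage of bounded duration.\<close>

lemma growth:
  assumes "0 \<le> T"
  obtains \<eta> L where "0 < \<eta>" "1 \<le> L"
    "\<And>x t. D x < \<eta> \<Longrightarrow> \<bar>t\<bar> \<le> T \<Longrightarrow> t \<in> I x \<and> D (\<Phi> t x) \<le> L * D x"
proof -
  obtain \<eta> L where \<eta>: "0 < \<eta>" "0 < L"
    "\<And>x y t. x \<in> Y \<Longrightarrow> dist y x < \<eta> \<Longrightarrow> \<bar>t\<bar> \<le> T \<Longrightarrow> t \<in> I y \<and> dist (\<Phi> t y) (\<Phi> t x) \<le> L * dist y x"
    using dependence_invariant[OF assms compact_imp_bounded[OF compact_Y]] I_Y flow_Y by metis
  show thesis
  proof (rule that[of \<eta> "max 1 L"])
    fix x t assume x: "D x < \<eta>" and t: "\<bar>t\<bar> \<le> T"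
    obtain y where y: "y \<in> Y" "D x = dist x y" using infdist_attains_inf[OF closed_Y nonempty_Y] by blast
    have *: "t \<in> I x \<and> dist (\<Phi> t x) (\<Phi> t y) \<le> L * dist x y" using \<eta>(3)[OF y(1) _ t] x y by simp
    have "D (\<Phi> t x) \<le> dist (\<Phi> t x) (\<Phi> t y)" by (rule infdist_le[OF flow_Y[OF y(1)]])
    also have "\<dots> \<le> L * dist x y" using * by blast
    also have "\<dots> \<le> max 1 L * D x" unfolding y(2) by (intro mult_right_mono) auto
    finally show "t \<in> I x \<and> D (\<Phi> t x) \<le> max 1 L * D x" using * by blast
  qed (use \<eta> in auto)
qed

lemma near_Y_subsequence:
  assumes "(\<lambda>n. D (X n)) \<longlonglongrightarrow> 0"
  obtains \<sigma> y where "strict_mono \<sigma>" "(\<lambda>n. X (\<sigma> n)) \<longlonglongrightarrow> y" "y \<in> Y"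
proof -
  have "\<exists>y\<in>Y. D (X n) = dist (X n) y" for n using infdist_attains_inf[OF closed_Y nonempty_Y] by metis
  then obtain y where y: "\<And>n. y n \<in> Y" "\<And>n. D (X n) = dist (X n) (y n)" by metis
  obtain l \<sigma> where \<sigma>: "l \<in> Y" "strict_mono \<sigma>" "(y \<circ> \<sigma>) \<longlonglongrightarrow> l"
    using compact_imp_seq_compact[OF compact_Y] y(1) seq_compactE by metis
  have "(\<lambda>n. dist (X (\<sigma> n)) (y (\<sigma> n))) \<longlonglongrightarrow> 0"
    using LIMSEQ_subseq_LIMSEQ[OF assms \<sigma>(2)] y(2) by (simp add: o_def)
  moreover have "(\<lambda>n. dist (y (\<sigma> n)) l) \<longlonglongrightarrow> 0"
    using tendsto_dist_iff[THEN iffD1, OF \<sigma>(3)] by (simp add: o_def)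
  ultimately have "(\<lambda>n. dist (X (\<sigma> n)) (y (\<sigma> n)) + dist (y (\<sigma> n)) l) \<longlonglongrightarrow> 0 + 0"
    by (rule tendsto_add)
  hence "(\<lambda>n. dist (X (\<sigma> n)) (y (\<sigma> n)) + dist (y (\<sigma> n)) l) \<longlonglongrightarrow> 0" by simp
  hence "(\<lambda>n. dist (X (\<sigma> n)) l) \<longlonglongrightarrow> 0"
    by (rule Lim_null_comparison[rotated]) (simp add: dist_triangle)
  hence "(\<lambda>n. X (\<sigma> n)) \<longlonglongrightarrow> l" by (rule tendsto_dist_iff[THEN iffD2])
  thus thesis using that \<sigma> by blast
qed

lemma omega_limit_close:
  assumes "\<kappa> \<in> omega_limit I \<Phi> x" "0 < \<epsilon>"
  obtains t where "T \<le> t" "t \<in> I x" "dist (\<Phi> t x) \<kappa> < \<epsilon>"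
proof -
  obtain t where t: "range t \<subseteq> I x" "filterlim t at_top sequentially" "(\<lambda>k. \<Phi> (t k) x) \<longlonglongrightarrow> \<kappa>"
    using assms(1) by (auto simp: omega_limit_def)
  have "\<forall>\<^sub>F k in sequentially. T \<le> t k" using t(2) by (auto simp: filterlim_at_top)
  moreover have "\<forall>\<^sub>F k in sequentially. dist (\<Phi> (t k) x) \<kappa> < \<epsilon>" using tendstoD[OF t(3) assms(2)] .
  ultimately have "\<forall>\<^sub>F k in sequentially. T \<le> t k \<and> dist (\<Phi> (t k) x) \<kappa> < \<epsilon>" by eventually_elim simp
  then obtain k where "T \<le> t k \<and> dist (\<Phi> (t k) x) \<kappa> < \<epsilon>" by (auto simp: eventually_sequentially)
  thus thesis using that t(1) by auto
qed

lemma alpha_limit_close: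
  assumes "\<xi> \<in> alpha_limit I \<Phi> x" "0 < \<epsilon>"
  obtains t where "0 \<le> t" "- t \<in> I x" "dist (\<Phi> (- t) x) \<xi> < \<epsilon>"
proof -
  obtain t where t: "range t \<subseteq> I x" "filterlim t at_bot sequentially" "(\<lambda>k. \<Phi> (t k) x) \<longlonglongrightarrow> \<xi>"
    using assms(1) by (auto simp: alpha_limit_def)
  have "\<forall>\<^sub>F k in sequentially. t k \<le> 0" using t(2) by (auto simp: filterlim_at_bot)
  moreover have "\<forall>\<^sub>F k in sequentially. dist (\<Phi> (t k) x) \<xi> < \<epsilon>" using tendstoD[OF t(3) assms(2)] .
  ultimately have "\<forall>\<^sub>F k in sequentially. t k \<le> 0 \<and> dist (\<Phi> (t k) x) \<xi> < \<epsilon>" by eventually_elim simp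
  then obtain k where "t k \<le> 0 \<and> dist (\<Phi> (t k) x) \<xi> < \<epsilon>" by (auto simp: eventually_sequentially)
  thus thesis using that[of "- t k"] t(1) by auto
qed

lemma eventually_near:
  assumes "X \<longlonglongrightarrow> x" "t \<in> I x" "dist (\<Phi> t x) \<kappa> < \<epsilon>"
  shows "\<forall>\<^sub>F n in sequentially. t \<in> I (X n) \<and> dist (\<Phi> t (X n)) \<kappa> < \<epsilon>"
proof -
  have lim: "(\<lambda>n. dist (\<Phi> t (X n)) \<kappa>) \<longlonglongrightarrow> dist (\<Phi> t x) \<kappa>"
    by (intro tendsto_dist flow_tendsto(2)[OF assms(2,1) tendsto_const] tendsto_const)
  show ?thesis
    using order_tendstoD(2)[OF lim assms(3)] flow_tendsto(1)[OF assms(2,1) tendsto_const]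
    by eventually_elim simp
qed

lemma first_exit:
  assumes "dist p \<xi> \<le> r" "0 \<le> u" "u \<in> I p" "r < dist (\<Phi> u p) \<xi>"
  obtains \<tau> where "0 \<le> \<tau>" "\<tau> \<le> u" "\<And>t. 0 \<le> t \<Longrightarrow> t \<le> \<tau> \<Longrightarrow> t \<in> I p \<and> dist (\<Phi> t p) \<xi> \<le> r" "dist (\<Phi> \<tau> p) \<xi> = r"
proof -
  have sub: "{0..u} \<subseteq> I p" using assms I_between[OF zero_in_I assms(3)] by auto
  have cont: "continuous_on {0..u} (\<lambda>t. dist (\<Phi> t p) \<xi>)"
    by (intro continuous_intros continuous_on_flow sub)
  have "dist (\<Phi> u p) \<xi> \<in> {r..}" using assms by simp
  from first_hitting_time[OF assms(2) cont closed_real_atLeast this]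
  obtain \<tau> where \<tau>: "0 \<le> \<tau>" "\<tau> \<le> u" "r \<le> dist (\<Phi> \<tau> p) \<xi>" "\<And>s. 0 \<le> s \<Longrightarrow> s < \<tau> \<Longrightarrow> dist (\<Phi> s p) \<xi> < r"
    by (metis atLeast_iff not_le)
  have "dist (\<Phi> \<tau> p) \<xi> \<le> r"
  proof (cases "\<tau> = 0")
    case False
    show ?thesis
    proof (rule continuous_le_on_closure[where f = "\<lambda>q. dist (\<Phi> q p) \<xi>" and S = "{0..<\<tau>}"])
      show "continuous_on (closure {0..<\<tau>}) (\<lambda>q. dist (\<Phi> q p) \<xi>)"
        using continuous_on_subset[OF cont, of "{0..\<tau>}"] \<tau> False by simp
      show "\<tau> \<in> closure {0..<\<tau>}" using \<tau> False by simp
    qed (use \<tau>(4) in \<open>auto intro: less_imp_le\<close>)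
  qed (use assms(1) in simp)
  hence eq: "dist (\<Phi> \<tau> p) \<xi> = r" using \<tau>(3) by simp
  show thesis
  proof (rule that[OF \<tau>(1,2) _ eq])
    fix t assume t: "0 \<le> t" "t \<le> \<tau>"
    hence "t \<in> I p" using sub \<tau>(2) by auto
    moreover have "dist (\<Phi> t p) \<xi> \<le> r" using \<tau>(4)[of t] t eq by (cases "t = \<tau>") auto
    ultimately show "t \<in> I p \<and> dist (\<Phi> t p) \<xi> \<le> r" by blast
  qed
qed

lemma backward_limit_in_ball:
  assumes \<tau>: "filterlim \<tau> at_top sequentially" "\<And>n. 0 \<le> \<tau> n"
    and orbit: "\<And>n t. 0 \<le> t \<Longrightarrow> t \<le> \<tau> n \<Longrightarrow> t \<in> I (p n) \<and> dist (\<Phi> t (p n)) \<xi> \<le> r"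
    and z: "(\<lambda>n. \<Phi> (\<tau> n) (p n)) \<longlonglongrightarrow> z" and t: "t \<le> 0"
  shows "t \<in> I z \<and> \<Phi> t z \<in> cball \<xi> r"
proof (rule backward_limit_orbit[OF compact_cball z \<tau>(1) _ t])
  fix n s assume s: "- \<tau> n \<le> s" "s \<le> 0"
  have \<tau>I: "\<tau> n \<in> I (p n)" using orbit[of "\<tau> n" n] \<tau>(2) by simp
  have s': "s + \<tau> n \<in> I (p n)" "dist (\<Phi> (s + \<tau> n) (p n)) \<xi> \<le> r" using orbit[of "s + \<tau> n" n] s by auto
  show "s \<in> I (\<Phi> (\<tau> n) (p n)) \<and> \<Phi> s (\<Phi> (\<tau> n) (p n)) \<in> cball \<xi> r"
    using I_shift[OF \<tau>I] flow_add[OF \<tau>I s'(1)] s' by (simp add: dist_commute)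
qed

text \<open>Orbits that stay in the ball for longer and longer times leave it close to the unstable set of
  \<open>\<xi>\<close>: a limit of exit points has a backward orbit that never leaves the ball.\<close>

lemma exit_points_limit:
  assumes \<xi>: "\<xi> \<in> E" and \<tau>: "filterlim \<tau> at_top sequentially" "\<And>n. 0 \<le> \<tau> n"
    and orbit: "\<And>n t. 0 \<le> t \<Longrightarrow> t \<le> \<tau> n \<Longrightarrow> t \<in> I (p n) \<and> dist (\<Phi> t (p n)) \<xi> \<le> r"
    and exit: "\<And>n. dist (\<Phi> (\<tau> n) (p n)) \<xi> = r"
  obtains \<sigma> z \<kappa> where "strict_mono \<sigma>" "(\<lambda>n. \<Phi> (\<tau> (\<sigma> n)) (p (\<sigma> n))) \<longlonglongrightarrow> z" "z \<in> Y" "dist z \<xi> = r"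
    "\<kappa> \<in> E" "\<kappa> \<noteq> \<xi>" "allowed \<xi> \<kappa>" "\<kappa> \<in> omega_limit I \<Phi> z" "\<xi> \<in> alpha_limit I \<Phi> z"
    "\<forall>t\<le>0. dist (\<Phi> t z) \<xi> \<le> r"
proof -
  have "\<forall>n. \<Phi> (\<tau> n) (p n) \<in> cball \<xi> r" using exit by (simp add: dist_commute)
  then obtain z \<sigma> where \<sigma>: "strict_mono \<sigma>" "((\<lambda>n. \<Phi> (\<tau> n) (p n)) \<circ> \<sigma>) \<longlonglongrightarrow> z"
    using compact_imp_seq_compact[OF compact_cball, of \<xi> r] seq_compactE by (metis (no_types, lifting))
  hence z: "(\<lambda>n. \<Phi> (\<tau> (\<sigma> n)) (p (\<sigma> n))) \<longlonglongrightarrow> z" by (simp add: o_def)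
  have lim: "filterlim (\<lambda>n. \<tau> (\<sigma> n)) at_top sequentially"
    using filterlim_compose[OF \<tau>(1) filterlim_subseq[OF \<sigma>(1)]] .
  have bwd: "t \<in> I z \<and> \<Phi> t z \<in> cball \<xi> r" if "t \<le> 0" for t
    by (rule backward_limit_in_ball[OF lim \<tau>(2) orbit z that])
  have "(\<lambda>n. dist (\<Phi> (\<tau> (\<sigma> n)) (p (\<sigma> n))) \<xi>) \<longlonglongrightarrow> dist z \<xi>" by (intro tendsto_dist z tendsto_const)
  hence dz: "dist z \<xi> = r" using exit by (simp add: LIMSEQ_const_iff)
  hence "z \<noteq> \<xi>" using r_pos by auto
  from backward_trapped[OF \<xi> bwd] this
  obtain \<kappa> where "\<kappa> \<in> E" "\<kappa> \<noteq> \<xi>" "\<kappa> \<in> omega_limit I \<Phi> z" "allowed \<xi> \<kappa>" "\<xi> \<in> alpha_limit I \<Phi> z" "z \<in> Y"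
    by (auto simp: allowed_def)
  thus thesis using that[OF \<sigma>(1) z _ dz] bwd by (simp add: dist_commute)
qed

text \<open>Over a bounded time, orbits that start close to an equilibrium remain close to it.\<close>

lemma exit_time_unbounded:
  assumes "\<xi> \<in> E" "p \<longlonglongrightarrow> \<xi>" and \<tau>: "\<And>n. 0 \<le> \<tau> n" "\<And>n. r \<le> dist (\<Phi> (\<tau> n) (p n)) \<xi>"
  shows "filterlim \<tau> at_top sequentially"
  unfolding filterlim_at_top
proof
  fix T :: real
  have eq: "t \<in> I x \<and> \<Phi> t x \<in> {\<xi>}" if "x \<in> {\<xi>}" for x t
    using equilibrium[OF equilibrium_E[OF assms(1)]] that by simp
  obtain \<eta> L where \<eta>: "0 < \<eta>" "0 < L"
    "\<And>x y t. x \<in> {\<xi>} \<Longrightarrow> dist y x < \<eta> \<Longrightarrow> \<bar>t\<bar> \<le> max 0 T \<Longrightarrow> t \<in> I y \<and> dist (\<Phi> t y) (\<Phi> t x) \<le> L * dist y x"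
    by (rule dependence_invariant[of "max 0 T" "{\<xi>}"]) (use eq in auto)
  have "\<forall>\<^sub>F n in sequentially. dist (p n) \<xi> < min \<eta> (r / L)"
    using \<eta> r_pos by (intro tendstoD[OF assms(2)]) simp
  thus "\<forall>\<^sub>F n in sequentially. T \<le> \<tau> n"
  proof eventually_elim
    case (elim n)
    show ?case
    proof (rule ccontr)
      assume "\<not> T \<le> \<tau> n"
      hence "\<bar>\<tau> n\<bar> \<le> max 0 T" using \<tau>(1)[of n] by simp
      from \<eta>(3)[OF _ _ this, of \<xi> "p n"] elim eq[of \<xi> "\<tau> n"]
      have "dist (\<Phi> (\<tau> n) (p n)) \<xi> \<le> L * dist (p n) \<xi>" by simp
      also have "\<dots> < r" using elim \<eta>(2) by (simp add: field_simps)
      finally show False using \<tau>(2)[of n] by simp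
    qed
  qed
qed

text \<open>Otherwise there are orbit segments in the ball that start closer and closer to \<open>Y\<close> but end at
  distance at least \<open>\<epsilon>\<close>. By \<open>growth\<close> their durations tend to infinity, so a limit of their endpoints
  has a backward orbit in the ball. It thus belongs to the unstable set of \<open>\<xi>\<close>, which is part of \<open>Y\<close>.\<close>

lemma local_stability:
  assumes "0 < \<epsilon>"
  obtains \<eta> where "0 < \<eta>" "\<And>\<xi> q t. \<xi> \<in> E \<Longrightarrow> D q < \<eta> \<Longrightarrow> 0 \<le> t \<Longrightarrow>
    \<forall>s. 0 \<le> s \<and> s \<le> t \<longrightarrow> s \<in> I q \<and> dist (\<Phi> s q) \<xi> \<le> r \<Longrightarrow> D (\<Phi> t q) < \<epsilon>"
proof -
  define P where "P \<xi> \<eta> \<longleftrightarrow> (\<forall>q t. D q < \<eta> \<and> 0 \<le> t \<and>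
    (\<forall>s. 0 \<le> s \<and> s \<le> t \<longrightarrow> s \<in> I q \<and> dist (\<Phi> s q) \<xi> \<le> r) \<longrightarrow> D (\<Phi> t q) < \<epsilon>)" for \<xi> \<eta>
  have "\<exists>\<eta>>0. \<forall>\<xi>\<in>E. P \<xi> \<eta>"
  proof (rule finite_uniform[OF finite_E])
    fix \<xi> assume \<xi>: "\<xi> \<in> E"
    show "\<exists>\<eta>>0. P \<xi> \<eta>"
    proof (rule ccontr)
      assume "\<not> ?thesis"
      hence "\<not> P \<xi> (1 / real (Suc n))" for n by auto
      hence "\<exists>q t. D q < 1 / real (Suc n) \<and> 0 \<le> t \<and>
        (\<forall>s. 0 \<le> s \<and> s \<le> t \<longrightarrow> s \<in> I q \<and> dist (\<Phi> s q) \<xi> \<le> r) \<and> \<epsilon> \<le> D (\<Phi> t q)" for n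
        unfolding P_def by (auto simp: not_less)
      then obtain q t where q: "\<And>n. D (q n) < 1 / real (Suc n)" "\<And>n. 0 \<le> t n"
        "\<And>n s. 0 \<le> s \<Longrightarrow> s \<le> t n \<Longrightarrow> s \<in> I (q n) \<and> dist (\<Phi> s (q n)) \<xi> \<le> r"
        "\<And>n. \<epsilon> \<le> D (\<Phi> (t n) (q n))" by metis
      have D0: "(\<lambda>n. D (q n)) \<longlonglongrightarrow> 0"
        by (rule tendsto_zero_inverse_Suc[where c = 1]) (use q(1) in \<open>auto intro: less_imp_le infdist_nonneg\<close>)
      have t_lim: "filterlim t at_top sequentially"
        unfolding filterlim_at_top
      proof
        fix T :: real
        obtain \<eta> L where \<eta>: "0 < \<eta>" "1 \<le> L"
          "\<And>x t. D x < \<eta> \<Longrightarrow> \<bar>t\<bar> \<le> max 0 T \<Longrightarrow> t \<in> I x \<and> D (\<Phi> t x) \<le> L * D x"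
          using growth[of "max 0 T"] by auto
        have "\<forall>\<^sub>F n in sequentially. D (q n) < min \<eta> (\<epsilon> / L)"
          using \<eta> \<open>0 < \<epsilon>\<close> by (intro order_tendstoD[OF D0]) auto
        thus "\<forall>\<^sub>F n in sequentially. T \<le> t n"
        proof eventually_elim
          case (elim n)
          show ?case
          proof (rule ccontr)
            assume "\<not> T \<le> t n"
            hence "\<bar>t n\<bar> \<le> max 0 T" using q(2)[of n] by simp
            hence "D (\<Phi> (t n) (q n)) \<le> L * D (q n)" using \<eta>(3) elim by simp
            also have "\<dots> < \<epsilon>" using elim \<eta>(2) by (simp add: field_simps)
            finally show False using q(4)[of n] by simp
          qed
        qed
      qed
      have "\<forall>n. \<Phi> (t n) (q n) \<in> cball \<xi> r" using q(2,3) by (auto simp: dist_commute)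
      then obtain z \<sigma> where \<sigma>: "strict_mono \<sigma>" "((\<lambda>n. \<Phi> (t n) (q n)) \<circ> \<sigma>) \<longlonglongrightarrow> z"
        using compact_imp_seq_compact[OF compact_cball, of \<xi> r] seq_compactE by (metis (no_types, lifting))
      hence z: "(\<lambda>n. \<Phi> (t (\<sigma> n)) (q (\<sigma> n))) \<longlonglongrightarrow> z" by (simp add: o_def)
      have lim: "filterlim (\<lambda>n. t (\<sigma> n)) at_top sequentially"
        using filterlim_compose[OF t_lim filterlim_subseq[OF \<sigma>(1)]] .
      have bwd: "s \<in> I z \<and> \<Phi> s z \<in> cball \<xi> r" if "s \<le> 0" for s
        by (rule backward_limit_in_ball[OF lim q(2) q(3) z that])
      have "z \<in> Y" using backward_trapped[OF \<xi> bwd] by blast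
      moreover have "(\<lambda>n. D (\<Phi> (t (\<sigma> n)) (q (\<sigma> n)))) \<longlonglongrightarrow> D z" by (rule tendsto_infdist[OF z])
      hence "\<epsilon> \<le> D z" by (rule tendsto_lowerbound) (use q(4) in auto)
      ultimately show False using \<open>0 < \<epsilon>\<close> by simp
    qed
  next
    fix \<xi> \<eta> \<eta>' :: real and \<zeta> assume "P \<zeta> \<eta>" "0 < \<eta>'" "\<eta>' \<le> \<eta>"
    thus "P \<zeta> \<eta>'" unfolding P_def by (meson less_le_trans)
  qed
  then obtain \<eta> where "0 < \<eta>" "\<forall>\<xi>\<in>E. P \<xi> \<eta>" by blast
  thus thesis using that[of \<eta>] unfolding P_def by blast
qed

text \<open>A point \<open>x\<close> outside \<open>Y\<close> and close to \<open>y\<close> would pass through the box of \<open>e\<close> within the time from \<open>s\<close> to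
  \<open>u\<close>. The backward bound of \<open>growth\<close> gives \<open>D_in \<le> L * D_out\<close>, whereas the estimate for the
  passage gives \<open>D_out \<le> A * D_in powr \<rho> e\<close>. For \<open>\<rho> e > 1\<close> both are compatible only if \<open>D_in\<close> is not
  too small, but it tends to 0 as \<open>x\<close> tends to \<open>y\<close>.\<close>

lemma strong_equilibrium_not_skipped:
  assumes e: "e \<in> E" "1 < \<rho> e" and y: "y \<in> Y" "y \<in> closure (- Y)"
    and ab: "a \<in> E" "a \<noteq> e" "b \<in> E" "b \<noteq> e" and times: "s < t" "t < u"
    and visits: "\<Phi> s y \<in> B a" "\<Phi> t y \<in> B e" "\<Phi> u y \<in> B b"
  shows False
proof -
  obtain x where x: "\<And>n. x n \<notin> Y" "x \<longlonglongrightarrow> y"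
    using y(2) unfolding closure_sequential by auto
  define T where "T = \<bar>s\<bar> + \<bar>u\<bar>"
  have "0 \<le> T" by (simp add: T_def)
  obtain \<eta> L where \<eta>: "0 < \<eta>" "1 \<le> L"
    "\<And>x t. D x < \<eta> \<Longrightarrow> \<bar>t\<bar> \<le> T \<Longrightarrow> t \<in> I x \<and> D (\<Phi> t x) \<le> L * D x"
    using growth[OF \<open>0 \<le> T\<close>] by metis
  \<comment> \<open>for distances below \<open>k\<close> the two bounds contradict each other\<close>
  define k where "k = (1 / (2 * L * A)) powr (1 / (\<rho> e - 1))"
  have "0 < k" using \<eta>(2) A_pos by (simp add: k_def)
  define m where "m = min \<eta> (min \<delta> k)"
  have "0 < m" using \<eta>(1) \<delta>_pos \<open>0 < k\<close> by (simp add: m_def)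
  have D0: "(\<lambda>n. D (x n)) \<longlonglongrightarrow> 0" using tendsto_infdist[OF x(2), of Y] y(1) by simp
  have "\<forall>\<^sub>F n in sequentially. D (x n) < m / L"
    using \<open>0 < m\<close> \<eta>(2) by (intro order_tendstoD[OF D0]) auto
  moreover have ev: "\<forall>\<^sub>F n in sequentially. \<Phi> w (x n) \<in> B c" if "c \<in> E" "\<Phi> w y \<in> B c" for w c
    by (rule topological_tendstoD[OF flow_tendsto(2)[OF I_Y[OF y(1)] x(2) tendsto_const] open_B[OF that(1)] that(2)])
  note ev[OF ab(1) visits(1)] ev[OF e(1) visits(2)] ev[OF ab(3) visits(3)]
  ultimately have "\<forall>\<^sub>F n in sequentially. D (x n) < m / L \<and> \<Phi> s (x n) \<in> B a \<and> \<Phi> t (x n) \<in> B e \<and> \<Phi> u (x n) \<in> B b"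
    by eventually_elim simp
  then obtain n where n: "D (x n) < m / L" "\<Phi> s (x n) \<in> B a" "\<Phi> t (x n) \<in> B e" "\<Phi> u (x n) \<in> B b"
    by (auto simp: eventually_sequentially)
  define p where "p = x n"
  have p: "p \<notin> Y" "L * D p < m" "\<Phi> s p \<in> B a" "\<Phi> t p \<in> B e" "\<Phi> u p \<in> B b"
    using n x(1) \<eta>(2) by (auto simp: p_def field_simps)
  have "D p \<le> L * D p" using mult_right_mono[OF \<eta>(2), of "D p"] by (simp add: infdist_nonneg)
  hence Dp: "D p < \<eta>" using p(2) by (simp add: m_def)
  have tm: "w \<in> I p \<and> D (\<Phi> w p) < m" if "s \<le> w" "w \<le> u" for w
  proof -
    have "\<bar>w\<bar> \<le> T" using that by (simp add: T_def)
    from \<eta>(3)[OF Dp this] p(2) show ?thesis by linarith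
  qed
  have cl: "closed (- B e)" using open_B[OF e(1)] by (simp add: closed_def)
  have notin: "\<Phi> s p \<in> - B e" "\<Phi> u p \<in> - B e" using p disjoint_B[OF _ e(1)] ab by blast+
  have sub: "{s..t} \<subseteq> I p" "{t..u} \<subseteq> I p" using tm times by auto
  obtain i where i: "s \<le> i" "i \<le> t" "\<Phi> i p \<notin> B e" "\<And>w. i < w \<Longrightarrow> w \<le> t \<Longrightarrow> \<Phi> w p \<in> B e"
    using last_hitting_time[OF less_imp_le[OF times(1)] continuous_on_flow[OF sub(1)] cl notin(1)] by auto
  obtain j where j: "t \<le> j" "j \<le> u" "\<Phi> j p \<notin> B e" "\<And>w. t \<le> w \<Longrightarrow> w < j \<Longrightarrow> \<Phi> w p \<in> B e"
    using first_hitting_time[OF less_imp_le[OF times(2)] continuous_on_flow[OF sub(2)] cl notin(2)] by auto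
  have "i \<noteq> t" using i(3) p(4) by auto
  hence "i < j" using i j by simp
  have pass: "passage I \<Phi> (B e) p i j"
    unfolding passage_def
  proof (intro conjI ballI subsetI)
    fix w assume "w \<in> {i<..<j}"
    thus "\<Phi> w p \<in> B e" using i(4)[of w] j(4)[of w] by (cases "w \<le> t") auto
  next
    fix w assume "w \<in> {i..j}" thus "w \<in> I p" using tm[of w] i j by auto
  qed (use i j \<open>i < j\<close> in auto)
  have iI: "i \<in> I p" "D (\<Phi> i p) < m" and jI: "j \<in> I p" "D (\<Phi> j p) < m" using tm[of i] tm[of j] i j by auto
  have est: "D (\<Phi> j p) \<le> A * D (\<Phi> i p) powr \<rho> e"
    by (rule estimate[OF e(1) p(1) pass]) (use tm i j in \<open>force simp: m_def\<close>)
  have bwd: "D (\<Phi> i p) \<le> L * D (\<Phi> j p)"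
  proof -
    have "D (\<Phi> j p) < \<eta>" using jI(2) by (simp add: m_def)
    moreover have "\<bar>i - j\<bar> \<le> T" using i j \<open>i < j\<close> by (simp add: T_def)
    ultimately have "D (\<Phi> (i - j) (\<Phi> j p)) \<le> L * D (\<Phi> j p)" using \<eta>(3) by blast
    thus ?thesis using flow_add[OF jI(1), of "i - j"] iI by simp
  qed
  define d where "d = D (\<Phi> i p)"
  have d: "0 < d" "d < k" using D_pos[OF flow_notin_Y[OF p(1) iI(1)]] iI(2) by (auto simp: d_def m_def)
  have "d \<le> L * (A * d powr \<rho> e)"
    using bwd mult_left_mono[OF est, of L] \<eta>(2) unfolding d_def by linarith
  also have "d powr \<rho> e = d * d powr (\<rho> e - 1)"
    using powr_add[of d 1 "\<rho> e - 1"] d(1) by simp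
  finally have "d * 1 \<le> d * (L * A * d powr (\<rho> e - 1))" by (simp add: mult_ac)
  hence "1 \<le> L * A * d powr (\<rho> e - 1)" using d(1) by (simp only: mult_le_cancel_left_pos)
  also have "\<dots> \<le> L * A * k powr (\<rho> e - 1)"
    using d e(2) \<eta>(2) A_pos by (intro mult_left_mono powr_mono2) auto
  also have "k powr (\<rho> e - 1) = 1 / (2 * L * A)"
    using e(2) \<eta>(2) A_pos by (simp add: k_def powr_powr)
  finally show False using \<eta>(2) A_pos by simp
qed

end

section \<open>The order in which equilibria are visited\<close>

context network_flow
begin

text \<open>Visits within the distance \<open>r1\<close> are close enough for the next equilibrium to be allowed. The points \<open>y\<close>
  are restricted to limits of points outside \<open>Y\<close>, because the passage estimate speaks of trajectories
  outside \<open>Y\<close>. The second conclusion ensures that a trajectory that shadows the orbit of \<open>y\<close> leaves the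
  box of \<open>\<xi>\<close> even if \<open>\<kappa> = \<xi>\<close>.\<close>

definition "visit_radius \<xi> r1 \<longleftrightarrow> (\<forall>y t \<kappa>. dist (\<Phi> (- t) y) \<xi> \<le> r1 \<longrightarrow>
    y \<in> Y \<and> y \<in> closure (- Y) \<and> dist y \<xi> = r \<and> 0 \<le> t \<and>
    (\<forall>s. - t \<le> s \<and> s \<le> 0 \<longrightarrow> dist (\<Phi> s y) \<xi> \<le> r) \<and> \<kappa> \<in> E \<and> \<kappa> \<in> omega_limit I \<Phi> y \<longrightarrow>
    allowed \<xi> \<kappa> \<and> (\<exists>\<eta>\<in>E. \<eta> \<noteq> \<xi> \<and> (\<exists>s\<ge>0. dist (\<Phi> s y) \<eta> < r)))"

text \<open>Suppose that an orbit in \<open>Y\<close> comes very close to \<open>\<xi>\<close>, leaves the ball around \<open>\<xi>\<close> at \<open>y\<close> and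
  converges to \<open>\<kappa>\<close>. In the limit of orbits that come arbitrarily close to \<open>\<xi>\<close>, the exit point lies on
  a connection from \<open>\<xi>\<close> to some \<open>\<kappa>1\<close>, so the orbits come arbitrarily close to \<open>\<kappa>1\<close>. Among the
  equilibria that are approached in this way and that are allowed after \<open>\<xi>\<close>, choose one, \<open>e\<close>, of
  maximal weight. If \<open>e\<close> is not the final limit of the orbits, then they pass it in between two other
  boxes, hence \<open>\<rho> e \<le> 1\<close>. They leave \<open>e\<close> close to a connection to some \<open>e'\<close>, which is then also
  approached and allowed, and \<open>\<theta> e' \<ge> \<Lambda> * \<theta> e > \<theta> e\<close> contradicts the choice of \<open>e\<close>.\<close>

lemma successor_allowed:
  assumes \<xi>: "\<xi> \<in> E"
  shows "\<exists>r1>0. visit_radius \<xi> r1"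
proof (rule ccontr)
  assume contra: "\<not> ?thesis"
  have "\<exists>y t \<kappa>. dist (\<Phi> (- t) y) \<xi> \<le> 1 / real (Suc n) \<and>
      y \<in> Y \<and> y \<in> closure (- Y) \<and> dist y \<xi> = r \<and> 0 \<le> t \<and>
      (\<forall>s. - t \<le> s \<and> s \<le> 0 \<longrightarrow> dist (\<Phi> s y) \<xi> \<le> r) \<and> \<kappa> \<in> E \<and> \<kappa> \<in> omega_limit I \<Phi> y \<and>
      \<not> (allowed \<xi> \<kappa> \<and> (\<exists>\<eta>\<in>E. \<eta> \<noteq> \<xi> \<and> (\<exists>s\<ge>0. dist (\<Phi> s y) \<eta> < r)))" for n
  proof -
    have "0 < 1 / real (Suc n)" by simp
    hence "\<not> visit_radius \<xi> (1 / real (Suc n))" using contra by blast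
    thus ?thesis unfolding visit_radius_def by (simp only: not_all not_imp) blast
  qed
  then obtain y t \<kappa> where yY: "\<And>n. y n \<in> Y" and yc: "\<And>n. y n \<in> closure (- Y)"
    and yr: "\<And>n. dist (y n) \<xi> = r" and t0: "\<And>n. 0 \<le> t n"
    and orbit: "\<And>n s. - t n \<le> s \<Longrightarrow> s \<le> 0 \<Longrightarrow> dist (\<Phi> s (y n)) \<xi> \<le> r"
    and start: "\<And>n. dist (\<Phi> (- t n) (y n)) \<xi> \<le> 1 / real (Suc n)"
    and \<kappa>E: "\<And>n. \<kappa> n \<in> E" and \<kappa>: "\<And>n. \<kappa> n \<in> omega_limit I \<Phi> (y n)"
    and bad: "\<And>n. \<not> (allowed \<xi> (\<kappa> n) \<and> (\<exists>\<eta>\<in>E. \<eta> \<noteq> \<xi> \<and> (\<exists>s\<ge>0. dist (\<Phi> s (y n)) \<eta> < r)))"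
    by metis
  define p where "p n = \<Phi> (- t n) (y n)" for n
  have "(\<lambda>n. dist (p n) \<xi>) \<longlonglongrightarrow> 0"
    by (rule tendsto_zero_inverse_Suc[where c = 1]) (use start in \<open>auto simp: p_def\<close>)
  hence p_lim: "p \<longlonglongrightarrow> \<xi>" by (rule tendsto_dist_iff[THEN iffD2])
  have pY: "p n \<in> Y" for n using flow_Y yY by (simp add: p_def)
  have p_flow: "\<Phi> s (p n) = \<Phi> (s - t n) (y n)" for s n
    unfolding p_def using flow_add[of "- t n" "y n" s] I_Y[OF yY] by simp
  have orbit': "s \<in> I (p n) \<and> dist (\<Phi> s (p n)) \<xi> \<le> r" if "0 \<le> s" "s \<le> t n" for s n
    using orbit[of n "s - t n"] I_Y[OF pY] that by (simp add: p_flow)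
  have exit_eq: "\<Phi> (t n) (p n) = y n" for n by (simp add: p_flow)
  have exit_r: "dist (\<Phi> (t n) (p n)) \<xi> = r" for n using exit_eq yr by simp
  have t_lim: "filterlim t at_top sequentially"
    by (rule exit_time_unbounded[OF \<xi> p_lim t0]) (simp add: exit_r)
  obtain \<sigma> z \<kappa>1 where \<sigma>: "strict_mono \<sigma>" and z: "(\<lambda>n. \<Phi> (t (\<sigma> n)) (p (\<sigma> n))) \<longlonglongrightarrow> z" "z \<in> Y"
    and \<kappa>1: "\<kappa>1 \<in> E" "\<kappa>1 \<noteq> \<xi>" "allowed \<xi> \<kappa>1" "\<kappa>1 \<in> omega_limit I \<Phi> z"
    by (rule exit_points_limit[OF \<xi> t_lim t0 orbit' exit_r]) blast
  have z_lim: "(\<lambda>n. y (\<sigma> n)) \<longlonglongrightarrow> z" using z(1) by (simp add: exit_eq)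
  obtain T where T: "0 \<le> T" "dist (\<Phi> T z) \<kappa>1 < r"
    using omega_limit_close[OF \<kappa>1(4) r_pos] by metis
  have ev_T: "\<forall>\<^sub>F n in sequentially. dist (\<Phi> T (y (\<sigma> n))) \<kappa>1 < r"
    using eventually_near[OF z_lim I_Y[OF z(2)] T(2)] by eventually_elim simp
  hence not_allowed: "\<forall>\<^sub>F n in sequentially. \<not> allowed \<xi> (\<kappa> (\<sigma> n))"
    by eventually_elim (use bad \<kappa>1 T in blast)
  obtain k where k: "k \<in> E" "\<exists>\<^sub>F n in sequentially. \<kappa> (\<sigma> n) = k"
    using frequently_finite_value[OF finite_E, of "\<lambda>n. \<kappa> (\<sigma> n)"] \<kappa>E by blast
  \<comment> \<open>Visits are counted only after time \<open>T\<close>, at which the orbits are near \<open>\<kappa>1\<close>, while they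
    are near \<open>\<xi>\<close> at time 0. Since \<open>\<kappa>1 \<noteq> \<xi>\<close>, an orbit that visits \<open>e\<close> has been in the box of an
    equilibrium other than \<open>e\<close> before.\<close>
  define visited where "visited e \<longleftrightarrow> (\<forall>\<epsilon>>0. \<exists>\<^sub>F n in sequentially. \<kappa> (\<sigma> n) = k \<and>
      dist (\<Phi> T (y (\<sigma> n))) \<kappa>1 < r \<and> (\<exists>s>T. dist (\<Phi> s (y (\<sigma> n))) e < \<epsilon>))" for e
  have "visited \<kappa>1"
    unfolding visited_def
  proof (intro allI impI)
    fix \<epsilon> :: real assume "0 < \<epsilon>"
    obtain s where s: "T + 1 \<le> s" "dist (\<Phi> s z) \<kappa>1 < \<epsilon>"
      using omega_limit_close[OF \<kappa>1(4) \<open>0 < \<epsilon>\<close>] by metis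
    have "\<forall>\<^sub>F n in sequentially. dist (\<Phi> s (y (\<sigma> n))) \<kappa>1 < \<epsilon>"
      using eventually_near[OF z_lim I_Y[OF z(2)] s(2)] by eventually_elim simp
    with ev_T have "\<forall>\<^sub>F n in sequentially. dist (\<Phi> T (y (\<sigma> n))) \<kappa>1 < r \<and> (\<exists>s>T. dist (\<Phi> s (y (\<sigma> n))) \<kappa>1 < \<epsilon>)"
      by eventually_elim (use s(1) in \<open>auto intro!: exI[of _ s]\<close>)
    from frequently_eventually_conj[OF k(2) this]
    show "\<exists>\<^sub>F n in sequentially. \<kappa> (\<sigma> n) = k \<and> dist (\<Phi> T (y (\<sigma> n))) \<kappa>1 < r \<and> (\<exists>s>T. dist (\<Phi> s (y (\<sigma> n))) \<kappa>1 < \<epsilon>)"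
      by (rule frequently_elim1) auto
  qed
  define S where "S = {e \<in> E. allowed \<xi> e \<and> visited e}"
  have "finite S" "\<kappa>1 \<in> S" using finite_E \<kappa>1 \<open>visited \<kappa>1\<close> by (auto simp: S_def)
  define M where "M = Max (\<theta> ` S)"
  have "M \<in> \<theta> ` S" unfolding M_def using \<open>finite S\<close> \<open>\<kappa>1 \<in> S\<close> by (intro Max_in) auto
  then obtain e where e: "e \<in> S" "M = \<theta> e" by blast
  have e_max: "\<theta> e' \<le> \<theta> e" if "e' \<in> S" for e'
    unfolding e(2)[symmetric] M_def using \<open>finite S\<close> that by simp
  have eE: "e \<in> E" "allowed \<xi> e" "visited e" using e(1) by (auto simp: S_def)
  have "e \<noteq> k"
  proof
    assume "e = k"
    from frequently_eventually_conj[OF k(2) not_allowed]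
    obtain n where "\<kappa> (\<sigma> n) = k" "\<not> allowed \<xi> (\<kappa> (\<sigma> n))" by (auto dest: frequently_ex)
    thus False using eE(2) \<open>e = k\<close> by simp
  qed
  have weak: "\<rho> e \<le> 1"
  proof (rule ccontr)
    assume "\<not> \<rho> e \<le> 1"
    hence strong: "1 < \<rho> e" by simp
    obtain n s where n: "\<kappa> (\<sigma> n) = k" "dist (\<Phi> T (y (\<sigma> n))) \<kappa>1 < r" "T < s" "dist (\<Phi> s (y (\<sigma> n))) e < r"
      using frequently_ex[OF eE(3)[unfolded visited_def, rule_format, OF r_pos]] by blast
    obtain u where u: "s + 1 \<le> u" "dist (\<Phi> u (y (\<sigma> n))) k < r"
      using omega_limit_close[OF \<kappa>[of "\<sigma> n"] r_pos] unfolding n(1) by metis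
    have B: "\<Phi> s (y (\<sigma> n)) \<in> B e" "\<Phi> u (y (\<sigma> n)) \<in> B k" "\<Phi> T (y (\<sigma> n)) \<in> B \<kappa>1" "\<Phi> 0 (y (\<sigma> n)) \<in> B \<xi>"
      using ball_small eE(1) k(1) \<kappa>1(1) \<xi> n u(2) yr by simp_all
    have su: "s < u" using u(1) by simp
    show False
    proof (cases "e = \<xi>")
      case True
      hence "\<kappa>1 \<noteq> e" using \<kappa>1(2) by simp
      from strong_equilibrium_not_skipped[OF eE(1) strong yY yc \<kappa>1(1) this k(1) _ n(3) su B(3,1,2)] \<open>e \<noteq> k\<close>
      show ?thesis by simp
    next
      case False
      have "0 < s" using T(1) n(3) by simp
      from strong_equilibrium_not_skipped[OF eE(1) strong yY yc \<xi> _ k(1) _ this su B(4,1,2)] \<open>e \<noteq> k\<close> False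
      show ?thesis by simp
    qed
  qed
  have "\<exists>n\<ge>j. \<kappa> (\<sigma> n) = k \<and> dist (\<Phi> T (y (\<sigma> n))) \<kappa>1 < r \<and> (\<exists>s>T. dist (\<Phi> s (y (\<sigma> n))) e < r / real (Suc j))" for j
  proof -
    have "0 < r / real (Suc j)" using r_pos by simp
    from eE(3)[unfolded visited_def, rule_format, OF this]
    show ?thesis unfolding frequently_sequentially by blast
  qed
  then obtain m s where m: "\<And>j. j \<le> m j" "\<And>j. \<kappa> (\<sigma> (m j)) = k" "\<And>j. dist (\<Phi> T (y (\<sigma> (m j)))) \<kappa>1 < r"
    and s: "\<And>j. T < s j" "\<And>j. dist (\<Phi> (s j) (y (\<sigma> (m j)))) e < r / real (Suc j)" by metis
  define q where "q j = \<Phi> (s j) (y (\<sigma> (m j)))" for j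
  have qY: "q j \<in> Y" for j using flow_Y yY by (simp add: q_def)
  have q_flow: "\<Phi> w (q j) = \<Phi> (w + s j) (y (\<sigma> (m j)))" for w j
    unfolding q_def using flow_add[of "s j" "y (\<sigma> (m j))" w] I_Y[OF yY] by simp
  have "(\<lambda>j. dist (q j) e) \<longlonglongrightarrow> 0"
    by (rule tendsto_zero_inverse_Suc[where c = r]) (use s(2) in \<open>auto simp: q_def intro: less_imp_le\<close>)
  hence q_lim: "q \<longlonglongrightarrow> e" by (rule tendsto_dist_iff[THEN iffD2])
  have "\<exists>\<tau>\<ge>0. (\<forall>w. 0 \<le> w \<and> w \<le> \<tau> \<longrightarrow> w \<in> I (q j) \<and> dist (\<Phi> w (q j)) e \<le> r) \<and> dist (\<Phi> \<tau> (q j)) e = r" for j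
  proof -
    obtain u where u: "s j \<le> u" "dist (\<Phi> u (y (\<sigma> (m j)))) k < r"
      using omega_limit_close[OF \<kappa>[of "\<sigma> (m j)"] r_pos] unfolding m(2) by metis
    have "\<Phi> u (y (\<sigma> (m j))) \<in> B k" using ball_small[OF k(1)] u(2) by simp
    hence "\<Phi> u (y (\<sigma> (m j))) \<notin> B e" using disjoint_B[OF k(1) eE(1)] \<open>e \<noteq> k\<close> by blast
    hence out: "r < dist (\<Phi> (u - s j) (q j)) e"
      using ball_small[OF eE(1), of "\<Phi> u (y (\<sigma> (m j)))"] by (auto simp: q_flow not_le[symmetric])
    have "r / real (Suc j) \<le> r" using r_pos by (simp add: field_simps)
    hence near: "dist (q j) e \<le> r" using s(2)[of j] by (simp add: q_def)
    have "0 \<le> u - s j" using u(1) by simp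
    from first_exit[OF near this I_Y[OF qY] out] show ?thesis by metis
  qed
  then obtain \<tau> where \<tau>: "\<And>j. 0 \<le> \<tau> j"
    "\<And>j w. 0 \<le> w \<Longrightarrow> w \<le> \<tau> j \<Longrightarrow> w \<in> I (q j) \<and> dist (\<Phi> w (q j)) e \<le> r" "\<And>j. dist (\<Phi> (\<tau> j) (q j)) e = r"
    by metis
  have \<tau>_lim: "filterlim \<tau> at_top sequentially"
    by (rule exit_time_unbounded[OF eE(1) q_lim \<tau>(1)]) (simp add: \<tau>(3))
  obtain \<sigma>' z' e' where \<sigma>': "strict_mono \<sigma>'" and z': "(\<lambda>j. \<Phi> (\<tau> (\<sigma>' j)) (q (\<sigma>' j))) \<longlonglongrightarrow> z'" "z' \<in> Y"
    and e': "e' \<in> E" "allowed e e'" "e' \<in> omega_limit I \<Phi> z'"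
    by (rule exit_points_limit[OF eE(1) \<tau>_lim \<tau>]) blast
  have "visited e'"
    unfolding visited_def
  proof (intro allI impI)
    fix \<epsilon> :: real assume "0 < \<epsilon>"
    obtain w where w: "0 \<le> w" "dist (\<Phi> w z') e' < \<epsilon>"
      using omega_limit_close[OF e'(3) \<open>0 < \<epsilon>\<close>] by metis
    have "\<forall>\<^sub>F j in sequentially. dist (\<Phi> w (\<Phi> (\<tau> (\<sigma>' j)) (q (\<sigma>' j)))) e' < \<epsilon>"
      using eventually_near[OF z'(1) I_Y[OF z'(2)] w(2)] by eventually_elim simp
    then obtain J where J: "\<And>j. J \<le> j \<Longrightarrow> dist (\<Phi> w (\<Phi> (\<tau> (\<sigma>' j)) (q (\<sigma>' j)))) e' < \<epsilon>"
      by (auto simp: eventually_sequentially)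
    show "\<exists>\<^sub>F n in sequentially. \<kappa> (\<sigma> n) = k \<and> dist (\<Phi> T (y (\<sigma> n))) \<kappa>1 < r \<and> (\<exists>s>T. dist (\<Phi> s (y (\<sigma> n))) e' < \<epsilon>)"
      unfolding frequently_sequentially
    proof
      fix N
      define j where "j = max J N"
      have "N \<le> m (\<sigma>' j)"
        using m(1)[of "\<sigma>' j"] seq_suble[OF \<sigma>', of j] by (simp add: j_def)
      moreover have "\<Phi> w (\<Phi> (\<tau> (\<sigma>' j)) (q (\<sigma>' j))) = \<Phi> (w + \<tau> (\<sigma>' j) + s (\<sigma>' j)) (y (\<sigma> (m (\<sigma>' j))))"
        using flow_add[OF I_Y[OF qY], of w "\<tau> (\<sigma>' j)" "\<sigma>' j"] I_Y[OF qY] by (simp add: q_flow)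
      hence "dist (\<Phi> (w + \<tau> (\<sigma>' j) + s (\<sigma>' j)) (y (\<sigma> (m (\<sigma>' j))))) e' < \<epsilon>"
        using J[of j] by (simp add: j_def)
      moreover have "T < w + \<tau> (\<sigma>' j) + s (\<sigma>' j)" using s(1)[of "\<sigma>' j"] w(1) \<tau>(1)[of "\<sigma>' j"] by simp
      ultimately show "\<exists>n\<ge>N. \<kappa> (\<sigma> n) = k \<and> dist (\<Phi> T (y (\<sigma> n))) \<kappa>1 < r \<and> (\<exists>s>T. dist (\<Phi> s (y (\<sigma> n))) e' < \<epsilon>)"
        using m(2,3) by blast
    qed
  qed
  have "\<Lambda> * \<theta> e \<le> \<rho> e * \<theta> e'" using e'(2) by (simp add: allowed_def)
  also have "\<dots> \<le> 1 * \<theta> e'" using weak \<theta>_pos[OF e'(1)] by (intro mult_right_mono) auto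
  finally have "\<Lambda> * \<theta> e \<le> \<theta> e'" by simp
  moreover have "1 * \<theta> e < \<Lambda> * \<theta> e" using \<Lambda> \<theta>_pos[OF eE(1)] by (intro mult_strict_right_mono) auto
  ultimately have less: "\<theta> e < \<theta> e'" by simp
  have "\<Lambda> * \<theta> \<xi> \<le> \<rho> \<xi> * \<theta> e" using eE(2) by (simp add: allowed_def)
  also have "\<dots> \<le> \<rho> \<xi> * \<theta> e'" using less \<rho>_pos[OF \<xi>] by simp
  finally have "allowed \<xi> e'" by (simp add: allowed_def)
  hence "e' \<in> S" using e'(1) \<open>visited e'\<close> by (simp add: S_def)
  from e_max[OF this] less show False by simp
qed

lemma successor_radius:
  obtains r1 where "0 < r1" "r1 \<le> r" "\<And>\<xi>. \<xi> \<in> E \<Longrightarrow> visit_radius \<xi> r1"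
proof -
  have mono: "visit_radius \<xi> r'" if vr: "visit_radius \<xi> r1" and "r' \<le> r1" for \<xi> r1 r'
  proof -
    have "dist (\<Phi> (- t) y) \<xi> \<le> r1" if "dist (\<Phi> (- t) y) \<xi> \<le> r'" for t y
      using that \<open>r' \<le> r1\<close> by linarith
    thus ?thesis using vr unfolding visit_radius_def by blast
  qed
  have "\<exists>r1>0. \<forall>\<xi>\<in>E. visit_radius \<xi> r1"
    by (rule finite_uniform[OF finite_E successor_allowed]) (use mono in blast)+
  then obtain r1 where r1: "0 < r1" "\<And>\<xi>. \<xi> \<in> E \<Longrightarrow> visit_radius \<xi> r1" by blast
  show thesis
  proof (rule that[of "min r1 r"])
    show "visit_radius \<xi> (min r1 r)" if "\<xi> \<in> E" for \<xi> by (rule mono[OF r1(2)[OF that]]) simp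
  qed (use r1(1) r_pos in auto)
qed

text \<open>The orbit segments from near \<open>\<xi>\<close> to the exit from the ball accumulate at an orbit in \<open>Y\<close> of the
  kind considered in \<open>successor_allowed\<close>. If their durations are bounded along a subsequence, then the
  whole segments converge; otherwise the limit point has a backward orbit that converges to \<open>\<xi>\<close>.\<close>

lemma exit_points_accumulate:
  assumes \<xi>: "\<xi> \<in> E" and "0 < r1" and \<tau>: "\<And>n. 0 \<le> \<tau> n"
    and D0: "(\<lambda>n. D (q n)) \<longlonglongrightarrow> 0" and start: "\<And>n. dist (q n) \<xi> \<le> r1"
    and orbit: "\<And>n t. 0 \<le> t \<Longrightarrow> t \<le> \<tau> n \<Longrightarrow> t \<in> I (q n) \<and> dist (\<Phi> t (q n)) \<xi> \<le> r"
    and exit: "\<And>n. dist (\<Phi> (\<tau> n) (q n)) \<xi> = r"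
  obtains \<sigma> y t where "strict_mono \<sigma>" "(\<lambda>n. \<Phi> (\<tau> (\<sigma> n)) (q (\<sigma> n))) \<longlonglongrightarrow> y" "y \<in> Y" "dist y \<xi> = r" "0 \<le> t"
    "\<forall>s. - t \<le> s \<and> s \<le> 0 \<longrightarrow> dist (\<Phi> s y) \<xi> \<le> r" "dist (\<Phi> (- t) y) \<xi> \<le> r1"
proof (cases "filterlim \<tau> at_top sequentially")
  case True
  obtain \<sigma> z where \<sigma>: "strict_mono \<sigma>" "(\<lambda>n. \<Phi> (\<tau> (\<sigma> n)) (q (\<sigma> n))) \<longlonglongrightarrow> z" "z \<in> Y" "dist z \<xi> = r"
    "\<xi> \<in> alpha_limit I \<Phi> z" "\<forall>t\<le>0. dist (\<Phi> t z) \<xi> \<le> r"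
    by (rule exit_points_limit[OF \<xi> True \<tau> orbit exit]) blast
  obtain t where "0 \<le> t" "dist (\<Phi> (- t) z) \<xi> < r1" using alpha_limit_close[OF \<sigma>(5) \<open>0 < r1\<close>] by metis
  thus thesis using that[OF \<sigma>(1-4), of t] \<sigma>(6) by (simp add: less_imp_le)
next
  case False
  obtain \<sigma>1 t where \<sigma>1: "strict_mono \<sigma>1" "(\<lambda>n. \<tau> (\<sigma>1 n)) \<longlonglongrightarrow> t" "0 \<le> t"
    by (rule bounded_times_subsequence[OF \<tau> False]) blast
  have "(\<lambda>n. D (q (\<sigma>1 n))) \<longlonglongrightarrow> 0" using LIMSEQ_subseq_LIMSEQ[OF D0 \<sigma>1(1)] by (simp add: o_def)
  then obtain \<sigma>2 x where \<sigma>2: "strict_mono \<sigma>2" "(\<lambda>n. q (\<sigma>1 (\<sigma>2 n))) \<longlonglongrightarrow> x" "x \<in> Y"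
    by (rule near_Y_subsequence) blast
  define \<sigma> where "\<sigma> n = \<sigma>1 (\<sigma>2 n)" for n
  have \<sigma>: "strict_mono \<sigma>" using strict_mono_o[OF \<sigma>1(1) \<sigma>2(1)] by (simp add: \<sigma>_def[abs_def] o_def)
  have q: "(\<lambda>n. q (\<sigma> n)) \<longlonglongrightarrow> x" using \<sigma>2(2) by (simp add: \<sigma>_def)
  have t: "(\<lambda>n. \<tau> (\<sigma> n)) \<longlonglongrightarrow> t" using LIMSEQ_subseq_LIMSEQ[OF \<sigma>1(2) \<sigma>2(1)] by (simp add: \<sigma>_def o_def)
  have lim: "(\<lambda>n. \<Phi> (\<tau> (\<sigma> n)) (q (\<sigma> n))) \<longlonglongrightarrow> \<Phi> t x" by (rule flow_tendsto(2)[OF I_Y[OF \<sigma>2(3)] q t])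
  have "(\<lambda>n. dist (\<Phi> (\<tau> (\<sigma> n)) (q (\<sigma> n))) \<xi>) \<longlonglongrightarrow> dist (\<Phi> t x) \<xi>" by (intro tendsto_dist lim tendsto_const)
  hence dr: "dist (\<Phi> t x) \<xi> = r" using exit by (simp add: LIMSEQ_const_iff)
  have fl: "\<Phi> s (\<Phi> t x) = \<Phi> (s + t) x" for s by (rule flow_add) (use I_Y[OF \<sigma>2(3)] in auto)
  show thesis
  proof (rule that[OF \<sigma> lim flow_Y[OF \<sigma>2(3)] dr \<sigma>1(3)], intro allI impI)
    fix s assume "- t \<le> s \<and> s \<le> 0"
    hence s: "- t \<le> s" "s \<le> 0" by auto
    show "dist (\<Phi> s (\<Phi> t x)) \<xi> \<le> r"
    proof (cases "s = 0")
      case False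
      hence "s + t < t" using s by simp
      hence "\<forall>\<^sub>F n in sequentially. s + t < \<tau> (\<sigma> n)" by (rule order_tendstoD(1)[OF t])
      hence "\<forall>\<^sub>F n in sequentially. dist (\<Phi> (s + t) (q (\<sigma> n))) \<xi> \<le> r"
        by eventually_elim (use orbit s in auto)
      moreover have "(\<lambda>n. dist (\<Phi> (s + t) (q (\<sigma> n))) \<xi>) \<longlonglongrightarrow> dist (\<Phi> (s + t) x) \<xi>"
        by (intro tendsto_dist flow_tendsto(2)[OF I_Y[OF \<sigma>2(3)] q tendsto_const] tendsto_const)
      ultimately show ?thesis unfolding fl by (intro tendsto_upperbound[where F = sequentially]) auto
    qed (use dr in simp)
  next
    have "(\<lambda>n. dist (q (\<sigma> n)) \<xi>) \<longlonglongrightarrow> dist x \<xi>" by (intro tendsto_dist q tendsto_const)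
    hence "dist x \<xi> \<le> r1" by (rule tendsto_upperbound) (use start in auto)
    thus "dist (\<Phi> (- t) (\<Phi> t x)) \<xi> \<le> r1" by (simp add: fl)
  qed
qed

text \<open>The trajectory of \<open>q\<close> leaves the ball around \<open>\<xi>\<close> after time \<open>\<tau>\<close> and the box \<open>B \<xi>\<close> at time \<open>e\<close>, and
  is near the next equilibrium \<open>\<kappa>\<close> at time \<open>t\<close>. The time from \<open>\<tau>\<close> to \<open>t\<close> is bounded by \<open>T\<close>, the
  time spent in the ball is not bounded.\<close>

definition "departs r1 T \<xi> q \<tau> e t \<kappa> \<longleftrightarrow> 0 \<le> \<tau> \<and> \<tau> \<le> e \<and> e \<le> t \<and> t \<le> \<tau> + T \<and> t \<in> I q \<and>
    (\<forall>s. 0 \<le> s \<and> s \<le> \<tau> \<longrightarrow> s \<in> I q \<and> dist (\<Phi> s q) \<xi> \<le> r) \<and>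
    (\<forall>s. 0 \<le> s \<and> s < e \<longrightarrow> \<Phi> s q \<in> B \<xi>) \<and> \<Phi> e q \<notin> B \<xi> \<and>
    \<kappa> \<in> E \<and> allowed \<xi> \<kappa> \<and> \<Phi> e q \<notin> B \<kappa> \<and> dist (\<Phi> t q) \<kappa> \<le> r1"

text \<open>The exit point is a boundary point of the open box \<open>B \<xi>\<close>, and the boundary of an open set does not meet
  an open set that is disjoint from it.\<close>

lemma exit_point_outside:
  assumes \<xi>: "\<xi> \<in> E" "\<kappa> \<in> E" and "0 < e" "e \<in> I q" and inside: "\<And>s. 0 \<le> s \<Longrightarrow> s < e \<Longrightarrow> \<Phi> s q \<in> B \<xi>"
    and out: "\<Phi> e q \<notin> B \<xi>"
  shows "\<Phi> e q \<notin> B \<kappa>"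
proof
  assume *: "\<Phi> e q \<in> B \<kappa>"
  hence ne: "\<kappa> \<noteq> \<xi>" using out by blast
  have "((\<lambda>t. \<Phi> t q) \<longlongrightarrow> \<Phi> e q) (at e)" using isCont_flow[OF \<open>e \<in> I q\<close>] by (simp add: isCont_def)
  hence "((\<lambda>t. \<Phi> t q) \<longlongrightarrow> \<Phi> e q) (at_left e)" by (rule tendsto_mono[OF at_le, rotated]) simp
  from topological_tendstoD[OF this open_B[OF \<xi>(2)] *]
  have "\<forall>\<^sub>F t in at_left e. \<Phi> t q \<in> B \<kappa>" .
  moreover have "\<forall>\<^sub>F t in at_left e. 0 < t \<and> t < e"
    using eventually_at_left_real[OF \<open>0 < e\<close>] by eventually_elim simp
  ultimately have "\<forall>\<^sub>F t in at_left e. False"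
    by eventually_elim (use inside disjoint_B[OF \<xi>(2,1) ne] in \<open>force\<close>)
  thus False by simp
qed

text \<open>By compactness the exit point from the ball is close to a point \<open>y\<close> as in \<open>successor_allowed\<close>. The
  trajectory shadows the orbit of \<open>y\<close> until this orbit is close to its limit \<open>\<kappa>\<close>. The bound \<open>1 / \<eta>\<close> for
  the time makes the statement monotone in \<open>\<eta>\<close>, so one contradiction argument along
  \<open>\<eta> = 1 / Suc n\<close> provides the neighbourhood and the time.\<close>

lemma departure_from:
  assumes \<xi>: "\<xi> \<in> E" and r1: "0 < r1" "r1 \<le> r"
    and succ: "visit_radius \<xi> r1"
  shows "\<exists>\<eta>>0. \<forall>q u. q \<notin> Y \<and> D q < \<eta> \<and> dist q \<xi> \<le> r1 \<and> 0 \<le> u \<and> u \<in> I q \<and> r < dist (\<Phi> u q) \<xi> \<longrightarrow>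
      (\<exists>\<tau> e t \<kappa>. departs r1 (1 / \<eta>) \<xi> q \<tau> e t \<kappa>)" (is "\<exists>\<eta>>0. ?P \<eta>")
proof (rule ccontr)
  assume contra: "\<not> ?thesis"
  have neg: "\<not> ?P (1 / real (Suc n))" for n
  proof -
    have "0 < 1 / real (Suc n)" by simp
    thus ?thesis using contra by blast
  qed
  have "\<exists>q u. q \<notin> Y \<and> D q < 1 / real (Suc n) \<and> dist q \<xi> \<le> r1 \<and> 0 \<le> u \<and> u \<in> I q \<and> r < dist (\<Phi> u q) \<xi> \<and>
      \<not> (\<exists>\<tau> e t \<kappa>. departs r1 (real (Suc n)) \<xi> q \<tau> e t \<kappa>)" for n
    using neg[of n] by (simp only: not_all not_imp) auto
  then obtain q u where q: "\<And>n. q n \<notin> Y" "\<And>n. D (q n) < 1 / real (Suc n)" "\<And>n. dist (q n) \<xi> \<le> r1"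
    and u: "\<And>n. 0 \<le> u n" "\<And>n. u n \<in> I (q n)" "\<And>n. r < dist (\<Phi> (u n) (q n)) \<xi>"
    and bad: "\<And>n. \<not> (\<exists>\<tau> e t \<kappa>. departs r1 (real (Suc n)) \<xi> (q n) \<tau> e t \<kappa>)" by metis
  have D0: "(\<lambda>n. D (q n)) \<longlonglongrightarrow> 0"
    by (rule tendsto_zero_inverse_Suc[where c = 1]) (use q(2) in \<open>auto intro: less_imp_le infdist_nonneg\<close>)
  have "\<exists>\<tau>\<ge>0. (\<forall>t. 0 \<le> t \<and> t \<le> \<tau> \<longrightarrow> t \<in> I (q n) \<and> dist (\<Phi> t (q n)) \<xi> \<le> r) \<and> dist (\<Phi> \<tau> (q n)) \<xi> = r" for n
    using first_exit[OF order_trans[OF q(3) r1(2)] u] by metis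
  then obtain \<tau> where \<tau>: "\<And>n. 0 \<le> \<tau> n" "\<And>n t. 0 \<le> t \<Longrightarrow> t \<le> \<tau> n \<Longrightarrow> t \<in> I (q n) \<and> dist (\<Phi> t (q n)) \<xi> \<le> r"
    "\<And>n. dist (\<Phi> (\<tau> n) (q n)) \<xi> = r" by metis
  obtain \<sigma> y t where \<sigma>: "strict_mono \<sigma>" and y: "(\<lambda>n. \<Phi> (\<tau> (\<sigma> n)) (q (\<sigma> n))) \<longlonglongrightarrow> y" "y \<in> Y" "dist y \<xi> = r"
    and t: "0 \<le> t" "\<forall>s. - t \<le> s \<and> s \<le> 0 \<longrightarrow> dist (\<Phi> s y) \<xi> \<le> r" "dist (\<Phi> (- t) y) \<xi> \<le> r1"
    by (rule exit_points_accumulate[OF \<xi> r1(1) \<tau>(1) D0 q(3) \<tau>(2) \<tau>(3)]) blast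
  have \<tau>I: "\<tau> n \<in> I (q n)" for n using \<tau>(1,2) by blast
  have yc: "y \<in> closure (- Y)"
    by (rule in_closure_complement[OF _ y(1)]) (use flow_notin_Y q(1) \<tau>I in blast)
  obtain \<kappa> where \<kappa>: "\<kappa> \<in> E" "\<kappa> \<in> omega_limit I \<Phi> y" using omega_Y[OF y(2)] by blast
  obtain \<eta> s1 where al: "allowed \<xi> \<kappa>" and \<eta>: "\<eta> \<in> E" "\<eta> \<noteq> \<xi>" "0 \<le> s1" "dist (\<Phi> s1 y) \<eta> < r"
    using succ[unfolded visit_radius_def, rule_format, OF t(3), of \<kappa>] y(2,3) yc t(1,2) \<kappa> by blast
  obtain t1 where t1: "s1 \<le> t1" "dist (\<Phi> t1 y) \<kappa> < r1" using omega_limit_close[OF \<kappa>(2) r1(1)] by metis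
  have "\<forall>\<^sub>F n in sequentially. t1 \<le> real n" using eventually_ge_at_top[of "nat \<lceil>t1\<rceil>"] by eventually_elim linarith
  with eventually_near[OF y(1) I_Y[OF y(2)] \<eta>(4)] eventually_near[OF y(1) I_Y[OF y(2)] t1(2)]
  have "\<forall>\<^sub>F n in sequentially. t1 \<le> real n \<and>
      s1 \<in> I (\<Phi> (\<tau> (\<sigma> n)) (q (\<sigma> n))) \<and> dist (\<Phi> s1 (\<Phi> (\<tau> (\<sigma> n)) (q (\<sigma> n)))) \<eta> < r \<and>
      t1 \<in> I (\<Phi> (\<tau> (\<sigma> n)) (q (\<sigma> n))) \<and> dist (\<Phi> t1 (\<Phi> (\<tau> (\<sigma> n)) (q (\<sigma> n)))) \<kappa> < r1"
    by eventually_elim simp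
  then obtain n where n: "t1 \<le> real n"
      "s1 \<in> I (\<Phi> (\<tau> (\<sigma> n)) (q (\<sigma> n)))" "dist (\<Phi> s1 (\<Phi> (\<tau> (\<sigma> n)) (q (\<sigma> n)))) \<eta> < r"
      "t1 \<in> I (\<Phi> (\<tau> (\<sigma> n)) (q (\<sigma> n)))" "dist (\<Phi> t1 (\<Phi> (\<tau> (\<sigma> n)) (q (\<sigma> n)))) \<kappa> < r1"
    by (auto simp: eventually_sequentially)
  define Q where "Q = q (\<sigma> n)"
  define w where "w = \<tau> (\<sigma> n)"
  have w: "0 \<le> w" "w \<in> I Q" using \<tau>(1) \<tau>I by (auto simp: Q_def w_def)
  have I1: "s1 + w \<in> I Q" "t1 + w \<in> I Q" using n(2,4) I_shift[OF w(2)] by (auto simp: Q_def w_def)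
  have d1: "dist (\<Phi> (s1 + w) Q) \<eta> < r" "dist (\<Phi> (t1 + w) Q) \<kappa> < r1"
    using n(3,5) flow_add[OF w(2) I1(1)] flow_add[OF w(2) I1(2)] by (auto simp: Q_def w_def)
  have "\<Phi> (s1 + w) Q \<in> B \<eta>" using ball_small[OF \<eta>(1)] d1 by simp
  hence out: "\<Phi> (s1 + w) Q \<in> - B \<xi>" using disjoint_B[OF \<eta>(1) \<xi> \<eta>(2)] by blast
  have sub: "{0..s1 + w} \<subseteq> I Q" using I_between[OF zero_in_I I1(1)] by auto
  have nn: "0 \<le> s1 + w" using \<eta>(3) w(1) by simp
  have cl: "closed (- B \<xi>)" using open_B[OF \<xi>] by (simp add: closed_def)
  obtain e where e: "0 \<le> e" "e \<le> s1 + w" "\<Phi> e Q \<notin> B \<xi>" "\<And>s. 0 \<le> s \<Longrightarrow> s < e \<Longrightarrow> \<Phi> s Q \<in> B \<xi>"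
    using first_hitting_time[OF nn continuous_on_flow[OF sub] cl out] by auto
  have inside: "s \<in> I Q" "dist (\<Phi> s Q) \<xi> \<le> r" if "0 \<le> s" "s \<le> w" for s
    using \<tau>(2)[of s "\<sigma> n"] that by (auto simp: Q_def w_def)
  have "w < e"
  proof (rule ccontr)
    assume "\<not> w < e"
    hence "dist (\<Phi> e Q) \<xi> \<le> r" using inside(2) e(1) by simp
    thus False using ball_small[OF \<xi>] e(3) by blast
  qed
  have "departs r1 (real (Suc (\<sigma> n))) \<xi> Q w e (t1 + w) \<kappa>"
    unfolding departs_def
  proof (intro conjI allI impI)
    have "t1 \<le> real (Suc (\<sigma> n))" using n(1) seq_suble[OF \<sigma>, of n] by linarith
    thus "t1 + w \<le> w + real (Suc (\<sigma> n))" by simp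
    have "e \<in> I Q" using sub e by auto
    thus "\<Phi> e Q \<notin> B \<kappa>"
      by (intro exit_point_outside[OF \<xi> \<kappa>(1)]) (use e w \<open>w < e\<close> in auto)
  qed (use w inside e \<open>w < e\<close> t1 I1 d1 \<kappa> al in auto)
  thus False using bad[of "\<sigma> n"] unfolding Q_def by blast
qed

text \<open>A trajectory that starts near \<open>Y\<close> shadows an orbit in \<open>Y\<close>, which converges to an equilibrium. As
  above, \<open>1 / \<eta>\<close> serves as the time bound.\<close>

lemma approach:
  assumes "0 < r1"
  shows "\<exists>\<eta>>0. \<forall>x. D x < \<eta> \<longrightarrow> (\<exists>t \<xi>. 0 \<le> t \<and> t \<le> 1 / \<eta> \<and> t \<in> I x \<and> \<xi> \<in> E \<and> dist (\<Phi> t x) \<xi> \<le> r1)"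
    (is "\<exists>\<eta>>0. ?P \<eta>")
proof (rule ccontr)
  assume contra: "\<not> ?thesis"
  have neg: "\<not> ?P (1 / real (Suc n))" for n
  proof -
    have "0 < 1 / real (Suc n)" by simp
    thus ?thesis using contra by blast
  qed
  have "\<exists>x. D x < 1 / real (Suc n) \<and>
      \<not> (\<exists>t \<xi>. 0 \<le> t \<and> t \<le> real (Suc n) \<and> t \<in> I x \<and> \<xi> \<in> E \<and> dist (\<Phi> t x) \<xi> \<le> r1)" for n
    using neg[of n] by (simp only: not_all not_imp) auto
  then obtain x where x: "\<And>n. D (x n) < 1 / real (Suc n)"
    "\<And>n. \<not> (\<exists>t \<xi>. 0 \<le> t \<and> t \<le> real (Suc n) \<and> t \<in> I (x n) \<and> \<xi> \<in> E \<and> dist (\<Phi> t (x n)) \<xi> \<le> r1)" by metis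
  have "(\<lambda>n. D (x n)) \<longlonglongrightarrow> 0"
    by (rule tendsto_zero_inverse_Suc[where c = 1]) (use x(1) in \<open>auto intro: less_imp_le infdist_nonneg\<close>)
  then obtain \<sigma> y where \<sigma>: "strict_mono \<sigma>" "(\<lambda>n. x (\<sigma> n)) \<longlonglongrightarrow> y" "y \<in> Y"
    by (rule near_Y_subsequence) blast
  obtain \<kappa> where \<kappa>: "\<kappa> \<in> E" "\<kappa> \<in> omega_limit I \<Phi> y" using omega_Y[OF \<sigma>(3)] by blast
  obtain t where t: "0 \<le> t" "dist (\<Phi> t y) \<kappa> < r1" using omega_limit_close[OF \<kappa>(2) assms] by metis
  have "\<forall>\<^sub>F n in sequentially. t \<le> real n" using eventually_ge_at_top[of "nat \<lceil>t\<rceil>"] by eventually_elim linarith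
  with eventually_near[OF \<sigma>(2) I_Y[OF \<sigma>(3)] t(2)]
  have "\<forall>\<^sub>F n in sequentially. t \<le> real n \<and> t \<in> I (x (\<sigma> n)) \<and> dist (\<Phi> t (x (\<sigma> n))) \<kappa> < r1"
    by eventually_elim simp
  then obtain n where n: "t \<le> real n" "t \<in> I (x (\<sigma> n))" "dist (\<Phi> t (x (\<sigma> n))) \<kappa> < r1"
    by (auto simp: eventually_sequentially)
  have "t \<le> real (Suc (\<sigma> n))" using n(1) seq_suble[OF \<sigma>(1), of n] by linarith
  thus False using x(2)[of "\<sigma> n"] n t(1) \<kappa>(1) less_imp_le by blast
qed

text \<open>Used for a lower bound on the duration of a visit, so that infinitely many visits fill all
  positive times.\<close>

lemma slow_motion:
  "\<exists>\<eta>>0. \<forall>x t. D x < \<eta> \<and> 0 \<le> t \<and> t \<le> \<eta> \<longrightarrow> dist (\<Phi> t x) x < r"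
    (is "\<exists>\<eta>>0. ?P \<eta>")
proof (rule ccontr)
  assume contra: "\<not> ?thesis"
  have neg: "\<not> ?P (1 / real (Suc n))" for n
  proof -
    have "0 < 1 / real (Suc n)" by simp
    thus ?thesis using contra by blast
  qed
  have "\<exists>x t. D x < 1 / real (Suc n) \<and> 0 \<le> t \<and> t \<le> 1 / real (Suc n) \<and> r \<le> dist (\<Phi> t x) x" for n
    using neg[of n] by (simp only: not_all not_imp not_less) auto
  then obtain x t where x: "\<And>n. D (x n) < 1 / real (Suc n)" "\<And>n. 0 \<le> t n" "\<And>n. t n \<le> 1 / real (Suc n)"
    "\<And>n. r \<le> dist (\<Phi> (t n) (x n)) (x n)" by metis
  have "(\<lambda>n. D (x n)) \<longlonglongrightarrow> 0"
    by (rule tendsto_zero_inverse_Suc[where c = 1]) (use x(1) in \<open>auto intro: less_imp_le infdist_nonneg\<close>)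
  then obtain \<sigma> y where \<sigma>: "strict_mono \<sigma>" "(\<lambda>n. x (\<sigma> n)) \<longlonglongrightarrow> y" "y \<in> Y"
    by (rule near_Y_subsequence) blast
  have "t \<longlonglongrightarrow> 0" by (rule tendsto_zero_inverse_Suc[where c = 1]) (use x(2,3) in auto)
  hence t0: "(\<lambda>n. t (\<sigma> n)) \<longlonglongrightarrow> 0" using LIMSEQ_subseq_LIMSEQ[OF _ \<sigma>(1)] by (fastforce simp: o_def)
  have "(\<lambda>n. dist (\<Phi> (t (\<sigma> n)) (x (\<sigma> n))) (x (\<sigma> n))) \<longlonglongrightarrow> dist (\<Phi> 0 y) y"
    by (intro tendsto_dist flow_tendsto(2)[OF I_Y[OF \<sigma>(3)] \<sigma>(2) t0] \<sigma>(2))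
  hence "r \<le> dist (\<Phi> 0 y) y" by (rule tendsto_lowerbound) (use x(4) in auto)
  thus False using r_pos by simp
qed

end

section \<open>Growth of the logarithmic distance\<close>

text \<open>A network together with a radius \<open>r1\<close> that defines a close visit, a bound \<open>T\<close> for the time between
  visits and a neighbourhood of \<open>Y\<close> in which both are valid.\<close>

locale network_scales = network_flow f I \<Phi> Y E B r \<delta> A \<Lambda> \<theta> \<rho>
  for f :: "'a::euclidean_space \<Rightarrow> 'a" and I \<Phi> Y E B r \<delta> A \<Lambda> \<theta> \<rho> +
  fixes r1 T \<eta>0 :: real
  assumes r1: "0 < r1" "r1 \<le> r" and T_pos: "0 < T" and \<eta>0_pos: "0 < \<eta>0"
    and departure: "\<And>\<xi> q u. \<xi> \<in> E \<Longrightarrow> q \<notin> Y \<Longrightarrow> D q < \<eta>0 \<Longrightarrow> dist q \<xi> \<le> r1 \<Longrightarrow> 0 \<le> u \<Longrightarrow> u \<in> I q \<Longrightarrow>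
      r < dist (\<Phi> u q) \<xi> \<Longrightarrow> \<exists>\<tau> e t \<kappa>. departs r1 T \<xi> q \<tau> e t \<kappa>"
    and arrival: "\<And>x. D x < \<eta>0 \<Longrightarrow> \<exists>t \<xi>. 0 \<le> t \<and> t \<le> T \<and> t \<in> I x \<and> \<xi> \<in> E \<and> dist (\<Phi> t x) \<xi> \<le> r1"

lemma (in network_flow) departs_mono: "departs r1 T \<xi> q \<tau> e t \<kappa> \<Longrightarrow> T \<le> T' \<Longrightarrow> departs r1 T' \<xi> q \<tau> e t \<kappa>"
  unfolding departs_def by auto

lemma (in network_flow) scales_exist:
  obtains r1 T \<eta>0 where "network_scales f I \<Phi> Y E B r \<delta> A \<Lambda> \<theta> \<rho> r1 T \<eta>0"
proof -
  obtain r1 where r1: "0 < r1" "r1 \<le> r"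
    and succ: "\<And>\<xi>. \<xi> \<in> E \<Longrightarrow> visit_radius \<xi> r1"
    by (rule successor_radius) (rule that)
  define P where "P \<xi> \<eta> \<longleftrightarrow> (\<forall>q u. q \<notin> Y \<and> D q < \<eta> \<and> dist q \<xi> \<le> r1 \<and> 0 \<le> u \<and> u \<in> I q \<and> r < dist (\<Phi> u q) \<xi> \<longrightarrow>
      (\<exists>\<tau> e t \<kappa>. departs r1 (1 / \<eta>) \<xi> q \<tau> e t \<kappa>))" for \<xi> \<eta>
  have "\<exists>\<eta>>0. \<forall>\<xi>\<in>E. P \<xi> \<eta>"
  proof (rule finite_uniform[OF finite_E])
    show "\<exists>\<eta>>0. P \<xi> \<eta>" if "\<xi> \<in> E" for \<xi>
      unfolding P_def by (rule departure_from[OF that r1 succ[OF that]])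
    show "P \<xi> \<eta>'" if P: "P \<xi> \<eta>" and \<eta>': "0 < \<eta>'" "\<eta>' \<le> \<eta>" for \<xi> \<eta> \<eta>'
      unfolding P_def
    proof (intro allI impI)
      fix q u assume q: "q \<notin> Y \<and> D q < \<eta>' \<and> dist q \<xi> \<le> r1 \<and> 0 \<le> u \<and> u \<in> I q \<and> r < dist (\<Phi> u q) \<xi>"
      hence "D q < \<eta>" using \<eta>'(2) by linarith
      then obtain \<tau> e t \<kappa> where "departs r1 (1 / \<eta>) \<xi> q \<tau> e t \<kappa>" using P q unfolding P_def by blast
      moreover have "1 / \<eta> \<le> 1 / \<eta>'" using \<eta>' by (simp add: frac_le)
      ultimately show "\<exists>\<tau> e t \<kappa>. departs r1 (1 / \<eta>') \<xi> q \<tau> e t \<kappa>" using departs_mono by blast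
    qed
  qed
  then obtain \<eta>1 where \<eta>1: "0 < \<eta>1" "\<And>\<xi>. \<xi> \<in> E \<Longrightarrow> P \<xi> \<eta>1" by blast
  obtain \<eta>2 where \<eta>2: "0 < \<eta>2"
    "\<And>x. D x < \<eta>2 \<Longrightarrow> \<exists>t \<xi>. 0 \<le> t \<and> t \<le> 1 / \<eta>2 \<and> t \<in> I x \<and> \<xi> \<in> E \<and> dist (\<Phi> t x) \<xi> \<le> r1"
    using approach[OF r1(1)] by blast
  define T where "T = max (1 / \<eta>1) (1 / \<eta>2)"
  have T: "1 / \<eta>1 \<le> T" "1 / \<eta>2 \<le> T" "0 < T" using \<eta>1(1) by (auto simp: T_def less_max_iff_disj)
  show thesis
  proof (rule that[of r1 T "min \<eta>1 \<eta>2"], unfold_locales)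
    fix \<xi> q u assume "\<xi> \<in> E" "q \<notin> Y" "D q < min \<eta>1 \<eta>2" "dist q \<xi> \<le> r1" "0 \<le> u" "u \<in> I q" "r < dist (\<Phi> u q) \<xi>"
    then obtain \<tau> e t \<kappa> where "departs r1 (1 / \<eta>1) \<xi> q \<tau> e t \<kappa>" using \<eta>1(2)[of \<xi>] unfolding P_def by fastforce
    thus "\<exists>\<tau> e t \<kappa>. departs r1 T \<xi> q \<tau> e t \<kappa>" using departs_mono T(1) by blast
  next
    fix x assume "D x < min \<eta>1 \<eta>2"
    hence "D x < \<eta>2" by simp
    from \<eta>2(2)[OF this] show "\<exists>t \<xi>. 0 \<le> t \<and> t \<le> T \<and> t \<in> I x \<and> \<xi> \<in> E \<and> dist (\<Phi> t x) \<xi> \<le> r1"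
      using T(2) order_trans by blast
  qed (use r1 T \<eta>1(1) \<eta>2(1) in auto)
qed

context network_scales
begin

text \<open>A point about to visit \<open>\<xi>\<close>: it is still outside the box, so that the subsequent visit is part of a
  complete passage to which the estimate applies.\<close>

definition "state \<xi> p \<longleftrightarrow> \<xi> \<in> E \<and> p \<notin> Y \<and> p \<notin> B \<xi> \<and> (\<exists>t. 0 \<le> t \<and> t \<le> T \<and> t \<in> I p \<and> dist (\<Phi> t p) \<xi> \<le> r1)"

definition "stays \<epsilon> x \<longleftrightarrow> (\<forall>t\<ge>0. t \<in> I x \<and> D (\<Phi> t x) < \<epsilon>) \<and> ((\<lambda>t. D (\<Phi> t x)) \<longlongrightarrow> 0) at_top"

definition "exits \<epsilon> \<xi> q e \<kappa> \<longleftrightarrow> 0 \<le> e \<and> (\<forall>t. 0 \<le> t \<and> t \<le> e \<longrightarrow> t \<in> I q \<and> D (\<Phi> t q) < \<epsilon>) \<and>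
    (\<forall>t. 0 \<le> t \<and> t < e \<longrightarrow> \<Phi> t q \<in> B \<xi>) \<and> \<Phi> e q \<notin> B \<xi> \<and> allowed \<xi> \<kappa> \<and> state \<kappa> (\<Phi> e q)"

text \<open>A complete visit. The factor \<open>L\<close> accounts for the motion from \<open>p\<close> to the entry into the box.\<close>

definition "passes h L \<epsilon> \<xi> p e \<kappa> \<longleftrightarrow> h \<le> e \<and> (\<forall>t. 0 \<le> t \<and> t \<le> e \<longrightarrow> t \<in> I p \<and> D (\<Phi> t p) < \<epsilon>) \<and>
    allowed \<xi> \<kappa> \<and> state \<kappa> (\<Phi> e p) \<and> D (\<Phi> e p) \<le> A * (L * D p) powr \<rho> \<xi>"

lemma attracted_shift:
  assumes s: "s \<in> I x" and I: "\<And>t. 0 \<le> t \<Longrightarrow> t \<in> I (\<Phi> s x)" and lim: "((\<lambda>t. D (\<Phi> t (\<Phi> s x))) \<longlongrightarrow> 0) at_top"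
  shows "((\<lambda>t. D (\<Phi> t x)) \<longlongrightarrow> 0) at_top"
proof -
  have "((\<lambda>t. D (\<Phi> (t - s) (\<Phi> s x))) \<longlongrightarrow> 0) at_top"
    by (rule filterlim_compose[OF lim]) (auto intro!: filterlim_tendsto_add_at_top[of "\<lambda>t. - s" "- s", simplified] tendsto_const filterlim_ident)
  moreover have "\<forall>\<^sub>F t in at_top. D (\<Phi> (t - s) (\<Phi> s x)) = D (\<Phi> t x)"
    using eventually_ge_at_top[of s]
  proof eventually_elim
    case (elim t)
    hence "t - s \<in> I (\<Phi> s x)" using I by simp
    hence "t - s + s \<in> I x" using I_shift[OF s] by blast
    from flow_add[OF s this] show ?case by simp
  qed
  ultimately show ?thesis by (rule Lim_transform_eventually)
qed

lemma stays_shift: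
  assumes s: "0 \<le> s" "s \<in> I x" and before: "\<And>t. 0 \<le> t \<Longrightarrow> t \<le> s \<Longrightarrow> t \<in> I x \<and> D (\<Phi> t x) < \<epsilon>"
    and stays: "stays \<epsilon> (\<Phi> s x)"
  shows "stays \<epsilon> x"
proof -
  have after: "t \<in> I (\<Phi> s x)" "D (\<Phi> t (\<Phi> s x)) < \<epsilon>" if "0 \<le> t" for t
    using stays that by (auto simp: stays_def)
  have "t \<in> I x \<and> D (\<Phi> t x) < \<epsilon>" if "0 \<le> t" for t
  proof (cases "t \<le> s")
    case False
    hence *: "t - s \<in> I (\<Phi> s x)" "D (\<Phi> (t - s) (\<Phi> s x)) < \<epsilon>" using after by auto
    hence "t - s + s \<in> I x" using I_shift[OF s(2)] by blast
    thus ?thesis using flow_add[OF s(2), of "t - s"] * by simp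
  qed (use before that in blast)
  moreover have "((\<lambda>t. D (\<Phi> t x)) \<longlongrightarrow> 0) at_top"
    using attracted_shift[OF s(2) after(1)] stays by (simp add: stays_def)
  ultimately show ?thesis by (simp add: stays_def)
qed

text \<open>The trajectory stays close to \<open>Y\<close> in the ball by \<open>local_stability\<close> and after leaving it by \<open>growth\<close>. The
  point where it leaves the box is outside all boxes, hence it is a state for the next equilibrium.\<close>

lemma settle_or_depart:
  assumes "0 < \<epsilon>"
  obtains \<eta> where "0 < \<eta>"
    "\<And>\<xi> q. \<xi> \<in> E \<Longrightarrow> q \<notin> Y \<Longrightarrow> dist q \<xi> \<le> r1 \<Longrightarrow> D q < \<eta> \<Longrightarrow> stays \<epsilon> q \<or> (\<exists>e \<kappa>. exits \<epsilon> \<xi> q e \<kappa>)"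
proof -
  obtain \<eta>g L where g: "0 < \<eta>g" "1 \<le> L" "\<And>x t. D x < \<eta>g \<Longrightarrow> \<bar>t\<bar> \<le> T \<Longrightarrow> t \<in> I x \<and> D (\<Phi> t x) \<le> L * D x"
    using growth[OF less_imp_le[OF T_pos]] by metis
  define \<epsilon>' where "\<epsilon>' = min (\<epsilon> / L) \<eta>g"
  have \<epsilon>': "0 < \<epsilon>'" "\<epsilon>' \<le> \<eta>g" "L * \<epsilon>' \<le> \<epsilon>" using g \<open>0 < \<epsilon>\<close> by (auto simp: \<epsilon>'_def min_def field_simps)
  have "1 * \<epsilon>' \<le> L * \<epsilon>'" using g(2) \<epsilon>'(1) by (intro mult_right_mono) auto
  hence "\<epsilon>' \<le> \<epsilon>" using \<epsilon>'(3) by simp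
  obtain \<eta>1 where \<eta>1: "0 < \<eta>1" "\<And>\<xi> q t. \<xi> \<in> E \<Longrightarrow> D q < \<eta>1 \<Longrightarrow> 0 \<le> t \<Longrightarrow>
    \<forall>s. 0 \<le> s \<and> s \<le> t \<longrightarrow> s \<in> I q \<and> dist (\<Phi> s q) \<xi> \<le> r \<Longrightarrow> D (\<Phi> t q) < \<epsilon>'"
    by (rule local_stability[OF \<epsilon>'(1)]) (rule that)
  show thesis
  proof (rule that[of "min \<eta>0 \<eta>1"])
    fix \<xi> q assume \<xi>: "\<xi> \<in> E" and q: "q \<notin> Y" "dist q \<xi> \<le> r1" "D q < min \<eta>0 \<eta>1"
    hence Dq: "D q < \<eta>0" "D q < \<eta>1" by auto
    show "stays \<epsilon> q \<or> (\<exists>e \<kappa>. exits \<epsilon> \<xi> q e \<kappa>)"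
    proof (cases "\<exists>u\<ge>0. u \<in> I q \<and> r < dist (\<Phi> u q) \<xi>")
      case False
      hence near: "dist (\<Phi> u q) \<xi> \<le> r" if "0 \<le> u" "u \<in> I q" for u using that by (meson not_le)
      obtain R where R: "cball \<xi> r \<subseteq> cball 0 R" by (rule bounded_subset_cball0[OF bounded_cball])
      have "\<Phi> u q \<in> cball 0 R" if "u \<in> I q" "0 \<le> u" for u
        using near[OF that(2,1)] R by (auto simp: dist_commute)
      hence Iq: "u \<in> I q" if "0 \<le> u" for u using forward_complete that by blast
      have "D (\<Phi> u q) < \<epsilon>" if "0 \<le> u" for u
      proof -
        have "D (\<Phi> u q) < \<epsilon>'" by (rule \<eta>1(2)[OF \<xi> Dq(2) that]) (use Iq near in auto)
        thus ?thesis using \<open>\<epsilon>' \<le> \<epsilon>\<close> by simp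
      qed
      moreover have "((\<lambda>t. \<Phi> t q) \<longlongrightarrow> \<xi>) at_top"
        by (rule forward_trapped[OF \<xi>]) (use Iq near in \<open>auto simp: dist_commute\<close>)
      hence "((\<lambda>t. D (\<Phi> t q)) \<longlongrightarrow> D \<xi>) at_top" by (rule tendsto_infdist)
      hence "((\<lambda>t. D (\<Phi> t q)) \<longlongrightarrow> 0) at_top" using E_subset \<xi> by auto
      ultimately show ?thesis using Iq by (auto simp: stays_def)
    next
      case True
      then obtain u where "0 \<le> u" "u \<in> I q" "r < dist (\<Phi> u q) \<xi>" by blast
      from departure[OF \<xi> q(1) Dq(1) q(2) this]
      obtain \<tau> e t \<kappa> where dep: "departs r1 T \<xi> q \<tau> e t \<kappa>" by blast
      hence ord: "0 \<le> \<tau>" "\<tau> \<le> e" "e \<le> t" "t \<le> \<tau> + T" and tI: "t \<in> I q"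
        and inner: "\<And>s. 0 \<le> s \<Longrightarrow> s \<le> \<tau> \<Longrightarrow> s \<in> I q \<and> dist (\<Phi> s q) \<xi> \<le> r"
        and box: "\<And>s. 0 \<le> s \<Longrightarrow> s < e \<Longrightarrow> \<Phi> s q \<in> B \<xi>" "\<Phi> e q \<notin> B \<xi>"
        and \<kappa>: "\<kappa> \<in> E" "allowed \<xi> \<kappa>" "\<Phi> e q \<notin> B \<kappa>" "dist (\<Phi> t q) \<kappa> \<le> r1"
        unfolding departs_def by blast+
      have Iq: "s \<in> I q" if "0 \<le> s" "s \<le> t" for s using I_between[OF zero_in_I tI] that by blast
      have D1: "D (\<Phi> s q) < \<epsilon>'" if "0 \<le> s" "s \<le> \<tau>" for s
        by (rule \<eta>1(2)[OF \<xi> Dq(2) that(1)]) (use inner that in auto)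
      have D2: "D (\<Phi> s q) < \<epsilon>" if "0 \<le> s" "s \<le> e" for s
      proof (cases "s \<le> \<tau>")
        case True
        thus ?thesis using D1[OF that(1)] \<open>\<epsilon>' \<le> \<epsilon>\<close> by simp
      next
        case False
        have D\<tau>: "D (\<Phi> \<tau> q) < \<epsilon>'" using D1[OF ord(1)] by simp
        have \<tau>I: "\<tau> \<in> I q" and sI: "s - \<tau> + \<tau> \<in> I q" using Iq ord that by auto
        have "D (\<Phi> (s - \<tau>) (\<Phi> \<tau> q)) \<le> L * D (\<Phi> \<tau> q)"
          using g(3)[of "\<Phi> \<tau> q" "s - \<tau>"] D\<tau> \<epsilon>'(2) ord that False by simp
        also have "\<dots> < L * \<epsilon>'" using D\<tau> g(2) by simp
        finally show ?thesis using \<epsilon>'(3) flow_add[OF \<tau>I sI] by simp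
      qed
      have eI: "e \<in> I q" and tI': "t - e + e \<in> I q" using Iq ord by auto
      have "state \<kappa> (\<Phi> e q)"
        unfolding state_def
      proof (intro conjI exI[of _ "t - e"])
        show "\<Phi> e q \<notin> Y" by (rule flow_notin_Y[OF q(1) eI])
        show "t - e \<in> I (\<Phi> e q)" using I_shift[OF eI] tI' by blast
        show "dist (\<Phi> (t - e) (\<Phi> e q)) \<kappa> \<le> r1" using flow_add[OF eI tI'] \<kappa>(4) by simp
      qed (use \<kappa> ord in auto)
      moreover have "0 \<le> e" using ord by simp
      moreover have "\<forall>t. 0 \<le> t \<and> t \<le> e \<longrightarrow> t \<in> I q \<and> D (\<Phi> t q) < \<epsilon>" using Iq D2 ord by auto
      ultimately show ?thesis unfolding exits_def using box \<kappa>(2) by blast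
    qed
  qed (use \<eta>0_pos \<eta>1 in auto)
qed

text \<open>The passage to which the estimate is applied begins at the last time \<open>s\<close> before the visit at which the
  trajectory is outside the box. The point \<open>p\<close> itself may be earlier, but at most by the time \<open>T\<close>, so
  the distances at \<open>p\<close> and at \<open>s\<close> differ at most by a constant factor \<open>L\<close>.\<close>

lemma transition:
  obtains h L where "0 < h" "1 \<le> L"
    "\<And>\<epsilon>. 0 < \<epsilon> \<Longrightarrow> \<exists>\<eta>>0. \<forall>\<xi> p. state \<xi> p \<and> D p < \<eta> \<longrightarrow> stays \<epsilon> p \<or> (\<exists>e \<kappa>. passes h L \<epsilon> \<xi> p e \<kappa>)"
proof -
  obtain \<eta>g L where g: "0 < \<eta>g" "1 \<le> L" "\<And>x t. D x < \<eta>g \<Longrightarrow> \<bar>t\<bar> \<le> T \<Longrightarrow> t \<in> I x \<and> D (\<Phi> t x) \<le> L * D x"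
    using growth[OF less_imp_le[OF T_pos]] by metis
  obtain h where h: "0 < h" "\<And>x t. D x < h \<Longrightarrow> 0 \<le> t \<Longrightarrow> t \<le> h \<Longrightarrow> dist (\<Phi> t x) x < r"
    using slow_motion by blast
  have "\<exists>\<eta>>0. \<forall>\<xi> p. state \<xi> p \<and> D p < \<eta> \<longrightarrow> stays \<epsilon> p \<or> (\<exists>e \<kappa>. passes h L \<epsilon> \<xi> p e \<kappa>)" if "0 < \<epsilon>" for \<epsilon>
  proof -
    \<comment> \<open>below \<open>\<delta>\<close> the passage estimate applies\<close>
    define \<epsilon>1 where "\<epsilon>1 = min \<epsilon> \<delta>"
    have \<epsilon>1: "0 < \<epsilon>1" "\<epsilon>1 \<le> \<epsilon>" "\<epsilon>1 \<le> \<delta>" using \<open>0 < \<epsilon>\<close> \<delta>_pos by (auto simp: \<epsilon>1_def)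
    obtain \<eta>1 where \<eta>1: "0 < \<eta>1"
      "\<And>\<xi> q. \<xi> \<in> E \<Longrightarrow> q \<notin> Y \<Longrightarrow> dist q \<xi> \<le> r1 \<Longrightarrow> D q < \<eta>1 \<Longrightarrow> stays \<epsilon>1 q \<or> (\<exists>e \<kappa>. exits \<epsilon>1 \<xi> q e \<kappa>)"
      by (rule settle_or_depart[OF \<epsilon>1(1)]) (rule that)
    define \<eta> where "\<eta> = min (min \<eta>1 \<epsilon>1 / L) (min \<eta>g h)"
    have "0 < \<eta>" using \<eta>1(1) \<epsilon>1(1) g h(1) by (simp add: \<eta>_def)
    moreover have "stays \<epsilon> p \<or> (\<exists>e \<kappa>. passes h L \<epsilon> \<xi> p e \<kappa>)"
      if st: "state \<xi> p" and Dp: "D p < \<eta>" for \<xi> p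
    proof -
      have \<xi>: "\<xi> \<in> E" and p: "p \<notin> Y" "p \<notin> B \<xi>" using st by (auto simp: state_def)
      obtain t0 where t0: "0 \<le> t0" "t0 \<le> T" "t0 \<in> I p" "dist (\<Phi> t0 p) \<xi> \<le> r1" using st by (auto simp: state_def)
      have "D p < min \<eta>1 \<epsilon>1 / L" using Dp by (simp add: \<eta>_def)
      hence "L * D p < min \<eta>1 \<epsilon>1" using g(2) by (simp add: pos_less_divide_eq mult.commute)
      hence small: "D p < \<eta>g" "D p < h" "L * D p < \<eta>1" "L * D p < \<epsilon>1"
        using Dp by (auto simp: \<eta>_def)
      have before: "t \<in> I p \<and> D (\<Phi> t p) \<le> L * D p" if "0 \<le> t" "t \<le> t0" for t
        using g(3)[OF small(1), of t] that t0 by simp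
      define q where "q = \<Phi> t0 p"
      have q: "q \<notin> Y" "dist q \<xi> \<le> r1" "D q < \<eta>1"
        using flow_notin_Y[OF p(1) t0(3)] t0(4) before[OF t0(1)] small(3) by (auto simp: q_def)
      have before': "t \<in> I p \<and> D (\<Phi> t p) < \<epsilon>1" if "0 \<le> t" "t \<le> t0" for t
        using before[OF that] small(4) by simp
      from \<eta>1(2)[OF \<xi> q] show ?thesis
      proof
        assume "stays \<epsilon>1 q"
        hence "stays \<epsilon>1 p" unfolding q_def using stays_shift[OF t0(1,3) before'] by blast
        thus ?thesis using \<epsilon>1(2) unfolding stays_def by force
      next
        assume "\<exists>e \<kappa>. exits \<epsilon>1 \<xi> q e \<kappa>"
        then obtain e \<kappa> where e: "0 \<le> e" "\<And>t. 0 \<le> t \<Longrightarrow> t \<le> e \<Longrightarrow> t \<in> I q \<and> D (\<Phi> t q) < \<epsilon>1"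
          "\<And>t. 0 \<le> t \<Longrightarrow> t < e \<Longrightarrow> \<Phi> t q \<in> B \<xi>" "\<Phi> e q \<notin> B \<xi>" and \<kappa>: "allowed \<xi> \<kappa>" "state \<kappa> (\<Phi> e q)"
          unfolding exits_def by blast
        define e' where "e' = e + t0"
        have after: "t \<in> I p" "\<Phi> t p = \<Phi> (t - t0) q" if "t0 \<le> t" "t \<le> e'" for t
        proof -
          have "t - t0 \<in> I (\<Phi> t0 p)" using e(2)[of "t - t0"] that by (simp add: e'_def q_def)
          hence *: "t - t0 + t0 \<in> I p" using I_shift[OF t0(3)] by blast
          thus "t \<in> I p" by simp
          show "\<Phi> t p = \<Phi> (t - t0) q" using flow_add[OF t0(3) *] by (simp add: q_def)
        qed
        have whole: "t \<in> I p \<and> D (\<Phi> t p) < \<epsilon>1" if "0 \<le> t" "t \<le> e'" for t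
        proof (cases "t \<le> t0")
          case False
          thus ?thesis using after[of t] e(2)[of "t - t0"] that by (simp add: e'_def)
        qed (use before' that in blast)
        have end_eq: "\<Phi> e' p = \<Phi> e q" using after(2)[of e'] e(1) by (simp add: e'_def)
        have "h \<le> t0"
        proof (rule ccontr)
          assume "\<not> h \<le> t0"
          hence "dist (\<Phi> t0 p) p < r" using h(2)[OF small(2) t0(1)] by simp
          hence "dist p \<xi> < 2 * r" using dist_triangle[of p \<xi> "\<Phi> t0 p"] t0(4) r1(2) by (simp add: dist_commute)
          hence "p \<in> cball \<xi> (2 * r)" by (simp add: dist_commute)
          thus False using ball_subset[OF \<xi>] p(2) by blast
        qed
        have cl: "closed (- B \<xi>)" using open_B[OF \<xi>] by (simp add: closed_def)
        have sub: "{0..t0} \<subseteq> I p" using before by auto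
        have start: "\<Phi> 0 p \<in> - B \<xi>" using p(2) by simp
        obtain s where s: "0 \<le> s" "s \<le> t0" "\<Phi> s p \<notin> B \<xi>" "\<And>w. s < w \<Longrightarrow> w \<le> t0 \<Longrightarrow> \<Phi> w p \<in> B \<xi>"
          using last_hitting_time[OF t0(1) continuous_on_flow[OF sub] cl start] by auto
        have "\<Phi> t0 p \<in> B \<xi>" using ball_small[OF \<xi>] t0(4) r1(2) by simp
        hence "s < t0" using s by (cases "s = t0") auto
        have pass: "passage I \<Phi> (B \<xi>) p s e'"
          unfolding passage_def
        proof (intro conjI ballI)
          show "\<Phi> e' p \<notin> B \<xi>" using end_eq e(4) by simp
          show "{s..e'} \<subseteq> I p" using whole s(1) by auto
          fix w assume w: "w \<in> {s<..<e'}"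
          show "\<Phi> w p \<in> B \<xi>"
          proof (cases "w \<le> t0")
            case False
            thus ?thesis using after(2)[of w] e(3)[of "w - t0"] w by (simp add: e'_def)
          qed (use s(4) w in auto)
        qed (use s \<open>s < t0\<close> e(1) in \<open>auto simp: e'_def\<close>)
        have "D (\<Phi> e' p) \<le> A * D (\<Phi> s p) powr \<rho> \<xi>"
        proof (rule estimate[OF \<xi> p(1) pass])
          show "D (\<Phi> w p) < \<delta>" if "s \<le> w" "w \<le> e'" for w using whole[of w] that s(1) \<epsilon>1(3) by simp
        qed
        also have "\<dots> \<le> A * (L * D p) powr \<rho> \<xi>"
          using before[OF s(1,2)] A_pos \<rho>_pos[OF \<xi>] by (intro mult_left_mono powr_mono2) (auto simp: infdist_nonneg)
        finally have est: "D (\<Phi> e' p) \<le> A * (L * D p) powr \<rho> \<xi>" .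
        have "h \<le> e'" using \<open>h \<le> t0\<close> e(1) by (simp add: e'_def)
        moreover have "\<forall>t. 0 \<le> t \<and> t \<le> e' \<longrightarrow> t \<in> I p \<and> D (\<Phi> t p) < \<epsilon>" using whole \<epsilon>1(2) by force
        moreover have "state \<kappa> (\<Phi> e' p)" using \<kappa>(2) end_eq by simp
        ultimately show ?thesis unfolding passes_def using \<kappa>(1) est by blast
      qed
    qed
    ultimately show ?thesis by blast
  qed
  thus thesis by (rule that[OF h(1) g(2)])
qed

text \<open>The logarithmic distance to \<open>Y\<close>, weighted such that it expands at each transition.\<close>

definition "level \<xi> p = \<theta> \<xi> * (- ln (D p))"

definition "climbs h \<epsilon> \<xi> p e \<kappa> \<longleftrightarrow> h \<le> e \<and> (\<forall>t. 0 \<le> t \<and> t \<le> e \<longrightarrow> t \<in> I p \<and> D (\<Phi> t p) < \<epsilon>) \<and>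
    state \<kappa> (\<Phi> e p) \<and> level \<xi> p + 1 \<le> level \<kappa> (\<Phi> e p)"

text \<open>Take logarithms in the estimate, multiply by \<open>- \<theta> \<kappa>\<close> and use that the step from \<open>\<xi>\<close> to \<open>\<kappa>\<close> is
  allowed. The sums over \<open>E\<close> are crude bounds that do not depend on \<open>\<xi>\<close> and \<open>\<kappa>\<close>.\<close>

lemma level_gain:
  assumes E: "\<xi> \<in> E" "\<kappa> \<in> E" and p: "p \<notin> Y" "D p \<le> 1" "p' \<notin> Y" and al: "allowed \<xi> \<kappa>" and L: "1 \<le> L"
    and est: "D p' \<le> A * (L * D p) powr \<rho> \<xi>"
  shows "\<Lambda> * level \<xi> p - (\<Sum>\<kappa>\<in>E. \<theta> \<kappa>) * (\<bar>ln A\<bar> + (\<Sum>\<xi>\<in>E. \<rho> \<xi>) * ln L) \<le> level \<kappa> p'"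
proof -
  have pos: "0 < D p" "0 < D p'" "0 < L" using D_pos p L by auto
  have "ln (D p') \<le> ln (A * (L * D p) powr \<rho> \<xi>)" using est pos by (subst ln_le_cancel_iff) auto
  also have "\<dots> = ln A + \<rho> \<xi> * (ln L + ln (D p))" using A_pos pos by (simp add: ln_mult ln_powr)
  finally have "\<rho> \<xi> * (- ln (D p)) - (ln A + \<rho> \<xi> * ln L) \<le> - ln (D p')" by (simp add: algebra_simps)
  hence "\<theta> \<kappa> * (\<rho> \<xi> * (- ln (D p)) - (ln A + \<rho> \<xi> * ln L)) \<le> level \<kappa> p'"
    unfolding level_def using \<theta>_pos[OF E(2)] by (intro mult_left_mono) auto
  moreover have "\<theta> \<kappa> * (ln A + \<rho> \<xi> * ln L) \<le> (\<Sum>\<kappa>\<in>E. \<theta> \<kappa>) * (\<bar>ln A\<bar> + (\<Sum>\<xi>\<in>E. \<rho> \<xi>) * ln L)"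
  proof -
    have \<theta>: "\<theta> \<kappa> \<le> (\<Sum>\<kappa>\<in>E. \<theta> \<kappa>)" using E(2) finite_E \<theta>_pos by (intro member_le_sum) (auto intro: less_imp_le)
    have \<rho>: "\<rho> \<xi> \<le> (\<Sum>\<xi>\<in>E. \<rho> \<xi>)" using E(1) finite_E \<rho>_pos by (intro member_le_sum) (auto intro: less_imp_le)
    have "0 \<le> ln L" using L by simp
    have "ln A + \<rho> \<xi> * ln L \<le> \<bar>ln A\<bar> + (\<Sum>\<xi>\<in>E. \<rho> \<xi>) * ln L"
      using mult_right_mono[OF \<rho> \<open>0 \<le> ln L\<close>] by linarith
    hence "\<theta> \<kappa> * (ln A + \<rho> \<xi> * ln L) \<le> \<theta> \<kappa> * (\<bar>ln A\<bar> + (\<Sum>\<xi>\<in>E. \<rho> \<xi>) * ln L)"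
      using \<theta>_pos[OF E(2)] by simp
    also have "\<dots> \<le> (\<Sum>\<kappa>\<in>E. \<theta> \<kappa>) * (\<bar>ln A\<bar> + (\<Sum>\<xi>\<in>E. \<rho> \<xi>) * ln L)"
    proof (intro mult_right_mono \<theta>)
      have "0 \<le> (\<Sum>\<xi>\<in>E. \<rho> \<xi>)" by (intro sum_nonneg less_imp_le \<rho>_pos)
      thus "0 \<le> \<bar>ln A\<bar> + (\<Sum>\<xi>\<in>E. \<rho> \<xi>) * ln L" using \<open>0 \<le> ln L\<close> by simp
    qed
    finally show ?thesis .
  qed
  moreover have "\<Lambda> * level \<xi> p \<le> \<theta> \<kappa> * (\<rho> \<xi> * (- ln (D p)))"
  proof -
    have "0 \<le> - ln (D p)" using pos p(2) by simp
    from mult_right_mono[OF al[unfolded allowed_def] this] show ?thesis by (simp add: level_def mult_ac)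
  qed
  ultimately show ?thesis by (simp add: right_diff_distrib)
qed

lemma high_level_near_Y:
  assumes "0 < \<eta>"
  obtains M where "\<And>\<xi> p. \<xi> \<in> E \<Longrightarrow> p \<notin> Y \<Longrightarrow> M < level \<xi> p \<Longrightarrow> D p < \<eta>"
proof (rule that[of "(\<Sum>\<xi>\<in>E. \<theta> \<xi>) * \<bar>ln \<eta>\<bar>"])
  fix \<xi> p assume \<xi>: "\<xi> \<in> E" and p: "p \<notin> Y" and lev: "(\<Sum>\<xi>\<in>E. \<theta> \<xi>) * \<bar>ln \<eta>\<bar> < level \<xi> p"
  have "\<theta> \<xi> \<le> (\<Sum>\<xi>\<in>E. \<theta> \<xi>)" using \<xi> finite_E \<theta>_pos by (intro member_le_sum) (auto intro: less_imp_le)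
  hence "\<theta> \<xi> * \<bar>ln \<eta>\<bar> \<le> (\<Sum>\<xi>\<in>E. \<theta> \<xi>) * \<bar>ln \<eta>\<bar>" by (intro mult_right_mono) auto
  hence "\<theta> \<xi> * \<bar>ln \<eta>\<bar> < \<theta> \<xi> * (- ln (D p))" using lev by (simp add: level_def)
  hence "\<bar>ln \<eta>\<bar> < - ln (D p)" using \<theta>_pos[OF \<xi>] by (simp only: mult_less_cancel_left_pos)
  hence "ln (D p) < ln \<eta>" by linarith
  thus "D p < \<eta>" using D_pos[OF p] assms by simp
qed

lemma near_Y_high_level:
  obtains \<eta> where "0 < \<eta>" "\<And>\<xi> p. \<xi> \<in> E \<Longrightarrow> p \<notin> Y \<Longrightarrow> D p < \<eta> \<Longrightarrow> M < level \<xi> p"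
proof -
  have "\<exists>\<eta>>0. \<forall>\<xi>\<in>E. \<forall>p. p \<notin> Y \<and> D p < \<eta> \<longrightarrow> M < level \<xi> p"
  proof (rule finite_uniform[OF finite_E])
    fix \<xi> assume \<xi>: "\<xi> \<in> E"
    have "M < level \<xi> p" if p: "p \<notin> Y" "D p < exp (- M / \<theta> \<xi>)" for p
    proof -
      have "ln (D p) < - M / \<theta> \<xi>" using ln_less_cancel_iff[THEN iffD2, OF D_pos[OF p(1)] _ p(2)] by simp
      thus ?thesis using \<theta>_pos[OF \<xi>] by (simp add: level_def field_simps)
    qed
    thus "\<exists>\<eta>>0. \<forall>p. p \<notin> Y \<and> D p < \<eta> \<longrightarrow> M < level \<xi> p" by (intro exI[of _ "exp (- M / \<theta> \<xi>)"]) auto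
  qed auto
  thus thesis using that by blast
qed

text \<open>From the threshold \<open>(b + 1) / (\<Lambda> - 1)\<close> on, expansion by the factor \<open>\<Lambda>\<close> outweighs the loss \<open>b\<close> by at
  least 1.\<close>

lemma level_transition:
  obtains h where "0 < h"
    "\<And>\<epsilon>. 0 < \<epsilon> \<Longrightarrow> \<exists>M. \<forall>\<xi> p. state \<xi> p \<and> M < level \<xi> p \<longrightarrow> stays \<epsilon> p \<or> (\<exists>e \<kappa>. climbs h \<epsilon> \<xi> p e \<kappa>)"
proof -
  obtain h L where h: "0 < h" and L: "1 \<le> L"
    and tr: "\<And>\<epsilon>. 0 < \<epsilon> \<Longrightarrow> \<exists>\<eta>>0. \<forall>\<xi> p. state \<xi> p \<and> D p < \<eta> \<longrightarrow> stays \<epsilon> p \<or> (\<exists>e \<kappa>. passes h L \<epsilon> \<xi> p e \<kappa>)"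
    by (rule transition) (rule that)
  define b where "b = (\<Sum>\<kappa>\<in>E. \<theta> \<kappa>) * (\<bar>ln A\<bar> + (\<Sum>\<xi>\<in>E. \<rho> \<xi>) * ln L)"
  show thesis
  proof (rule that[OF h])
    fix \<epsilon> :: real assume "0 < \<epsilon>"
    from tr[OF this] obtain \<eta> where \<eta>: "0 < \<eta>"
      "\<And>\<xi> p. state \<xi> p \<Longrightarrow> D p < \<eta> \<Longrightarrow> stays \<epsilon> p \<or> (\<exists>e \<kappa>. passes h L \<epsilon> \<xi> p e \<kappa>)" by blast
    have "0 < min \<eta> 1" using \<eta>(1) by simp
    then obtain M where M: "\<And>\<xi> p. \<xi> \<in> E \<Longrightarrow> p \<notin> Y \<Longrightarrow> M < level \<xi> p \<Longrightarrow> D p < min \<eta> 1"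
      by (rule high_level_near_Y) (rule that)
    define M' where "M' = max M ((b + 1) / (\<Lambda> - 1))"
    show "\<exists>M. \<forall>\<xi> p. state \<xi> p \<and> M < level \<xi> p \<longrightarrow> stays \<epsilon> p \<or> (\<exists>e \<kappa>. climbs h \<epsilon> \<xi> p e \<kappa>)"
    proof (intro exI[of _ M'] allI impI)
      fix \<xi> p assume *: "state \<xi> p \<and> M' < level \<xi> p"
      hence \<xi>: "\<xi> \<in> E" and p: "p \<notin> Y" by (auto simp: state_def)
      have "D p < min \<eta> 1" using M[OF \<xi> p] * by (simp add: M'_def)
      hence Dp: "D p < \<eta>" "D p \<le> 1" by auto
      from \<eta>(2)[OF conjunct1[OF *] Dp(1)]
      show "stays \<epsilon> p \<or> (\<exists>e \<kappa>. climbs h \<epsilon> \<xi> p e \<kappa>)"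
      proof
        assume "\<exists>e \<kappa>. passes h L \<epsilon> \<xi> p e \<kappa>"
        then obtain e \<kappa> where e: "h \<le> e" "\<forall>t. 0 \<le> t \<and> t \<le> e \<longrightarrow> t \<in> I p \<and> D (\<Phi> t p) < \<epsilon>"
          "allowed \<xi> \<kappa>" "state \<kappa> (\<Phi> e p)" "D (\<Phi> e p) \<le> A * (L * D p) powr \<rho> \<xi>" unfolding passes_def by blast
        have \<kappa>: "\<kappa> \<in> E" "\<Phi> e p \<notin> Y" using e(4) by (auto simp: state_def)
        have "\<Lambda> * level \<xi> p - b \<le> level \<kappa> (\<Phi> e p)"
          unfolding b_def by (rule level_gain[OF \<xi> \<kappa>(1) p Dp(2) \<kappa>(2) e(3) L e(5)])
        moreover have "(b + 1) / (\<Lambda> - 1) < level \<xi> p" using * by (simp add: M'_def)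
        hence "b + 1 < level \<xi> p * (\<Lambda> - 1)" using \<Lambda> by (simp add: pos_divide_less_eq)
        ultimately have "level \<xi> p + 1 \<le> level \<kappa> (\<Phi> e p)" by (simp add: algebra_simps)
        thus ?thesis unfolding climbs_def using e by blast
      qed blast
    qed
  qed
qed

text \<open>Induction on the number of visits. Each visit raises the level, so the bound on the
  distance during a visit remains applicable, and each takes at least the time \<open>h\<close>.\<close>

lemma state_remains_near:
  assumes "0 < \<epsilon>"
  obtains M where "\<And>\<xi> p t. state \<xi> p \<Longrightarrow> M < level \<xi> p \<Longrightarrow> 0 \<le> t \<Longrightarrow> t \<in> I p \<and> D (\<Phi> t p) < \<epsilon>"
proof -
  obtain h where h: "0 < h"
    and tr: "\<And>\<epsilon>. 0 < \<epsilon> \<Longrightarrow> \<exists>M. \<forall>\<xi> p. state \<xi> p \<and> M < level \<xi> p \<longrightarrow> stays \<epsilon> p \<or> (\<exists>e \<kappa>. climbs h \<epsilon> \<xi> p e \<kappa>)"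
    by (rule level_transition) (rule that)
  from tr[OF assms] obtain M where M: "\<And>\<xi> p. state \<xi> p \<Longrightarrow> M < level \<xi> p \<Longrightarrow> stays \<epsilon> p \<or> (\<exists>e \<kappa>. climbs h \<epsilon> \<xi> p e \<kappa>)" by blast
  have main: "t \<in> I p \<and> D (\<Phi> t p) < \<epsilon>"
    if "state \<xi> p" "M < level \<xi> p" "0 \<le> t" "t \<le> real n * h" for n \<xi> p t
    using that
  proof (induction n arbitrary: \<xi> p t)
    case 0
    hence t: "t = 0" by simp
    from M[OF 0(1,2)] h show ?case unfolding t stays_def climbs_def by fastforce
  next
    case (Suc n)
    from M[OF Suc.prems(1,2)] show ?case
    proof
      assume "stays \<epsilon> p"
      thus ?thesis using Suc.prems by (simp add: stays_def)
    next
      assume "\<exists>e \<kappa>. climbs h \<epsilon> \<xi> p e \<kappa>"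
      then obtain e \<kappa> where e: "h \<le> e" "\<forall>t. 0 \<le> t \<and> t \<le> e \<longrightarrow> t \<in> I p \<and> D (\<Phi> t p) < \<epsilon>"
        "state \<kappa> (\<Phi> e p)" "level \<xi> p + 1 \<le> level \<kappa> (\<Phi> e p)" unfolding climbs_def by blast
      show ?thesis
      proof (cases "t \<le> e")
        case True
        thus ?thesis using e(2) Suc.prems(3) by blast
      next
        case False
        have eI: "e \<in> I p" using e(1,2) h by simp
        have "t \<le> h + real n * h" using Suc.prems(4) by (simp add: algebra_simps)
        hence "t - e \<in> I (\<Phi> e p) \<and> D (\<Phi> (t - e) (\<Phi> e p)) < \<epsilon>"
          using Suc.IH[OF e(3), of "t - e"] e(1,4) Suc.prems(2) False by simp
        moreover from this have "t - e + e \<in> I p" using I_shift[OF eI] by blast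
        ultimately show ?thesis using flow_add[OF eI, of "t - e"] by simp
      qed
    qed
  qed
  show thesis
  proof (rule that[of M])
    fix \<xi> p t assume *: "state \<xi> p" "M < level \<xi> p" "0 \<le> (t::real)"
    obtain n where "t / h \<le> real n" using real_arch_simple by blast
    hence "t \<le> real n * h" using h by (simp add: pos_divide_le_eq)
    thus "t \<in> I p \<and> D (\<Phi> t p) < \<epsilon>" by (rule main[OF *])
  qed
qed

text \<open>Unless the trajectory settles at an equilibrium, its level exceeds every bound after finitely many visits,
  and from then on \<open>state_remains_near\<close> keeps it arbitrarily close to \<open>Y\<close>.\<close>

lemma state_attracted:
  obtains M where "\<And>\<xi> p. state \<xi> p \<Longrightarrow> M < level \<xi> p \<Longrightarrow> ((\<lambda>t. D (\<Phi> t p)) \<longlongrightarrow> 0) at_top"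
proof -
  obtain h where h: "0 < h"
    and tr: "\<And>\<epsilon>. 0 < \<epsilon> \<Longrightarrow> \<exists>M. \<forall>\<xi> p. state \<xi> p \<and> M < level \<xi> p \<longrightarrow> stays \<epsilon> p \<or> (\<exists>e \<kappa>. climbs h \<epsilon> \<xi> p e \<kappa>)"
    by (rule level_transition) (rule that)
  from tr[OF zero_less_one] obtain M where M: "\<And>\<xi> p. state \<xi> p \<Longrightarrow> M < level \<xi> p \<Longrightarrow> stays 1 p \<or> (\<exists>e \<kappa>. climbs h 1 \<xi> p e \<kappa>)" by blast
  obtain M1 where M1: "\<And>\<xi> p t. state \<xi> p \<Longrightarrow> M1 < level \<xi> p \<Longrightarrow> 0 \<le> t \<Longrightarrow> t \<in> I p \<and> D (\<Phi> t p) < 1"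
    by (rule state_remains_near[OF zero_less_one]) (rule that)
  have reach: "((\<lambda>t. D (\<Phi> t p)) \<longlongrightarrow> 0) at_top \<or>
      (\<exists>s \<kappa>. s \<in> I p \<and> state \<kappa> (\<Phi> s p) \<and> N < level \<kappa> (\<Phi> s p))"
    if "state \<xi> p" "max M M1 < level \<xi> p" "N < level \<xi> p + real n" for N n \<xi> p
    using that
  proof (induction n arbitrary: \<xi> p)
    case 0
    thus ?case by (intro disjI2 exI[of _ 0] exI[of _ \<xi>]) simp
  next
    case (Suc n)
    have lev: "M < level \<xi> p" "M1 < level \<xi> p" using Suc.prems(2) by auto
    from M[OF Suc.prems(1) lev(1)] show ?case
    proof
      assume "stays 1 p"
      thus ?thesis by (simp add: stays_def)
    next
      assume "\<exists>e \<kappa>. climbs h 1 \<xi> p e \<kappa>"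
      then obtain e \<kappa> where e: "h \<le> e" "\<forall>t. 0 \<le> t \<and> t \<le> e \<longrightarrow> t \<in> I p \<and> D (\<Phi> t p) < 1"
        "state \<kappa> (\<Phi> e p)" "level \<xi> p + 1 \<le> level \<kappa> (\<Phi> e p)" unfolding climbs_def by blast
      have eI: "e \<in> I p" using e(1,2) h by simp
      have "((\<lambda>t. D (\<Phi> t (\<Phi> e p))) \<longlongrightarrow> 0) at_top \<or>
        (\<exists>s \<kappa>'. s \<in> I (\<Phi> e p) \<and> state \<kappa>' (\<Phi> s (\<Phi> e p)) \<and> N < level \<kappa>' (\<Phi> s (\<Phi> e p)))"
        by (rule Suc.IH[OF e(3)]) (use e(4) Suc.prems in auto)
      thus ?thesis
      proof
        assume "((\<lambda>t. D (\<Phi> t (\<Phi> e p))) \<longlongrightarrow> 0) at_top"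
        moreover have "t \<in> I (\<Phi> e p)" if "0 \<le> t" for t using M1[OF e(3) _ that] e(4) lev(2) by simp
        ultimately show ?thesis using attracted_shift[OF eI] by blast
      next
        assume "\<exists>s \<kappa>'. s \<in> I (\<Phi> e p) \<and> state \<kappa>' (\<Phi> s (\<Phi> e p)) \<and> N < level \<kappa>' (\<Phi> s (\<Phi> e p))"
        then obtain s \<kappa>' where s: "s \<in> I (\<Phi> e p)" "state \<kappa>' (\<Phi> s (\<Phi> e p))" "N < level \<kappa>' (\<Phi> s (\<Phi> e p))" by blast
        have sI: "s + e \<in> I p" using I_shift[OF eI] s(1) by blast
        thus ?thesis using s(2,3) flow_add[OF eI sI] by auto
      qed
    qed
  qed
  show thesis
  proof (rule that[of "max M M1"])
    fix \<xi> p assume p: "state \<xi> p" "max M M1 < level \<xi> p"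
    show "((\<lambda>t. D (\<Phi> t p)) \<longlongrightarrow> 0) at_top"
    proof (rule tendstoI)
      fix \<epsilon> :: real assume "0 < \<epsilon>"
      then obtain M2 where M2: "\<And>\<xi> p t. state \<xi> p \<Longrightarrow> M2 < level \<xi> p \<Longrightarrow> 0 \<le> t \<Longrightarrow> t \<in> I p \<and> D (\<Phi> t p) < \<epsilon>"
        by (rule state_remains_near) (rule that)
      obtain n where "M2 - level \<xi> p < real n" using reals_Archimedean2 by blast
      hence "M2 < level \<xi> p + real n" by simp
      from reach[OF p this] show "\<forall>\<^sub>F t in at_top. dist (D (\<Phi> t p)) 0 < \<epsilon>"
      proof
        assume "((\<lambda>t. D (\<Phi> t p)) \<longlongrightarrow> 0) at_top"
        thus ?thesis using \<open>0 < \<epsilon>\<close> by (rule tendstoD)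
      next
        assume "\<exists>s \<kappa>. s \<in> I p \<and> state \<kappa> (\<Phi> s p) \<and> M2 < level \<kappa> (\<Phi> s p)"
        then obtain s \<kappa> where s: "s \<in> I p" "state \<kappa> (\<Phi> s p)" "M2 < level \<kappa> (\<Phi> s p)" by blast
        show ?thesis
          using eventually_ge_at_top[of s]
        proof eventually_elim
          case (elim t)
          hence *: "t - s \<in> I (\<Phi> s p)" "D (\<Phi> (t - s) (\<Phi> s p)) < \<epsilon>" using M2[OF s(2,3), of "t - s"] by auto
          hence "t - s + s \<in> I p" using I_shift[OF s(1)] by blast
          thus ?case using flow_add[OF s(1), of "t - s"] *(2) by (simp add: infdist_nonneg)
        qed
      qed
    qed
  qed
qed

text \<open>A trajectory that starts near \<open>Y\<close> need not be a state: it may start inside a box, and then the estimate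
  says nothing about its first exit. But \<open>settle_or_depart\<close> bounds the distance at this exit by any
  prescribed amount, and the exit point is a state of high level.\<close>

theorem attracting_neighbourhood:
  assumes "0 < \<epsilon>"
  obtains \<eta> where "0 < \<eta>" "\<And>x. D x < \<eta> \<Longrightarrow> stays \<epsilon> x"
proof -
  obtain M1 where M1: "\<And>\<xi> p t. state \<xi> p \<Longrightarrow> M1 < level \<xi> p \<Longrightarrow> 0 \<le> t \<Longrightarrow> t \<in> I p \<and> D (\<Phi> t p) < \<epsilon>"
    by (rule state_remains_near[OF assms]) (rule that)
  obtain M2 where M2: "\<And>\<xi> p. state \<xi> p \<Longrightarrow> M2 < level \<xi> p \<Longrightarrow> ((\<lambda>t. D (\<Phi> t p)) \<longlongrightarrow> 0) at_top"
    by (rule state_attracted) (rule that)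
  have stays_state: "stays \<epsilon> p" if "state \<xi> p" "max M1 M2 < level \<xi> p" for \<xi> p
    unfolding stays_def using M1[OF that(1)] M2[OF that(1)] that(2) by simp
  obtain \<eta>1 where \<eta>1: "0 < \<eta>1" "\<And>\<xi> p. \<xi> \<in> E \<Longrightarrow> p \<notin> Y \<Longrightarrow> D p < \<eta>1 \<Longrightarrow> max M1 M2 < level \<xi> p"
    by (rule near_Y_high_level) (rule that)
  define \<epsilon>1 where "\<epsilon>1 = min \<epsilon> \<eta>1"
  have \<epsilon>1: "0 < \<epsilon>1" "\<epsilon>1 \<le> \<epsilon>" "\<epsilon>1 \<le> \<eta>1" using assms \<eta>1(1) by (auto simp: \<epsilon>1_def)
  obtain \<eta>2 where \<eta>2: "0 < \<eta>2"
    "\<And>\<xi> q. \<xi> \<in> E \<Longrightarrow> q \<notin> Y \<Longrightarrow> dist q \<xi> \<le> r1 \<Longrightarrow> D q < \<eta>2 \<Longrightarrow> stays \<epsilon>1 q \<or> (\<exists>e \<kappa>. exits \<epsilon>1 \<xi> q e \<kappa>)"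
    by (rule settle_or_depart[OF \<epsilon>1(1)]) (rule that)
  obtain \<eta>g L where g: "0 < \<eta>g" "1 \<le> L" "\<And>x t. D x < \<eta>g \<Longrightarrow> \<bar>t\<bar> \<le> T \<Longrightarrow> t \<in> I x \<and> D (\<Phi> t x) \<le> L * D x"
    using growth[OF less_imp_le[OF T_pos]] by metis
  define \<eta> where "\<eta> = min (min \<eta>2 \<epsilon>1 / L) (min \<eta>g \<eta>0)"
  show thesis
  proof (rule that[of \<eta>])
    show "0 < \<eta>" using \<eta>2(1) \<epsilon>1(1) g \<eta>0_pos by (simp add: \<eta>_def)
    fix x assume Dx: "D x < \<eta>"
    show "stays \<epsilon> x"
    proof (cases "x \<in> Y")
      case True
      have "D (\<Phi> t x) = 0" for t by (rule D_zero[OF flow_Y[OF True]])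
      thus ?thesis using I_Y[OF True] assms by (simp add: stays_def)
    next
      case False
      have "D x < min \<eta>2 \<epsilon>1 / L" using Dx by (simp add: \<eta>_def)
      hence "L * D x < min \<eta>2 \<epsilon>1" using g(2) by (simp add: pos_less_divide_eq mult.commute)
      hence small: "D x < \<eta>g" "D x < \<eta>0" "L * D x < \<eta>2" "L * D x < \<epsilon>1"
        using Dx by (auto simp: \<eta>_def)
      obtain t0 \<xi> where t0: "0 \<le> t0" "t0 \<le> T" "t0 \<in> I x" and \<xi>: "\<xi> \<in> E" "dist (\<Phi> t0 x) \<xi> \<le> r1"
        using arrival[OF small(2)] by blast
      have before: "t \<in> I x \<and> D (\<Phi> t x) \<le> L * D x" if "0 \<le> t" "t \<le> t0" for t
        using g(3)[OF small(1), of t] that t0 by simp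
      have before': "t \<in> I x \<and> D (\<Phi> t x) < \<epsilon>" if "0 \<le> t" "t \<le> t0" for t
        using before[OF that] small(4) \<epsilon>1(2) by simp
      have "stays \<epsilon> (\<Phi> t0 x)"
      proof -
        have "D (\<Phi> t0 x) < \<eta>2" using before[OF t0(1)] small(3) by simp
        from \<eta>2(2)[OF \<xi>(1) flow_notin_Y[OF False t0(3)] \<xi>(2) this] show ?thesis
        proof
          assume "stays \<epsilon>1 (\<Phi> t0 x)"
          thus ?thesis using \<epsilon>1(2) unfolding stays_def by force
        next
          assume "\<exists>e \<kappa>. exits \<epsilon>1 \<xi> (\<Phi> t0 x) e \<kappa>"
          then obtain e \<kappa> where e: "0 \<le> e" "\<forall>t. 0 \<le> t \<and> t \<le> e \<longrightarrow> t \<in> I (\<Phi> t0 x) \<and> D (\<Phi> t (\<Phi> t0 x)) < \<epsilon>1"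
            "state \<kappa> (\<Phi> e (\<Phi> t0 x))" unfolding exits_def by blast
          have "\<kappa> \<in> E" "\<Phi> e (\<Phi> t0 x) \<notin> Y" using e(3) by (auto simp: state_def)
          moreover have eI: "e \<in> I (\<Phi> t0 x)" and "D (\<Phi> e (\<Phi> t0 x)) < \<eta>1" using e(1,2) \<epsilon>1(3) by force+
          ultimately have "stays \<epsilon> (\<Phi> e (\<Phi> t0 x))" using stays_state[OF e(3)] \<eta>1(2) by blast
          thus ?thesis by (rule stays_shift[OF e(1) eI, rotated]) (use e(2) \<epsilon>1(2) in force)
        qed
      qed
      thus ?thesis using stays_shift[OF t0(1,3) before'] by blast
    qed
  qed
qed

end

section \<open>Asymptotic stability of clean robust networks\<close>

lemma max_dist_le_infdist:
  assumes "compact Y" "Y \<noteq> {}" shows "max_dist x Y \<le> infdist x Y"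
proof -
  obtain y where y: "y \<in> Y" "infdist x Y = dist x y"
    using infdist_attains_inf[OF compact_imp_closed[OF assms(1)] assms(2)] by blast
  have "max_dist x Y \<le> infnorm (x - y)"
    unfolding max_dist_def by (rule cINF_lower[OF _ y(1)]) (auto intro!: bdd_belowI[of _ 0] infnorm_pos_le)
  also have "\<dots> \<le> dist x y" by (simp add: dist_norm infnorm_le_norm)
  finally show ?thesis using y(2) by simp
qed

lemma max_dist_nonneg: "Y \<noteq> {} \<Longrightarrow> 0 \<le> max_dist x Y"
  unfolding max_dist_def by (rule cINF_greatest) (auto intro: infnorm_pos_le)

lemma infdist_le_max_dist:
  fixes Y :: "'a::euclidean_space set"
  assumes "Y \<noteq> {}" shows "infdist x Y \<le> sqrt DIM('a) * max_dist x Y"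
proof -
  have "infdist x Y / sqrt DIM('a) \<le> max_dist x Y"
    unfolding max_dist_def
  proof (rule cINF_greatest[OF assms])
    fix y assume "y \<in> Y"
    have "infdist x Y \<le> dist x y" by (rule infdist_le[OF \<open>y \<in> Y\<close>])
    also have "\<dots> \<le> sqrt DIM('a) * infnorm (x - y)" by (simp add: dist_norm norm_le_infnorm)
    finally show "infdist x Y / sqrt DIM('a) \<le> infnorm (x - y)"
      by (simp add: pos_divide_le_eq mult.commute)
  qed
  thus ?thesis by (simp add: pos_divide_le_eq mult.commute)
qed

lemma (in local_flow) limits_equilibrium:
  assumes "f \<xi> = 0" shows "alpha_limit I \<Phi> \<xi> = {\<xi>}" "omega_limit I \<Phi> \<xi> = {\<xi>}"
proof -
  show "omega_limit I \<Phi> \<xi> = {\<xi>}"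
    by (rule omega_limit_unique) (use equilibrium[OF assms] in auto)
  interpret rev: local_flow "\<lambda>x. - f x" "\<lambda>x. uminus ` I x" "\<lambda>t. \<Phi> (- t)" by (rule reverse_flow)
  show "alpha_limit I \<Phi> \<xi> = {\<xi>}"
    unfolding alpha_limit_reverse
    by (rule rev.omega_limit_unique) (use equilibrium[OF assms] in auto)
qed

text \<open>The maximum norm and the Euclidean norm are equivalent, and the neighbourhoods \<open>{x. infdist x Y < \<eta>}\<close> of
  the compact set \<open>Y\<close> are arbitrarily small.\<close>

lemma asymptotically_stable_infdist:
  assumes "compact Y" "Y \<noteq> {}"
    and attract: "\<And>\<epsilon>. 0 < \<epsilon> \<Longrightarrow> \<exists>\<eta>>0. \<forall>x. infdist x Y < \<eta> \<longrightarrow>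
      (\<forall>t\<ge>0. t \<in> I x \<and> infdist (\<Phi> t x) Y < \<epsilon>) \<and> ((\<lambda>t. infdist (\<Phi> t x) Y) \<longlongrightarrow> 0) at_top"
  shows "asymptotically_stable I \<Phi> Y"
proof -
  have nbhd: "open {x. infdist x Y < \<eta>}" "0 < \<eta> \<Longrightarrow> Y \<subseteq> {x. infdist x Y < \<eta>}" for \<eta>
    by (auto intro!: open_Collect_less continuous_intros)
  have "lyapunov_stable I \<Phi> Y"
    unfolding lyapunov_stable_def
  proof (intro allI impI, elim conjE)
    fix U assume U: "open U" "Y \<subseteq> U"
    obtain \<epsilon> where \<epsilon>: "0 < \<epsilon>" "{x. infdist x Y \<le> \<epsilon>} \<subseteq> U"
      using compact_in_open_separated[OF assms(2,1) U] by blast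
    obtain \<eta> where \<eta>: "0 < \<eta>" "\<And>x t. infdist x Y < \<eta> \<Longrightarrow> 0 \<le> t \<Longrightarrow> t \<in> I x \<and> infdist (\<Phi> t x) Y < \<epsilon>"
      using attract[OF \<epsilon>(1)] by blast
    have "t \<in> I x \<and> \<Phi> t x \<in> U" if "infdist x Y < \<eta>" "0 < t" for x t
    proof -
      have "t \<in> I x \<and> infdist (\<Phi> t x) Y < \<epsilon>" using \<eta>(2)[OF that(1)] that(2) by simp
      moreover from this have "\<Phi> t x \<in> {x. infdist x Y \<le> \<epsilon>}" by simp
      ultimately show ?thesis using \<epsilon>(2) by blast
    qed
    thus "\<exists>V. open V \<and> Y \<subseteq> V \<and> (\<forall>x\<in>V. \<forall>t>0. t \<in> I x \<and> \<Phi> t x \<in> U)"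
      using nbhd[of \<eta>] \<eta>(1) by (intro exI[of _ "{x. infdist x Y < \<eta>}"]) simp
  qed
  moreover obtain \<eta> where \<eta>: "0 < \<eta>" "\<forall>x. infdist x Y < \<eta> \<longrightarrow>
      (\<forall>t\<ge>0. t \<in> I x \<and> infdist (\<Phi> t x) Y < 1) \<and> ((\<lambda>t. infdist (\<Phi> t x) Y) \<longlongrightarrow> 0) at_top"
    using attract[OF zero_less_one] by blast
  have "{0<..} \<subseteq> I x \<and> ((\<lambda>t. max_dist (\<Phi> t x) Y) \<longlongrightarrow> 0) at_top" if "infdist x Y < \<eta>" for x
  proof
    have *: "\<forall>t\<ge>0. t \<in> I x \<and> infdist (\<Phi> t x) Y < 1" "((\<lambda>t. infdist (\<Phi> t x) Y) \<longlongrightarrow> 0) at_top"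
      using \<eta>(2) that by blast+
    show "{0<..} \<subseteq> I x" using *(1) by auto
    show "((\<lambda>t. max_dist (\<Phi> t x) Y) \<longlongrightarrow> 0) at_top"
      by (rule Lim_null_comparison[OF _ *(2)])
         (simp add: max_dist_nonneg[OF assms(2)] max_dist_le_infdist[OF assms(1,2)])
  qed
  hence "\<exists>V. open V \<and> Y \<subseteq> V \<and> (\<forall>x\<in>V. {0<..} \<subseteq> I x \<and> ((\<lambda>t. max_dist (\<Phi> t x) Y) \<longlongrightarrow> 0) at_top)"
    using nbhd[of \<eta>] \<eta>(1) by (intro exI[of _ "{x. infdist x Y < \<eta>}"]) simp
  ultimately show ?thesis by (simp add: asymptotically_stable_def)
qed

theorem theorem4p17:
  fixes f :: "real ^ 'n \<Rightarrow> real ^ 'n"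
    and I :: "real ^ 'n \<Rightarrow> real set"
    and \<Phi> :: "real \<Rightarrow> real ^ 'n \<Rightarrow> real ^ 'n"
    and Y :: "(real ^ 'n) set"
    and v :: "real ^ 'n \<Rightarrow> 'n \<Rightarrow> complex ^ 'n"
    and \<delta>' \<delta> :: real
    and A \<rho> :: "real ^ 'n \<Rightarrow> real"
  assumes smooth: "smooth f"
    and flow: "flow_of f I \<Phi>"
    and network: "heteroclinic_network f I \<Phi> Y"
    and robust: "robust f I \<Phi> Y"
    and clean: "clean I \<Phi> Y"
    and basis: "\<And>\<xi>. \<xi> \<in> equilibria_in f Y \<Longrightarrow> eigenbasis f \<xi> (v \<xi>)"
    and box_size: "\<delta>' > 0"
    and disjoint_boxes: "disjoint_family_on (\<lambda>\<xi>. eigenbox (v \<xi>) \<delta>' \<xi>) (equilibria_in f Y)"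
    and nbhd_size: "\<delta> > 0"
    and constants: "\<And>\<xi>. \<xi> \<in> equilibria_in f Y \<Longrightarrow> A \<xi> > 0 \<and> \<rho> \<xi> > 0"
    and estimate: "\<And>\<xi> x \<tau>in \<tau>out. \<xi> \<in> equilibria_in f Y \<Longrightarrow>
           nearby_passage I \<Phi> Y \<delta> (eigenbox (v \<xi>) \<delta>' \<xi>) x \<tau>in \<tau>out \<Longrightarrow>
           max_dist (\<Phi> \<tau>out x) Y < A \<xi> * max_dist (\<Phi> \<tau>in x) Y powr \<rho> \<xi>"
    and cycles: "\<And>xs. heteroclinic_cycle f I \<Phi> xs \<Longrightarrow> cycle_set I \<Phi> xs \<subseteq> Y \<Longrightarrow>
           (\<Prod>\<xi>\<in>set xs. \<rho> \<xi>) > 1"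
  shows "asymptotically_stable I \<Phi> Y"
proof -
  interpret local_flow f I \<Phi>
    by unfold_locales (rule flow, rule smooth_locally_lipschitz[OF smooth])
  let ?E = "equilibria_in f Y"
  let ?B = "\<lambda>\<xi>. eigenbox (v \<xi>) \<delta>' \<xi>"
  obtain K where K: "finite K" "K \<noteq> {}" "\<And>xs. xs \<in> K \<Longrightarrow> heteroclinic_cycle f I \<Phi> xs"
    and Y: "Y = (\<Union>xs\<in>K. cycle_set I \<Phi> xs)"
    using network unfolding heteroclinic_network_def by blast
  have cY: "compact Y" and invY: "flow_invariant I \<Phi> Y"
    and unstable: "\<And>X. X \<subseteq> Y \<Longrightarrow> flow_invariant I \<Phi> X \<Longrightarrow> W_u_set I \<Phi> X \<subseteq> Y"
    using clean unfolding clean_def by blast+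
  have set_Y: "set xs \<subseteq> Y" if "xs \<in> K" for xs using that unfolding Y cycle_set_def by blast
  have hyp_K: "hyperbolic_equilibrium f \<xi>" if "xs \<in> K" "\<xi> \<in> set xs" for xs \<xi>
    using K(3)[OF that(1)] that(2) by (auto simp: heteroclinic_cycle_def)
  obtain xs0 where "xs0 \<in> K" using K(2) by blast
  hence "set xs0 \<noteq> {}" using K(3)[of xs0] by (auto simp: heteroclinic_cycle_def)
  hence neY: "Y \<noteq> {}" using set_Y[OF \<open>xs0 \<in> K\<close>] by auto
  have E_K: "\<xi> \<in> ?E" if "xs \<in> K" "\<xi> \<in> set xs" for xs \<xi>
    using hyp_K[OF that] set_Y[OF that(1)] that(2) by (auto simp: equilibria_in_def hyperbolic_equilibrium_def)
  have limits: "(y \<in> ?E \<and> (\<exists>xs\<in>K. y \<in> set xs)) \<or>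
      (\<exists>xs\<in>K. \<exists>a\<in>set xs. \<exists>b\<in>set xs. alpha_limit I \<Phi> y = {a} \<and> omega_limit I \<Phi> y = {b} \<and> y \<in> connection I \<Phi> a b)"
    if yY: "y \<in> Y" for y
  proof -
    obtain xs where xs: "xs \<in> K" "y \<in> cycle_set I \<Phi> xs" using yY unfolding Y by blast
    show ?thesis
    proof (cases "y \<in> set xs")
      case True
      thus ?thesis using E_K xs(1) by blast
    next
      case False
      then obtain j where j: "j < length xs" "y \<in> connection I \<Phi> (xs ! j) (xs ! (Suc j mod length xs))"
        using xs(2) by (auto simp: cycle_set_def)
      have "0 < length xs" using j(1) by linarith
      hence "Suc j mod length xs < length xs" by (rule mod_less_divisor)
      hence "xs ! j \<in> set xs" "xs ! (Suc j mod length xs) \<in> set xs" using j(1) nth_mem by blast+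
      moreover have "alpha_limit I \<Phi> y = {xs ! j}" "omega_limit I \<Phi> y = {xs ! (Suc j mod length xs)}"
        using j(2) by (auto simp: connection_def W_u_def W_s_def)
      ultimately show ?thesis using xs(1) j(2) by blast
    qed
  qed
  have E_in_K: "\<exists>xs\<in>K. \<xi> \<in> set xs" if "\<xi> \<in> ?E" for \<xi>
  proof -
    have "\<xi> \<in> Y" "f \<xi> = 0" using that by (auto simp: equilibria_in_def)
    from limits[OF this(1)] limits_equilibrium(1)[OF this(2)] show ?thesis by auto
  qed
  have "?E \<subseteq> (\<Union>xs\<in>K. set xs)" using E_in_K by blast
  hence finE: "finite ?E" by (rule finite_subset) (use K(1) in auto)
  have hyp: "hyperbolic_equilibrium f \<xi>" if "\<xi> \<in> ?E" for \<xi> using E_in_K[OF that] hyp_K by blast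
  have zero: "f \<xi> = 0" if "\<xi> \<in> ?E" for \<xi> using that by (simp add: equilibria_in_def)
  have Wu_Y: "W_u I \<Phi> \<xi> \<subseteq> Y" if "\<xi> \<in> ?E" for \<xi>
  proof -
    have "flow_invariant I \<Phi> {\<xi>}" using equilibrium[OF zero[OF that]] by (simp add: flow_invariant_def)
    hence "W_u_set I \<Phi> {\<xi>} \<subseteq> Y" using unstable[of "{\<xi>}"] that by (auto simp: equilibria_in_def)
    thus ?thesis by (auto simp: W_u_def W_u_set_def)
  qed
  have conn_Y: "connection I \<Phi> \<xi> \<eta> \<subseteq> Y" if "\<xi> \<in> ?E" for \<xi> \<eta>
    using Wu_Y[OF that] by (auto simp: connection_def)
  have no_homoclinic: "\<not> connected_to I \<Phi> \<xi> \<xi>" if \<xi>: "\<xi> \<in> ?E" for \<xi>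
  proof
    assume "connected_to I \<Phi> \<xi> \<xi>"
    \<comment> \<open>restricted to this subspace, the derivative at \<open>\<xi>\<close> would have an eigenvalue with positive real part
      although all its eigenvalues have negative real part\<close>
    then obtain S where "saddle_in f S \<xi>" "sink_in f S \<xi>"
      using robust \<xi> conn_Y[OF \<xi>] unfolding robust_def by blast
    thus False unfolding saddle_in_def sink_in_def by force
  qed
  obtain \<theta> \<Lambda> where \<Lambda>: "1 < \<Lambda>" and \<theta>: "\<And>\<xi>. \<xi> \<in> ?E \<Longrightarrow> 0 < \<theta> \<xi>"
    and edge: "\<And>\<xi> \<eta>. \<xi> \<in> ?E \<Longrightarrow> \<eta> \<in> ?E \<Longrightarrow> connected_to I \<Phi> \<xi> \<eta> \<Longrightarrow> \<Lambda> * \<theta> \<xi> \<le> \<rho> \<xi> * \<theta> \<eta>"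
  proof (rule cycle_potential[OF finE, of \<rho> "connected_to I \<Phi>"])
    show "0 < \<rho> \<xi>" if "\<xi> \<in> ?E" for \<xi> using constants[OF that] by simp
    fix xs assume xs: "xs \<noteq> []" "distinct xs" "set xs \<subseteq> ?E"
      "\<And>j. j < length xs \<Longrightarrow> connected_to I \<Phi> (xs ! j) (xs ! (Suc j mod length xs))"
    have "heteroclinic_cycle f I \<Phi> xs" unfolding heteroclinic_cycle_def using xs hyp by blast
    moreover have "cycle_set I \<Phi> xs \<subseteq> Y"
      unfolding cycle_set_def
    proof (intro Un_least UN_least)
      show "set xs \<subseteq> Y" using xs(3) by (auto simp: equilibria_in_def)
      show "connection I \<Phi> (xs ! j) (xs ! (Suc j mod length xs)) \<subseteq> Y" if "j \<in> {..<length xs}" for j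
        using that by (intro conn_Y subsetD[OF xs(3)] nth_mem) simp
    qed
    ultimately show "1 < (\<Prod>\<xi>\<in>set xs. \<rho> \<xi>)" by (rule cycles)
  qed blast
  have der: "\<exists>A. (f has_derivative A) (at \<xi>)" for \<xi>
  proof -
    have "Ck (Suc 0) f" using smooth by (simp add: smooth_def)
    hence "f differentiable_on UNIV" by simp
    thus ?thesis by (simp add: differentiable_on_def differentiable_def)
  qed
  define P where "P \<xi> r \<longleftrightarrow> cball \<xi> (2 * r) \<subseteq> ?B \<xi> \<and> (\<exists>Q Q'. (\<forall>y. (Q has_derivative Q' y) (at y)) \<and>
      (\<forall>y\<in>cball \<xi> r. y \<noteq> \<xi> \<longrightarrow> (0::real) < Q' y (f y)))" for \<xi> r
  have "\<exists>r>0. \<forall>\<xi>\<in>?E. P \<xi> r"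
  proof (rule finite_uniform[OF finE])
    fix \<xi> assume \<xi>: "\<xi> \<in> ?E"
    obtain A where "(f has_derivative A) (at \<xi>)" using der by blast
    then obtain r Q Q' where Q: "0 < r" "\<And>y. (Q has_derivative Q' y) (at y)"
      "\<And>y. y \<in> cball \<xi> r \<Longrightarrow> y \<noteq> \<xi> \<Longrightarrow> (0::real) < Q' y (f y)"
      by (rule hyperbolic_lyapunov_function[OF _ hyp[OF \<xi>] basis[OF \<xi>]]) (rule that)
    have "\<exists>e>0. cball \<xi> e \<subseteq> ?B \<xi>"
      using open_contains_cball[THEN iffD1, OF open_eigenbox[OF basis[OF \<xi>]]] center_in_eigenbox[OF box_size] by blast
    then obtain e where e: "0 < e" "cball \<xi> e \<subseteq> ?B \<xi>" by blast
    have "cball \<xi> (2 * min r (e / 2)) \<subseteq> cball \<xi> e" by (rule subset_cball) simp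
    moreover have "cball \<xi> (min r (e / 2)) \<subseteq> cball \<xi> r" by (rule subset_cball) simp
    ultimately have "P \<xi> (min r (e / 2))" unfolding P_def using Q(2,3) e(2) by blast
    thus "\<exists>r>0. P \<xi> r" using Q(1) e(1) by (intro exI[of _ "min r (e / 2)"]) simp
  next
    fix \<xi> r r' assume "P \<xi> r" "0 < r'" "r' \<le> r"
    moreover have "cball \<xi> (2 * r') \<subseteq> cball \<xi> (2 * r)" "cball \<xi> r' \<subseteq> cball \<xi> r"
      using \<open>r' \<le> r\<close> by (auto intro!: subset_cball)
    ultimately show "P \<xi> r'" unfolding P_def by blast
  qed
  then obtain r where r: "0 < r" "\<And>\<xi>. \<xi> \<in> ?E \<Longrightarrow> P \<xi> r" by blast
  \<comment> \<open>the square root converts the maximum norm into the Euclidean norm; the sum bounds every \<open>A \<xi>\<close>\<close>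
  define A' where "A' = sqrt DIM(real ^ 'n) * (1 + (\<Sum>\<xi>\<in>?E. A \<xi>))"
  have sumA: "0 \<le> (\<Sum>\<xi>\<in>?E. A \<xi>)" using constants by (intro sum_nonneg) (simp add: less_imp_le)
  interpret network_flow f I \<Phi> Y ?E ?B r \<delta> A' \<Lambda> \<theta> \<rho>
  proof unfold_locales
    show "\<Phi> t x \<in> Y" if "x \<in> Y" "t \<in> I x" for x t using invY that by (auto simp: flow_invariant_def)
    show "open (?B \<xi>)" if "\<xi> \<in> ?E" for \<xi> by (rule open_eigenbox[OF basis[OF that]])
    show "?B \<xi> \<inter> ?B \<eta> = {}" if "\<xi> \<in> ?E" "\<eta> \<in> ?E" "\<xi> \<noteq> \<eta>" for \<xi> \<eta>
      using disjoint_boxes that by (auto simp: disjoint_family_on_def)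
    show "cball \<xi> (2 * r) \<subseteq> ?B \<xi>" if "\<xi> \<in> ?E" for \<xi> using r(2)[OF that] by (simp add: P_def)
    show "((\<lambda>t. \<Phi> t x) \<longlongrightarrow> \<xi>) at_top"
      if \<xi>: "\<xi> \<in> ?E" and orbit: "\<And>t. 0 \<le> t \<Longrightarrow> t \<in> I x \<and> \<Phi> t x \<in> cball \<xi> r" for \<xi> x
    proof -
      obtain Q Q' where Q: "\<And>y. (Q has_derivative Q' y) (at y)"
        "\<And>y. y \<in> cball \<xi> r \<Longrightarrow> y \<noteq> \<xi> \<Longrightarrow> (0::real) < Q' y (f y)"
        using r(2)[OF \<xi>] unfolding P_def by blast
      show ?thesis by (rule lyapunov_convergence[OF compact_cball orbit Q zero[OF \<xi>]])
    qed
    show "\<xi> \<in> alpha_limit I \<Phi> x \<and> x \<in> Y \<and> (x \<noteq> \<xi> \<longrightarrow>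
        (\<exists>\<kappa>\<in>?E. \<kappa> \<noteq> \<xi> \<and> \<kappa> \<in> omega_limit I \<Phi> x \<and> \<Lambda> * \<theta> \<xi> \<le> \<rho> \<xi> * \<theta> \<kappa>))"
      if \<xi>: "\<xi> \<in> ?E" and orbit: "\<And>t. t \<le> 0 \<Longrightarrow> t \<in> I x \<and> \<Phi> t x \<in> cball \<xi> r" for \<xi> x
    proof -
      obtain Q Q' where Q: "\<And>y. (Q has_derivative Q' y) (at y)"
        "\<And>y. y \<in> cball \<xi> r \<Longrightarrow> y \<noteq> \<xi> \<Longrightarrow> (0::real) < Q' y (f y)"
        using r(2)[OF \<xi>] unfolding P_def by blast
      have alpha: "alpha_limit I \<Phi> x = {\<xi>}"
        by (rule lyapunov_alpha_limit[OF compact_cball orbit Q zero[OF \<xi>]])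
      hence "x \<in> Y" using Wu_Y[OF \<xi>] by (auto simp: W_u_def)
      moreover have "\<exists>\<kappa>\<in>?E. \<kappa> \<noteq> \<xi> \<and> \<kappa> \<in> omega_limit I \<Phi> x \<and> \<Lambda> * \<theta> \<xi> \<le> \<rho> \<xi> * \<theta> \<kappa>" if "x \<noteq> \<xi>"
      proof -
        have "x \<notin> ?E" using limits_equilibrium(1)[OF zero] alpha that by blast
        then obtain xs a b where xs: "xs \<in> K" "b \<in> set xs" "alpha_limit I \<Phi> x = {a}"
          "omega_limit I \<Phi> x = {b}" "x \<in> connection I \<Phi> a b"
          using limits[OF \<open>x \<in> Y\<close>] by blast
        have "a = \<xi>" using xs(3) alpha by simp
        hence con: "connected_to I \<Phi> \<xi> b" using xs(5) that by (auto simp: connected_to_def)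
        have "b \<in> ?E" using E_K[OF xs(1,2)] .
        moreover have "b \<noteq> \<xi>" using con no_homoclinic[OF \<xi>] by blast
        ultimately show ?thesis using edge[OF \<xi> _ con] xs(4) by blast
      qed
      ultimately show ?thesis using alpha by blast
    qed
    show "\<exists>\<kappa>\<in>?E. \<kappa> \<in> omega_limit I \<Phi> x" if "x \<in> Y" for x
      using limits[OF that] limits_equilibrium(2)[OF zero] E_K by blast
    show "0 < A'" using sumA by (simp add: A'_def)
    show "infdist (\<Phi> e x) Y \<le> A' * infdist (\<Phi> s x) Y powr \<rho> \<xi>"
      if \<xi>: "\<xi> \<in> ?E" and x: "x \<notin> Y" and pass: "passage I \<Phi> (?B \<xi>) x s e"
        and near: "\<And>t. s \<le> t \<Longrightarrow> t \<le> e \<Longrightarrow> infdist (\<Phi> t x) Y < \<delta>" for \<xi> x s e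
    proof -
      have "max_dist (\<Phi> t x) Y < \<delta>" if "t \<in> {s..e}" for t
        using max_dist_le_infdist[OF cY neY, of "\<Phi> t x"] near[of t] that by simp
      moreover have "\<not> (\<lambda>t. \<Phi> t x) ` I x \<subseteq> Y"
        using x zero_in_I[of x] flow_0[of x] by (metis image_subset_iff)
      ultimately have "nearby_passage I \<Phi> Y \<delta> (?B \<xi>) x s e" using pass by (simp add: nearby_passage_def)
      from estimate[OF \<xi> this] have est: "max_dist (\<Phi> e x) Y < A \<xi> * max_dist (\<Phi> s x) Y powr \<rho> \<xi>" .
      have "A \<xi> \<le> (\<Sum>\<xi>\<in>?E. A \<xi>)"
        using \<xi> finE constants by (intro member_le_sum) (auto simp: less_imp_le)
      hence A: "0 \<le> A \<xi>" "A \<xi> \<le> 1 + (\<Sum>\<xi>\<in>?E. A \<xi>)" using constants[OF \<xi>] by auto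
      have "infdist (\<Phi> e x) Y \<le> sqrt DIM(real ^ 'n) * max_dist (\<Phi> e x) Y" by (rule infdist_le_max_dist[OF neY])
      also have "\<dots> \<le> sqrt DIM(real ^ 'n) * (A \<xi> * max_dist (\<Phi> s x) Y powr \<rho> \<xi>)"
        using est by (intro mult_left_mono) auto
      also have "\<dots> \<le> sqrt DIM(real ^ 'n) * ((1 + (\<Sum>\<xi>\<in>?E. A \<xi>)) * infdist (\<Phi> s x) Y powr \<rho> \<xi>)"
        using A constants[OF \<xi>] max_dist_nonneg[OF neY] max_dist_le_infdist[OF cY neY] sumA
        by (intro mult_left_mono mult_mono powr_mono2) auto
      finally show ?thesis by (simp add: A'_def mult.assoc)
    qed
    show "?E \<subseteq> Y" by (auto simp: equilibria_in_def)
    show "0 < \<rho> \<xi>" if "\<xi> \<in> ?E" for \<xi> using constants[OF that] by simp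
  qed (fact cY neY finE zero \<theta> r(1) \<Lambda> nbhd_size)+
  obtain r1 T \<eta>0 where scales: "network_scales f I \<Phi> Y ?E ?B r \<delta> A' \<Lambda> \<theta> \<rho> r1 T \<eta>0"
    by (rule scales_exist)
  interpret network_scales f I \<Phi> Y ?E ?B r \<delta> A' \<Lambda> \<theta> \<rho> r1 T \<eta>0 by (rule scales)
  show ?thesis
  proof (rule asymptotically_stable_infdist[OF cY neY])
    fix \<epsilon> :: real assume "0 < \<epsilon>"
    then obtain \<eta> where "0 < \<eta>" "\<And>x. infdist x Y < \<eta> \<Longrightarrow> stays \<epsilon> x"
      by (rule attracting_neighbourhood) (rule that)
    thus "\<exists>\<eta>>0. \<forall>x. infdist x Y < \<eta> \<longrightarrow>
      (\<forall>t\<ge>0. t \<in> I x \<and> infdist (\<Phi> t x) Y < \<epsilon>) \<and> ((\<lambda>t. infdist (\<Phi> t x) Y) \<longlongrightarrow> 0) at_top"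
      unfolding stays_def by blast
  qed
qed

end
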